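(* Let $\beta\in(0,2]$ and $L>0$ be known, let $K$ satisfy the kernel assumptions, let $\alpha\in(0,1)$ and run FOMT with $C_n(\alpha)=-2\log(\alpha/2)h_n^{-1}$, with complexity measured in elementary arithmetic operations. Then: (i) for all $f\in\Sigma(\beta,L)$, FOMT has worst-case computational complexity $O(n(\log n)^2)$; (ii) if further $f\in\mathcal F_\beta(C\Delta_{\beta,n})$ with $C=(2C_\beta+2L)C_h^{\beta-\lceil\beta\rceil+1}$ and $\Delta_{\beta,n}=(\log n/n)^{(\beta-\lceil\beta\rceil+1)/(2\beta+1)}$, then with asymptotic probability at least $1-\alpha$, FOMT detects the violation (outputs $\Phi=1$) within $$O\Big(\big(\varepsilon_{\lceil\beta\rceil-1,\gamma_n}(f)\big)^{-1}\,n^{\frac{2\beta}{2\beta+1}}(\log n)^{\frac{4\beta+3}{2\beta+1}}\Big)$$ steps, where $\gamma_n=C_\beta h_n^{\beta-\lceil\beta\rceil+1}$.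
   Context: Model: $Y_i=f(x_i)+\varepsilon_i$, $i\in[n]=\{1,\dots,n\}$, $x_i=i/n$, $\varepsilon_i$ i.i.d. $\mathcal N(0,\sigma^2)$ with known $\sigma>0$, $f:[0,1]\to\mathbb R$ unknown. $\Sigma(\beta,L)$: $f$ with $|f^{(\lceil\beta\rceil-1)}(x)-f^{(\lceil\beta\rceil-1)}(y)|\le L|x-y|^{\beta+1-\lceil\beta\rceil}$. $\mathcal M$: nondecreasing functions on $[0,1]$; $\lambda$ = Lebesgue measure. $\mathcal F_\beta(\delta)=\{f\in\Sigma(\beta,L):\max_{0\le a<b\le1}(f(a)-f(b))\ge\delta\}$ if $\beta\le1$, $\{f\in\Sigma(\beta,L):\min_{[0,1]}f'\le-\delta\}$ if $\beta\in(1,2]$. $\gamma$-exceedance fractions: for continuous $f$, $\varepsilon_{0,\gamma}(f)=\min_{g\in\mathcal M}\lambda(\{x\in[0,1]:|f(x)-g(x)|>\gamma\})$; for continuously differentiable $f$, $\varepsilon_{1,\gamma}(f)=\lambda(\{x\in[0,1]:f'(x)\le-\gamma\})$. Kernel assumptions: $K\ge0$, $\int K=1$, support in $[-1,1]$, $K_{\min}\mathbf 1_{\{|u|\le\Delta\}}\le K\le K_{\max}$ with constants $K_{\min},K_{\max},\Delta>0$, $K$ Lipschitz with constant $L_K$, $K$ symmetric; $\mu_2=\int K^2$. LPE of order $k=\lceil\beta\rceil-1$, bandwidth $h$: $U(u)=(1,u,\dots,u^k/k!)^\top$, $\mathcal B_{nx}=\frac1{nh}\sum_iU(\tfrac{x_i-x}h)U(\tfrac{x_i-x}h)^\top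 K(\tfrac{x_i-x}h)$, $\hat f_n(x)=\sum_iW_{ni}(x)Y_i$, $W_{ni}(x)=\frac1{nh}U(0)^\top\mathcal B_{nx}^{-1}U(\tfrac{x_i-x}h)K(\tfrac{x_i-x}h)$. $\lambda_0>0$ lower-bounds the smallest eigenvalue of $\mathcal B_{nx}$ for all $x$, large $n$ (paper: $1/2$ if $\beta\le1$, $0.0228$ if $\beta\in(1,2]$). Constants: $C_*=8K_{\max}/\lambda_0$, $q_1=C_*L/(\lceil\beta\rceil-1)!$, $q_2=16\sigma^2\lceil\beta\rceil\mu_2/\lambda_0^2$, $C_h=(q_2/(4q_1^2\beta))^{1/(2\beta+1)}$, $h_n=C_h(\log n/n)^{1/(2\beta+1)}$; $L_1=\sqrt e(K_{\max}+L_K)$, $L_2=2\lceil\beta\rceil K_{\max}+\lceil\beta\rceil L_K$, $\widetilde C_*=L_1/(8L_2)+\sqrt eK_{\max}/\lambda_0$, $W=\max(4C_*^2,4\widetilde C_*^2)$; $C_\beta=\big((\tfrac{16K_{\max}}{\lambda_0}\vee2)+4\big)L+\sigma\big(\sqrt{4W/C_h^{2\beta+1}}+\sqrt{6W/C_h^{2\beta+1}}\big)$ if $\beta\in(0,1]$, $C_\beta=4L+\frac{16L_2\sigma}{\lambda_0}\sqrt{4W/C_h^{2\beta+1}}$ if $\beta\in(1,2]$. FOMT: $N_{\max}=\frac{40}{\log2}C_n(\alpha)(\log n)^2$; $T_{i,j}=\hat f_n(x_i)-\hat f_n(x_j)$ (bandwidth $h_n$); $C_{n,\alpha,i,j}=\sigma\sqrt{-2\log(\alpha/N_{\max})W}\,n^{-1/2}h_n^{-3/2}(\tfrac{8L_2}{\lambda_0}|x_i-x_j|\wedge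 h_n)$; $D_{n,\beta,i,j}=0$ if $x_i,x_j\in[h_n,1-h_n]$, else $(\tfrac{16K_{\max}}{\lambda_0}\vee2)Lh_n^\beta$; $\Phi_{i,j}=\mathbf 1\{T_{i,j}\ge C_{n,\alpha,i,j}+D_{n,\beta,i,j}\}$. $\Phi$: repeat $C_n(\alpha)$ times: draw $I\sim\mathrm{Unif}([n])$; if $I\le n-1$, repeat $\lceil20\log n\rceil$ times: for $k=0,\dots,\lceil\log_2(n-I)\rceil$ draw $J_k\sim\mathrm{Unif}\{1,\dots,\min(2^k,n-I)\}$, output $\Phi=1$ and stop if $\Phi_{I,I+J_k}=1$; if $I\ge2$, repeat $\lceil20\log n\rceil$ times: for $k=0,\dots,\lceil\log_2(I-1)\rceil$ draw $J'_k\sim\mathrm{Unif}\{1,\dots,\min(2^k,I-1)\}$, output $\Phi=1$ and stop if $\Phi_{I-J'_k,I}=1$; otherwise output $\Phi=0$. Draws independent of each other and of the data. *)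

theory Defs
  imports "HOL-Probability.Probability"
    "Jordan_Normal_Form.Gauss_Jordan_Elimination" "Jordan_Normal_Form.Char_Poly"
begin

record params =
  beta  :: real
  Lc    :: real
  sigma :: real
  Ker   :: "real \<Rightarrow> real"
  Kmin  :: real
  Kmax  :: real
  Dlt   :: real
  LK    :: real
  lam0  :: real              (* eigenvalue lower bound lambda_0 *)

definition kord :: "params \<Rightarrow> nat" where
  "kord p = nat (\<lceil>beta p\<rceil> - 1)"

definition cb :: "params \<Rightarrow> real" where
  "cb p = of_int \<lceil>beta p\<rceil>"

definition mu2 :: "params \<Rightarrow> real" where
  "mu2 p = integral UNIV (\<lambda>u. (Ker p u)\<^sup>2)"

definition kernel_assms :: "params \<Rightarrow> bool" where
  "kernel_assms p \<longleftrightarrow>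
     (\<forall>u. Ker p u \<ge> 0) \<and> (Ker p has_integral 1) UNIV \<and>
     (\<forall>u. \<bar>u\<bar> > 1 \<longrightarrow> Ker p u = 0) \<and>
     Kmin p > 0 \<and> Kmax p > 0 \<and> Dlt p > 0 \<and>
     (\<forall>u. Kmin p * (if \<bar>u\<bar> \<le> Dlt p then 1 else 0) \<le> Ker p u \<and> Ker p u \<le> Kmax p) \<and>
     LK p > 0 \<and> (\<forall>u v. \<bar>Ker p u - Ker p v\<bar> \<le> LK p * \<bar>u - v\<bar>) \<and>
     (\<forall>u. Ker p (- u) = Ker p u)"

definition dF :: "(real \<Rightarrow> real) \<Rightarrow> real \<Rightarrow> real" where
  "dF f x = vector_derivative f (at x within {0..1})"

definition Hoelder :: "real \<Rightarrow> real \<Rightarrow> (real \<Rightarrow> real) \<Rightarrow> bool" where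
  "Hoelder b L f \<longleftrightarrow>
     (if \<lceil>b\<rceil> - 1 = 0 then
        (\<forall>x\<in>{0..1}. \<forall>y\<in>{0..1}. \<bar>f x - f y\<bar> \<le> L * \<bar>x - y\<bar> powr b)
      else if \<lceil>b\<rceil> - 1 = 1 then
        (\<forall>x\<in>{0..1}. f differentiable (at x within {0..1})) \<and>
        (\<forall>x\<in>{0..1}. \<forall>y\<in>{0..1}. \<bar>dF f x - dF f y\<bar> \<le> L * \<bar>x - y\<bar> powr (b - 1))
      else False)"

definition Fclass :: "real \<Rightarrow> real \<Rightarrow> real \<Rightarrow> (real \<Rightarrow> real) set" where
  "Fclass b L \<delta> = {f. Hoelder b L f \<and>
     (if b \<le> 1 then (\<exists>a c. 0 \<le> a \<and> a < c \<and> c \<le> 1 \<and> f a - f c \<ge> \<delta>)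
      else (\<exists>x\<in>{0..1}. dF f x \<le> - \<delta>))}"

definition eps0 :: "real \<Rightarrow> (real \<Rightarrow> real) \<Rightarrow> real" where
  "eps0 \<gamma> f = (INF g\<in>{g :: real \<Rightarrow> real. mono_on {0..1} g}.
                  measure lborel {x\<in>{0..1}. \<bar>f x - g x\<bar> > \<gamma>})"

definition eps1 :: "real \<Rightarrow> (real \<Rightarrow> real) \<Rightarrow> real" where
  "eps1 \<gamma> f = measure lborel {x\<in>{0..1}. dF f x \<le> - \<gamma>}"

definition epsk :: "nat \<Rightarrow> real \<Rightarrow> (real \<Rightarrow> real) \<Rightarrow> real" where
  "epsk k \<gamma> f = (if k = 0 then eps0 \<gamma> f else eps1 \<gamma> f)"

definition xd :: "nat \<Rightarrow> nat \<Rightarrow> real" where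
  "xd n i = real i / real n"

definition data :: "real \<Rightarrow> nat \<Rightarrow> (real \<Rightarrow> real) \<Rightarrow> (nat \<Rightarrow> real) measure" where
  "data \<sigma> n f = PiM {1..n} (\<lambda>i. density lborel (normal_density (f (xd n i)) \<sigma>))"

definition Uv :: "nat \<Rightarrow> real \<Rightarrow> real vec" where
  "Uv k u = vec (k + 1) (\<lambda>j. u ^ j / fact j)"

definition Bmat :: "params \<Rightarrow> nat \<Rightarrow> real \<Rightarrow> real \<Rightarrow> real mat" where
  "Bmat p n h x = (let k = kord p in
     mat (k + 1) (k + 1) (\<lambda>(a, b). (1 / (real n * h)) *
       (\<Sum>i=1..n. (let u = (xd n i - x) / h in u ^ a / fact a * (u ^ b / fact b) * Ker p u))))"

definition Wn :: "params \<Rightarrow> nat \<Rightarrow> real \<Rightarrow> real \<Rightarrow> nat \<Rightarrow> real" where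
  "Wn p n h x i = (let k = kord p; u = (xd n i - x) / h in
     (1 / (real n * h)) * ((Uv k 0 \<bullet> (the (mat_inverse (Bmat p n h x)) *\<^sub>v Uv k u))) * Ker p u)"

definition LPE :: "params \<Rightarrow> nat \<Rightarrow> real \<Rightarrow> (nat \<Rightarrow> real) \<Rightarrow> real \<Rightarrow> real" where
  "LPE p n h Y x = (\<Sum>i=1..n. Wn p n h x i * Y i)"

definition Cstar where "Cstar p = 8 * Kmax p / lam0 p"
definition q1 where "q1 p = Cstar p * Lc p / fact (kord p)"
definition q2 where "q2 p = 16 * (sigma p)\<^sup>2 * cb p * mu2 p / (lam0 p)\<^sup>2"
definition Ch where "Ch p = (q2 p / (4 * (q1 p)\<^sup>2 * beta p)) powr (1 / (2 * beta p + 1))"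
definition hn where "hn p n = Ch p * (ln (real n) / real n) powr (1 / (2 * beta p + 1))"
definition L1 where "L1 p = sqrt (exp 1) * (Kmax p + LK p)"
definition L2 where "L2 p = 2 * cb p * Kmax p + cb p * LK p"
definition Ctil where "Ctil p = L1 p / (8 * L2 p) + sqrt (exp 1) * Kmax p / lam0 p"
definition Wc where "Wc p = max (4 * (Cstar p)\<^sup>2) (4 * (Ctil p)\<^sup>2)"
definition Cbeta where
  "Cbeta p = (if beta p \<le> 1 then
      ((max (16 * Kmax p / lam0 p) 2) + 4) * Lc p
      + sigma p * (sqrt (4 * Wc p / Ch p powr (2 * beta p + 1)) + sqrt (6 * Wc p / Ch p powr (2 * beta p + 1)))
    else 4 * Lc p + 16 * L2 p * sigma p / lam0 p * sqrt (4 * Wc p / Ch p powr (2 * beta p + 1)))"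

definition smexp where "smexp p = beta p - cb p + 1"

definition Cn where "Cn p \<alpha> n = - 2 * ln (\<alpha> / 2) / hn p n"
definition Nmax where "Nmax p \<alpha> n = 40 / ln 2 * Cn p \<alpha> n * (ln (real n))\<^sup>2"

definition Ccrit where
  "Ccrit p \<alpha> n i j = sigma p * sqrt (- 2 * ln (\<alpha> / Nmax p \<alpha> n) * Wc p) * real n powr (-1/2)
     * hn p n powr (-3/2) * min (8 * L2 p / lam0 p * \<bar>xd n i - xd n j\<bar>) (hn p n)"

definition Dcrit where
  "Dcrit p n i j = (if xd n i \<in> {hn p n..1 - hn p n} \<and> xd n j \<in> {hn p n..1 - hn p n} then 0
     else max (16 * Kmax p / lam0 p) 2 * Lc p * hn p n powr beta p)"

definition Phi :: "params \<Rightarrow> real \<Rightarrow> nat \<Rightarrow> (nat \<Rightarrow> real) \<Rightarrow> nat \<Rightarrow> nat \<Rightarrow> bool" where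
  "Phi p \<alpha> n Y i j \<longleftrightarrow>
     LPE p n (hn p n) Y (xd n i) - LPE p n (hn p n) Y (xd n j) \<ge> Ccrit p \<alpha> n i j + Dcrit p n i j"

(* ---------- cost model (elementary arithmetic operations, up to constants) ----------
   Evaluating the LPE at x_i with a kernel supported in [-1,1] costs one unit per design
   point in the window |x_l - x_i| <= h (the order k <= 1 is fixed), plus one; evaluating
   Phi_{i,j} costs the two LPE evaluations plus one (critical values, comparison).
   Every random draw costs one unit. *)
definition lpe_cost :: "nat \<Rightarrow> real \<Rightarrow> nat \<Rightarrow> nat" where
  "lpe_cost n h i = card {l\<in>{1..n}. \<bar>xd n l - xd n i\<bar> \<le> h} + 1"

definition test_cost :: "nat \<Rightarrow> real \<Rightarrow> nat \<Rightarrow> nat \<Rightarrow> nat" where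
  "test_cost n h i j = lpe_cost n h i + lpe_cost n h j + 1"

(* ---------- randomized algorithm: pmf over (output Phi, number of operations spent) ---------- *)
definition seqp :: "(bool \<times> nat) pmf \<Rightarrow> (bool \<times> nat) pmf \<Rightarrow> (bool \<times> nat) pmf" where
  "seqp P Q = bind_pmf P (\<lambda>(b, c). if b then return_pmf (True, c)
                                   else map_pmf (\<lambda>(b', c'). (b', c + c')) Q)"

fun seqs :: "(bool \<times> nat) pmf list \<Rightarrow> (bool \<times> nat) pmf" where
  "seqs [] = return_pmf (False, 0)"
| "seqs (P # Ps) = seqp P (seqs Ps)"

definition rep :: "nat \<Rightarrow> (bool \<times> nat) pmf \<Rightarrow> (bool \<times> nat) pmf" where
  "rep m P = seqs (replicate m P)"

definition FOMT :: "params \<Rightarrow> real \<Rightarrow> nat \<Rightarrow> (nat \<Rightarrow> real) \<Rightarrow> (bool \<times> nat) pmf" where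
  "FOMT p \<alpha> n Y = (let h = hn p n;
       R = nat \<lceil>Cn p \<alpha> n\<rceil>;
       m = nat \<lceil>20 * ln (real n)\<rceil>;
       tf = (\<lambda>I k. bind_pmf (pmf_of_set {1..min (2 ^ k) (n - I)})
               (\<lambda>J. return_pmf (Phi p \<alpha> n Y I (I + J), 1 + test_cost n h I (I + J))));
       tb = (\<lambda>I k. bind_pmf (pmf_of_set {1..min (2 ^ k) (I - 1)})
               (\<lambda>J. return_pmf (Phi p \<alpha> n Y (I - J) I, 1 + test_cost n h (I - J) I)));
       fwd = (\<lambda>I. if I \<le> n - 1 then
                 rep m (seqs (map (tf I) [0..<nat \<lceil>log 2 (real (n - I))\<rceil> + 1]))
               else return_pmf (False, 0));
       bwd = (\<lambda>I. if I \<ge> 2 then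
                 rep m (seqs (map (tb I) [0..<nat \<lceil>log 2 (real (I - 1))\<rceil> + 1]))
               else return_pmf (False, 0));
       outer = bind_pmf (pmf_of_set {1..n})
                 (\<lambda>I. map_pmf (\<lambda>(b, c). (b, c + 1)) (seqp (fwd I) (bwd I)))
     in rep R outer)"

end

(*
Call an index heavy if, for some d, a fixed fraction of the pairs it forms with the d indices next
to it on one side fail the test.  The dyadic sampling meets such a pair at a heavy index with
constant probability per repetition, so a round that draws a heavy index detects the violation
except with tiny probability, and about 1 / epsilon rounds suffice once a fraction epsilon of the
indices is heavy.

By a Gaussian tail bound and a union bound over all pairs, up to probability 1 / n every
difference of estimates is close to its mean; on that event every pair with a decrease of f larger
than critical value + bias + noise fails the test.  For beta <= 1, of two indices i < j at which f
decreases by twice this threshold one is heavy, because every index in between witnesses half of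
the decrease against i or against j; interpolating f at the remaining indices gives a monotone
function that is gamma_n-close to f off the cells of the heavy indices.  For beta > 1, an index at
which f' <= -gamma_n (approximately) is heavy, by the mean value theorem at distance about h_n.
The exceedance fraction is therefore at most the fraction of heavy indices; on the alternative it
is at least h_n, so that the number C_n(alpha) of rounds is large enough.
*)
theory Submission
  imports Defs "HOL-Real_Asymp.Real_Asymp"
begin

section \<open>The algorithm on fixed data\<close>

text \<open>A run may use up far fewer rounds than the algorithm allows, so part (ii) is not a bound
  on the total cost. The run is cut after about 1/epsilon rounds, and cost and failure probability
  up to the cut are controlled together by \<open>miss\<close>; the separation in the alternative
  guarantees that the cut comes before the round limit. The constant \<open>Cbeta\<close> acts as a
  budget, to be read with \<open>noise_scale p * h powr beta p\<close> as the noise unit. For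
  \<beta> \<le> 1 a factor 2 pays for the critical value, a factor \<open>sqrt 6\<close> for the
  random fluctuation, the maximum for the boundary correction, and 4L for bias and discretisation.
  For \<beta> > 1 the budget shows no separate entry for the boundary correction or for the constant
  \<open>Kmax / lam0\<close> in the bias. The calibration of \<open>Ch\<close> then makes the noise
  unit large enough to cover both. Of the admissible error \<alpha>, half is spent on the random
  draws and 1/n on the data.\<close>

definition cost_le :: "real \<Rightarrow> (bool \<times> nat) pmf \<Rightarrow> bool" where
  "cost_le c P \<longleftrightarrow> (\<forall>r\<in>set_pmf P. real (snd r) \<le> c)"

text \<open>Silence and overspending are merged into one failure event, because the claim on steps
  concerns detection within a budget \<open>B\<close>.\<close>

definition miss :: "real \<Rightarrow> (bool \<times> nat) pmf \<Rightarrow> real" where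
  "miss B P = measure_pmf.prob P {r. \<not> (fst r \<and> real (snd r) \<le> B)}"

definition silent :: "(bool \<times> nat) pmf \<Rightarrow> real" where
  "silent P = measure_pmf.prob P {r. \<not> fst r}"

lemma miss_le_1: "miss B P \<le> 1"
  by (simp add: miss_def)

lemma silent_nonneg: "0 \<le> silent P" and silent_le_1: "silent P \<le> 1"
  by (simp_all add: silent_def)

lemma cost_le_mono: "cost_le c P \<Longrightarrow> c \<le> d \<Longrightarrow> cost_le d P"
  by (force simp: cost_le_def)

lemma cost_le_return: "0 \<le> c \<Longrightarrow> cost_le c (return_pmf (b, 0))"
  by (simp add: cost_le_def)

lemma cost_le_seqp:
  assumes "cost_le a P" "cost_le b Q" "0 \<le> b"
  shows "cost_le (a + b) (seqp P Q)"
  using assms unfolding cost_le_def seqp_def by (fastforce split: if_splits)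

lemma cost_le_seqs:
  assumes "\<And>P. P \<in> set Ps \<Longrightarrow> cost_le c P" "0 \<le> c"
  shows "cost_le (real (length Ps) * c) (seqs Ps)"
  using assms
proof (induction Ps)
  case (Cons P Ps)
  have "cost_le (c + real (length Ps) * c) (seqp P (seqs Ps))"
    using Cons by (intro cost_le_seqp) auto
  then show ?case by (simp add: algebra_simps)
qed (simp add: cost_le_return)

lemma cost_le_rep:
  assumes "cost_le c P" "0 \<le> c"
  shows "cost_le (real m * c) (rep m P)"
  using cost_le_seqs[of "replicate m P" c] assms by (simp add: rep_def)

lemma cost_le_bind:
  assumes "\<And>x. x \<in> set_pmf M \<Longrightarrow> cost_le c (F x)"
  shows "cost_le c (bind_pmf M F)"
  using assms by (auto simp: cost_le_def)

lemma cost_le_map_Suc: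
  assumes "cost_le c P" shows "cost_le (c + 1) (map_pmf (\<lambda>(b, c). (b, c + 1)) P)"
  using assms by (fastforce simp: cost_le_def)

lemma prob_bind_pmf:
  "measure_pmf.prob (bind_pmf M F) A = measure_pmf.expectation M (\<lambda>x. measure_pmf.prob (F x) A)"
proof -
  have "ennreal (measure_pmf.prob (bind_pmf M F) A) = (\<integral>\<^sup>+x. emeasure (F x) A \<partial>M)"
    by (simp add: emeasure_bind_pmf flip: measure_pmf.emeasure_eq_measure)
  also have "\<dots> = (\<integral>\<^sup>+x. ennreal (measure_pmf.prob (F x) A) \<partial>M)"
    by (simp add: measure_pmf.emeasure_eq_measure)
  also have "\<dots> = ennreal (measure_pmf.expectation M (\<lambda>x. measure_pmf.prob (F x) A))"
    by (intro nn_integral_eq_integral measure_pmf.integrable_const_bound[where B=1]) auto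
  finally show ?thesis by (simp add: integral_nonneg_AE)
qed

lemma silent_seqp: "silent (seqp P Q) = silent P * silent Q"
proof -
  have "silent (seqp P Q) = measure_pmf.expectation P (\<lambda>r. silent Q * indicator {r. \<not> fst r} r)"
    unfolding seqp_def silent_def prob_bind_pmf
    by (intro integral_cong_AE AE_I2)
       (auto simp: measure_return_pmf indicator_def vimage_def case_prod_unfold)
  then show ?thesis by (simp add: silent_def)
qed

text \<open>If \<open>P\<close> detects, it has spent at most \<open>c\<close>, and
  \<open>0 \<le> B\<close> excludes a miss. If \<open>P\<close> is silent, at most \<open>c\<close>
  is gone and \<open>Q\<close> still has \<open>B\<close> left. So a miss requires silence of
  \<open>P\<close> and an independent miss of \<open>Q\<close>.\<close>

lemma miss_seqp_le:
  assumes P: "cost_le c P" and B: "0 \<le> B"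
  shows "miss (c + B) (seqp P Q) \<le> silent P * miss B Q"
proof -
  have "miss (c + B) (seqp P Q) \<le> measure_pmf.expectation P (\<lambda>r. miss B Q * indicator {r. \<not> fst r} r)"
    unfolding seqp_def prob_bind_pmf miss_def
  proof (rule integral_mono_AE)
    show "AE r in P. measure_pmf.prob (case r of (b, k) \<Rightarrow> if b then return_pmf (True, k)
             else map_pmf (\<lambda>(b', c'). (b', k + c')) Q) {r. \<not> (fst r \<and> real (snd r) \<le> c + B)}
          \<le> measure_pmf.prob Q {r. \<not> (fst r \<and> real (snd r) \<le> B)} * indicator {r. \<not> fst r} r"
    proof (subst AE_measure_pmf_iff, intro ballI)
      fix r assume r: "r \<in> set_pmf P"
      obtain b k where [simp]: "r = (b, k)" by (cases r)
      have k: "real k \<le> c" using P r by (auto simp: cost_le_def)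
      have "measure_pmf.prob (map_pmf (\<lambda>(b', c'). (b', k + c')) Q) {r. \<not> (fst r \<and> real (snd r) \<le> c + B)}
          \<le> measure_pmf.prob Q {r. \<not> (fst r \<and> real (snd r) \<le> B)}"
        using k by (auto intro!: measure_pmf.finite_measure_mono simp: case_prod_unfold)
      then show "measure_pmf.prob (case r of (b, k) \<Rightarrow> if b then return_pmf (True, k)
             else map_pmf (\<lambda>(b', c'). (b', k + c')) Q) {r. \<not> (fst r \<and> real (snd r) \<le> c + B)}
          \<le> measure_pmf.prob Q {r. \<not> (fst r \<and> real (snd r) \<le> B)} * indicator {r. \<not> fst r} r"
        using k B by (auto simp: measure_return_pmf indicator_def)
    qed
  next
    show "integrable (measure_pmf P) (\<lambda>r. measure_pmf.prob Q {r. \<not> (fst r \<and> real (snd r) \<le> B)}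
            * indicator {r. \<not> fst r} r)"
      by (intro integrable_mult_right measure_pmf.integrable_const_bound[where B=1]) (auto simp: indicator_def)
  qed (intro measure_pmf.integrable_const_bound[where B=1], auto)
  then show ?thesis by (simp add: silent_def mult.commute)
qed

text \<open>Only the first \<open>m\<close> of the \<open>M\<close> rounds are charged: a detection
  among them ends the run within \<open>m * c\<close> operations, and for the rest the trivial bound
  1 on \<open>miss\<close> is used. This separates the analysed number of rounds from the number
  allowed.\<close>

lemma miss_rep_le:
  assumes P: "cost_le c P" and c: "0 \<le> c" and m: "m \<le> M"
  shows "miss (real m * c) (rep M P) \<le> silent P ^ m"
  using m
proof (induction m arbitrary: M)
  case 0
  then show ?case by (simp add: miss_le_1)
next
  case (Suc m)
  then obtain M' where M': "M = Suc M'" "m \<le> M'" by (cases M) auto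
  have "miss (real (Suc m) * c) (rep M P) = miss (c + real m * c) (seqp P (rep M' P))"
    by (simp add: M' rep_def algebra_simps)
  also have "\<dots> \<le> silent P * miss (real m * c) (rep M' P)"
    by (intro miss_seqp_le P) (use c in auto)
  also have "\<dots> \<le> silent P * silent P ^ m"
    by (intro mult_left_mono Suc.IH M' silent_nonneg)
  finally show ?case by simp
qed

lemma silent_rep: "silent (rep m P) = silent P ^ m"
  by (induction m) (auto simp: rep_def silent_seqp, simp_all add: silent_def measure_return_pmf)

lemma silent_seqs_le: "P \<in> set Ps \<Longrightarrow> silent (seqs Ps) \<le> silent P"
  by (induction Ps)
     (auto simp: silent_seqp silent_nonneg silent_le_1 mult_left_le mult_left_le_one_le
        intro: order_trans[OF mult_left_le_one_le])

lemma silent_draw: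
  assumes "finite S" "S \<noteq> {}"
  shows "silent (bind_pmf (pmf_of_set S) (\<lambda>J. return_pmf (\<phi> J, c J))) = 1 - real (card {J\<in>S. \<phi> J}) / real (card S)"
proof -
  have "silent (bind_pmf (pmf_of_set S) (\<lambda>J. return_pmf (\<phi> J, c J)))
      = measure_pmf.expectation (pmf_of_set S) (indicator {J. \<not> \<phi> J})"
    unfolding silent_def prob_bind_pmf by (intro Bochner_Integration.integral_cong) (auto simp: measure_return_pmf indicator_def)
  also have "\<dots> = real (card (S \<inter> {J. \<not> \<phi> J})) / real (card S)"
    using assms by (simp add: measure_pmf_of_set)
  also have "S \<inter> {J. \<not> \<phi> J} = S - {J\<in>S. \<phi> J}" by auto
  also have "real (card (S - {J\<in>S. \<phi> J})) / real (card S) = 1 - real (card {J\<in>S. \<phi> J}) / real (card S)"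
    using assms by (subst card_Diff_subset) (auto simp: of_nat_diff card_mono diff_divide_distrib)
  finally show ?thesis .
qed


section \<open>The scans for an abstract pair test and cost function\<close>

definition fwd_level where
  "fwd_level \<phi> tc n I k = bind_pmf (pmf_of_set {1..min (2 ^ k) (n - I)})
     (\<lambda>J. return_pmf (\<phi> I (I + J) :: bool, 1 + tc I (I + J) :: nat))"

definition bwd_level where
  "bwd_level \<phi> tc I k = bind_pmf (pmf_of_set {1..min (2 ^ k) (I - 1)})
     (\<lambda>J. return_pmf (\<phi> (I - J) I :: bool, 1 + tc (I - J) I :: nat))"

definition fwd_scan where
  "fwd_scan m \<phi> tc n I = (if I \<le> n - 1 then
     rep m (seqs (map (fwd_level \<phi> tc n I) [0..<nat \<lceil>log 2 (real (n - I))\<rceil> + 1]))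
   else return_pmf (False, 0))"

definition bwd_scan where
  "bwd_scan m \<phi> tc I = (if I \<ge> 2 then
     rep m (seqs (map (bwd_level \<phi> tc I) [0..<nat \<lceil>log 2 (real (I - 1))\<rceil> + 1]))
   else return_pmf (False, 0))"

definition fomt_round where
  "fomt_round m \<phi> tc n = bind_pmf (pmf_of_set {1..n})
     (\<lambda>I. map_pmf (\<lambda>(b, c). (b, c + 1)) (seqp (fwd_scan m \<phi> tc n I) (bwd_scan m \<phi> tc I)))"

text \<open>The data enter a round only through the pair test, so the analysis of the sampling can
  be carried out for an arbitrary predicate \<open>\<phi>\<close>.\<close>

lemma FOMT_eq_rep_round:
  "FOMT p \<alpha> n Y = rep (nat \<lceil>Cn p \<alpha> n\<rceil>)
     (fomt_round (nat \<lceil>20 * ln (real n)\<rceil>) (Phi p \<alpha> n Y) (test_cost n (hn p n)) n)"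
  unfolding FOMT_def Let_def fomt_round_def fwd_scan_def bwd_scan_def
    fwd_level_def[abs_def] bwd_level_def[abs_def] by (rule refl)

text \<open>The draws only query pairs inside \<open>{1..n}\<close>. This reduces the law of the
  output to a finite table of test outcomes, which measurability rests on.\<close>

lemma fomt_round_cong:
  assumes "n \<ge> 1" and \<phi>: "\<And>i j. i \<in> {1..n} \<Longrightarrow> j \<in> {1..n} \<Longrightarrow> \<phi> i j = \<psi> i j"
  shows "fomt_round m \<phi> tc n = fomt_round m \<psi> tc n"
  unfolding fomt_round_def
proof (rule bind_pmf_cong[OF refl])
  fix I assume "I \<in> set_pmf (pmf_of_set {1..n})"
  then have I: "I \<in> {1..n}" using \<open>n \<ge> 1\<close> by simp
  have "fwd_level \<phi> tc n I k = fwd_level \<psi> tc n I k" if "I \<le> n - 1" for k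
    unfolding fwd_level_def using that I \<open>n \<ge> 1\<close> by (intro bind_pmf_cong) (auto simp: \<phi>)
  moreover have "bwd_level \<phi> tc I k = bwd_level \<psi> tc I k" if "I \<ge> 2" for k
  proof -
    have "\<phi> (I - J) I = \<psi> (I - J) I" if "J \<in> {1..min (2 ^ k) (I - 1)}" for J
      using that I by (intro \<phi>) auto
    then show ?thesis
      unfolding bwd_level_def using that by (intro bind_pmf_cong refl) simp
  qed
  ultimately show "map_pmf (\<lambda>(b, c). (b, c + 1)) (seqp (fwd_scan m \<phi> tc n I) (bwd_scan m \<phi> tc I))
      = map_pmf (\<lambda>(b, c). (b, c + 1)) (seqp (fwd_scan m \<psi> tc n I) (bwd_scan m \<psi> tc I))"
    by (simp add: fwd_scan_def bwd_scan_def cong: map_cong)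
qed

text \<open>The level \<open>k\<close>, the logarithm of \<open>d\<close> rounded up, samples from a
  range that contains \<open>{1..d}\<close> and is at most twice as long, so a share 2/5 of hits
  remains at least 1/5.\<close>

lemma dyadic_level_hit:
  assumes d: "1 \<le> d" "d \<le> N" and hit: "2 / 5 * real d \<le> real (card {J\<in>{1..d}. \<psi> J})"
  obtains k where "k \<le> nat \<lceil>log 2 (real N)\<rceil>"
    "1 / 5 \<le> real (card {J\<in>{1..min (2 ^ k) N}. \<psi> J}) / real (card {1..min (2 ^ k) N})"
proof
  define k where "k = nat \<lceil>log 2 (real d)\<rceil>"
  have l0: "0 \<le> log 2 (real d)" using d by simp
  have "log 2 (real d) \<le> log 2 (real N)" using d by simp
  then show "k \<le> nat \<lceil>log 2 (real N)\<rceil>" unfolding k_def by (intro nat_mono ceiling_mono)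
  have "log 2 (real d) \<le> real k" using l0 unfolding k_def by linarith
  then have "real d \<le> 2 powr real k" using d by (simp add: log_le_iff)
  then have "real d \<le> real (2 ^ k)" by (simp add: powr_realpow)
  then have dk: "d \<le> 2 ^ k" by (simp only: of_nat_le_iff)
  have "real k \<le> log 2 (real d) + 1" using l0 unfolding k_def by linarith
  also have "\<dots> = log 2 (2 * real d)" using d by (simp add: log_mult)
  finally have "2 powr real k \<le> 2 * real d" using d by (simp add: le_log_iff)
  then have kd: "real (2 ^ k) \<le> 2 * real d" by (simp add: powr_realpow)
  have card: "real (card {J\<in>{1..d}. \<psi> J}) \<le> real (card {J\<in>{1..min (2 ^ k) N}. \<psi> J})"
    using dk d by (intro of_nat_mono card_mono) auto
  have le: "real (min (2 ^ k) N) \<le> 2 * real d"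
    using kd by (meson min.cobounded1 of_nat_mono order_trans)
  have pos: "0 < real (min (2 ^ k) N)" using d by simp
  have "1 / 5 * real (min (2 ^ k) N) \<le> real (card {J\<in>{1..min (2 ^ k) N}. \<psi> J})"
    using le card hit by linarith
  then show "1 / 5 \<le> real (card {J\<in>{1..min (2 ^ k) N}. \<psi> J}) / real (card {1..min (2 ^ k) N})"
    using pos by (simp add: le_divide_eq)
qed

text \<open>The fraction \<open>2/5\<close> rather than \<open>1/2\<close> absorbs the rounding of the window length when \<open>\<beta> > 1\<close>.\<close>

definition heavy_fwd :: "(nat \<Rightarrow> nat \<Rightarrow> bool) \<Rightarrow> nat \<Rightarrow> nat \<Rightarrow> bool" where
  "heavy_fwd \<phi> n I \<longleftrightarrow>
     (\<exists>d. 1 \<le> d \<and> d \<le> n - I \<and> 2 / 5 * real d \<le> real (card {J\<in>{1..d}. \<phi> I (I + J)}))"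

definition heavy_bwd :: "(nat \<Rightarrow> nat \<Rightarrow> bool) \<Rightarrow> nat \<Rightarrow> bool" where
  "heavy_bwd \<phi> I \<longleftrightarrow>
     (\<exists>d. 1 \<le> d \<and> d \<le> I - 1 \<and> 2 / 5 * real d \<le> real (card {J\<in>{1..d}. \<phi> (I - J) I}))"

definition heavy :: "(nat \<Rightarrow> nat \<Rightarrow> bool) \<Rightarrow> nat \<Rightarrow> nat \<Rightarrow> bool" where
  "heavy \<phi> n I \<longleftrightarrow> heavy_fwd \<phi> n I \<or> heavy_bwd \<phi> I"

text \<open>Each repetition visits the favourable level, which is silent with probability at most
  4/5. The other levels can only lower this, and the \<open>m\<close> repetitions are
  independent.\<close>

lemma silent_fwd_scan:
  assumes "heavy_fwd \<phi> n I"
  shows "silent (fwd_scan m \<phi> tc n I) \<le> (4 / 5) ^ m"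
proof -
  obtain d where d: "1 \<le> d" "d \<le> n - I" "2 / 5 * real d \<le> real (card {J\<in>{1..d}. \<phi> I (I + J)})"
    using assms by (auto simp: heavy_fwd_def)
  obtain k where k: "k \<le> nat \<lceil>log 2 (real (n - I))\<rceil>"
    "1 / 5 \<le> real (card {J\<in>{1..min (2 ^ k) (n - I)}. \<phi> I (I + J)}) / real (card {1..min (2 ^ k) (n - I)})"
    using dyadic_level_hit[OF d] by blast
  have "silent (fwd_level \<phi> tc n I k) \<le> 4 / 5"
    unfolding fwd_level_def using k d by (subst silent_draw) auto
  moreover have "fwd_level \<phi> tc n I k
      \<in> set (map (fwd_level \<phi> tc n I) [0..<nat \<lceil>log 2 (real (n - I))\<rceil> + 1])"
    using k(1) by (simp del: upt_Suc)
  ultimately have "silent (seqs (map (fwd_level \<phi> tc n I) [0..<nat \<lceil>log 2 (real (n - I))\<rceil> + 1])) \<le> 4 / 5"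
    using silent_seqs_le by (meson order_trans)
  then show ?thesis using d unfolding fwd_scan_def silent_rep
    by (auto simp: silent_rep simp del: upt_Suc intro!: power_mono silent_nonneg)
qed

lemma silent_bwd_scan:
  assumes "heavy_bwd \<phi> I"
  shows "silent (bwd_scan m \<phi> tc I) \<le> (4 / 5) ^ m"
proof -
  obtain d where d: "1 \<le> d" "d \<le> I - 1" "2 / 5 * real d \<le> real (card {J\<in>{1..d}. \<phi> (I - J) I})"
    using assms by (auto simp: heavy_bwd_def)
  obtain k where k: "k \<le> nat \<lceil>log 2 (real (I - 1))\<rceil>"
    "1 / 5 \<le> real (card {J\<in>{1..min (2 ^ k) (I - 1)}. \<phi> (I - J) I}) / real (card {1..min (2 ^ k) (I - 1)})"
    using dyadic_level_hit[OF d] by blast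
  have "silent (bwd_level \<phi> tc I k) \<le> 4 / 5"
    unfolding bwd_level_def using k d by (subst silent_draw) auto
  moreover have "bwd_level \<phi> tc I k
      \<in> set (map (bwd_level \<phi> tc I) [0..<nat \<lceil>log 2 (real (I - 1))\<rceil> + 1])"
    using k(1) by (simp del: upt_Suc)
  ultimately have "silent (seqs (map (bwd_level \<phi> tc I) [0..<nat \<lceil>log 2 (real (I - 1))\<rceil> + 1])) \<le> 4 / 5"
    using silent_seqs_le by (meson order_trans)
  then show ?thesis using d unfolding bwd_scan_def silent_rep
    by (auto simp: silent_rep simp del: upt_Suc intro!: power_mono silent_nonneg)
qed

text \<open>A round draws a heavy index with probability equal to the heavy fraction. From the scans
  only a detection probability of 1/2 is then extracted, which explains the final division by
  2.\<close>

lemma silent_round_le: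
  assumes n: "n \<ge> 1" and m: "m \<ge> 4"
  shows "silent (fomt_round m \<phi> tc n) \<le> 1 - real (card {I\<in>{1..n}. heavy \<phi> n I}) / real n / 2"
proof -
  \<comment> \<open>Four repetitions suffice, as (4/5)^4 = 256/625.\<close>
  have half: "(4 / 5 :: real) ^ m \<le> 1 / 2"
    using power_decreasing[OF m, of "4 / 5 :: real"] by (simp add: power4_eq_xxxx)
  have scan: "silent (seqp (fwd_scan m \<phi> tc n I) (bwd_scan m \<phi> tc I)) \<le> 1 - indicator {I. heavy \<phi> n I} I / 2" for I
  proof (cases "heavy \<phi> n I")
    case True
    then consider "heavy_fwd \<phi> n I" | "heavy_bwd \<phi> I" by (auto simp: heavy_def)
    then have "silent (fwd_scan m \<phi> tc n I) * silent (bwd_scan m \<phi> tc I) \<le> 1 / 2"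
    proof cases
      case 1
      from silent_fwd_scan[OF this, of m tc] half
      have "silent (fwd_scan m \<phi> tc n I) \<le> 1 / 2" by linarith
      then show ?thesis
        using mult_mono[of _ "1/2" _ 1, OF _ silent_le_1] by (simp add: silent_nonneg)
    next
      case 2
      from silent_bwd_scan[OF this, of m tc] half
      have "silent (bwd_scan m \<phi> tc I) \<le> 1 / 2" by linarith
      then show ?thesis
        using mult_mono[of _ 1 _ "1/2", OF silent_le_1] by (simp add: silent_nonneg)
    qed
    then show ?thesis using True by (simp add: silent_seqp)
  qed (simp add: silent_le_1)
  have "silent (fomt_round m \<phi> tc n) = measure_pmf.expectation (pmf_of_set {1..n})
      (\<lambda>I. silent (seqp (fwd_scan m \<phi> tc n I) (bwd_scan m \<phi> tc I)))"
    unfolding fomt_round_def silent_def prob_bind_pmf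
    by (intro Bochner_Integration.integral_cong) (auto simp: vimage_def case_prod_unfold)
  also have "\<dots> \<le> measure_pmf.expectation (pmf_of_set {1..n}) (\<lambda>I. 1 - indicator {I. heavy \<phi> n I} I / 2)"
    using n scan by (intro integral_mono) (auto intro!: integrable_measure_pmf_finite)
  also have "\<dots> = (\<Sum>I\<in>{1..n}. 1 - indicator {I. heavy \<phi> n I} I / 2) / real n"
    using n by (subst integral_pmf_of_set) auto
  also have "\<dots> = 1 - real (card {I\<in>{1..n}. heavy \<phi> n I}) / real n / 2"
    using n by (simp add: sum_subtractf diff_divide_distrib indicator_def of_bool_def sum.If_cases Int_def
        flip: sum_divide_distrib)
  finally show ?thesis .
qed

section \<open>Operation counts of scans and rounds\<close>

lemma cost_le_scan:
  assumes tc: "\<And>i j. i \<in> {1..n} \<Longrightarrow> j \<in> {1..n} \<Longrightarrow> real (tc i j) \<le> T" and I: "I \<in> {1..n}" and T: "0 \<le> T"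
  shows "cost_le (real m * ((log 2 (real n) + 2) * (1 + T))) (fwd_scan m \<phi> tc n I)" (is ?F)
    and "cost_le (real m * ((log 2 (real n) + 2) * (1 + T))) (bwd_scan m \<phi> tc I)" (is ?B)
proof -
  have len: "real (length (map g [0..<nat \<lceil>log 2 (real N)\<rceil> + 1])) * (1 + T) \<le> (log 2 (real n) + 2) * (1 + T)"
    if "1 \<le> N" "N \<le> n" for g :: "nat \<Rightarrow> (bool \<times> nat) pmf" and N
  proof -
    have "0 \<le> log 2 (real N)" "log 2 (real N) \<le> log 2 (real n)" using that by simp_all
    then show ?thesis using T by (intro mult_right_mono) (simp_all, linarith)
  qed
  have pos: "0 \<le> real m * ((log 2 (real n) + 2) * (1 + T))" using T I by simp
  have fwd: "cost_le (1 + T) (fwd_level \<phi> tc n I k)" if "I \<le> n - 1" for k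
    unfolding fwd_level_def
    by (intro cost_le_bind) (use that I tc in \<open>auto simp: cost_le_def\<close>)
  show ?F
  proof (cases "I \<le> n - 1")
    case True
    have "cost_le ((log 2 (real n) + 2) * (1 + T))
        (seqs (map (fwd_level \<phi> tc n I) [0..<nat \<lceil>log 2 (real (n - I))\<rceil> + 1]))"
      by (rule cost_le_mono[OF cost_le_seqs len]) (use fwd True T I in auto)
    then show ?thesis
      unfolding fwd_scan_def if_P[OF True] by (rule cost_le_rep) (use T I in auto)
  next
    case False
    show ?thesis unfolding fwd_scan_def if_not_P[OF False] by (rule cost_le_return[OF pos])
  qed
  have bwd: "cost_le (1 + T) (bwd_level \<phi> tc I k)" if "2 \<le> I" for k
  proof -
    have "real (tc (I - J) I) \<le> T" if "J \<in> {1..min (2 ^ k) (I - 1)}" for J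
      using that I by (intro tc) auto
    then show ?thesis
      unfolding bwd_level_def by (intro cost_le_bind) (use that in \<open>auto simp: cost_le_def\<close>)
  qed
  show ?B
  proof (cases "2 \<le> I")
    case True
    have "cost_le ((log 2 (real n) + 2) * (1 + T))
        (seqs (map (bwd_level \<phi> tc I) [0..<nat \<lceil>log 2 (real (I - 1))\<rceil> + 1]))"
      by (rule cost_le_mono[OF cost_le_seqs len]) (use bwd True T I in auto)
    then show ?thesis
      unfolding bwd_scan_def if_P[OF True] by (rule cost_le_rep) (use T I in auto)
  next
    case False
    show ?thesis unfolding bwd_scan_def if_not_P[OF False] by (rule cost_le_return[OF pos])
  qed
qed

lemma cost_le_round:
  assumes tc: "\<And>i j. i \<in> {1..n} \<Longrightarrow> j \<in> {1..n} \<Longrightarrow> real (tc i j) \<le> T" and n: "n \<ge> 1" and T: "0 \<le> T"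
  shows "cost_le (2 * real m * (log 2 (real n) + 2) * (1 + T) + 1) (fomt_round m \<phi> tc n)"
  unfolding fomt_round_def
proof (rule cost_le_bind)
  fix I assume "I \<in> set_pmf (pmf_of_set {1..n})"
  then have I: "I \<in> {1..n}" using n by simp
  let ?c = "real m * ((log 2 (real n) + 2) * (1 + T))"
  have "cost_le (?c + ?c) (seqp (fwd_scan m \<phi> tc n I) (bwd_scan m \<phi> tc I))"
    using T n by (intro cost_le_seqp cost_le_scan[OF tc I T]) auto
  from cost_le_map_Suc[OF this] have "cost_le (?c + ?c + 1)
      (map_pmf (\<lambda>(b, c). (b, c + 1)) (seqp (fwd_scan m \<phi> tc n I) (bwd_scan m \<phi> tc I)))" .
  then show "cost_le (2 * real m * (log 2 (real n) + 2) * (1 + T) + 1)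
      (map_pmf (\<lambda>(b, c). (b, c + 1)) (seqp (fwd_scan m \<phi> tc n I) (bwd_scan m \<phi> tc I)))"
    by (rule cost_le_mono) (simp add: mult.assoc)
qed

section \<open>Gaussian noise and measurability\<close>

text \<open>Completing the square: tilting the density by \<open>exp (s * (y - \<mu>))\<close> gives
  a multiple of the normal density with mean shifted by \<open>s * \<sigma>\<^sup>2\<close>, whose
  mass is 1.\<close>

lemma nn_integral_exp_normal_density:
  assumes "\<sigma> > 0"
  shows "(\<integral>\<^sup>+y. ennreal (exp (s * (y - \<mu>))) \<partial>density lborel (\<lambda>x. ennreal (normal_density \<mu> \<sigma> x))) = ennreal (exp (s\<^sup>2 * \<sigma>\<^sup>2 / 2))"
proof -
  have shift: "normal_density \<mu> \<sigma> y * exp (s * (y - \<mu>))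
      = exp (s\<^sup>2 * \<sigma>\<^sup>2 / 2) * normal_density (\<mu> + s * \<sigma>\<^sup>2) \<sigma> y" for y
  proof -
    have "- (y - \<mu>)\<^sup>2 / (2 * \<sigma>\<^sup>2) + s * (y - \<mu>)
        = s\<^sup>2 * \<sigma>\<^sup>2 / 2 + (- (y - (\<mu> + s * \<sigma>\<^sup>2))\<^sup>2 / (2 * \<sigma>\<^sup>2))"
      using assms by (simp add: field_simps power2_eq_square)
    then have "exp (- (y - \<mu>)\<^sup>2 / (2 * \<sigma>\<^sup>2)) * exp (s * (y - \<mu>))
        = exp (s\<^sup>2 * \<sigma>\<^sup>2 / 2) * exp (- (y - (\<mu> + s * \<sigma>\<^sup>2))\<^sup>2 / (2 * \<sigma>\<^sup>2))"
      by (simp only: flip: exp_add)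
    then show ?thesis by (simp add: normal_density_def)
  qed
  interpret N: prob_space "density lborel (\<lambda>x. ennreal (normal_density (\<mu> + s * \<sigma>\<^sup>2) \<sigma> x))"
    by (rule prob_space_normal_density[OF assms])
  have one: "(\<integral>\<^sup>+y. ennreal (normal_density (\<mu> + s * \<sigma>\<^sup>2) \<sigma> y) \<partial>lborel) = 1"
    using N.emeasure_space_1 by (simp add: emeasure_density)
  have "(\<integral>\<^sup>+y. ennreal (exp (s * (y - \<mu>))) \<partial>density lborel (\<lambda>x. ennreal (normal_density \<mu> \<sigma> x)))
      = (\<integral>\<^sup>+y. ennreal (exp (s\<^sup>2 * \<sigma>\<^sup>2 / 2)) * ennreal (normal_density (\<mu> + s * \<sigma>\<^sup>2) \<sigma> y) \<partial>lborel)"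
    by (subst nn_integral_density) (auto simp: shift simp flip: ennreal_mult')
  also have "\<dots> = ennreal (exp (s\<^sup>2 * \<sigma>\<^sup>2 / 2))"
    by (subst nn_integral_cmult) (auto simp: one)
  finally show ?thesis .
qed

lemma prob_space_data: "\<sigma> > 0 \<Longrightarrow> prob_space (data \<sigma> n f)"
  unfolding data_def by (intro prob_space_PiM prob_space_normal_density)

lemma measurable_data_component: "i \<in> {1..n} \<Longrightarrow> (\<lambda>Y. Y i) \<in> borel_measurable (data \<sigma> n f)"
  unfolding data_def
  by (rule measurable_compose[OF measurable_component_singleton]) auto

lemma measurable_data_sum:
  "(\<lambda>Y. \<Sum>i=1..n. a i * Y i) \<in> borel_measurable (data \<sigma> n f)"
  by (intro borel_measurable_sum borel_measurable_times borel_measurable_const measurable_data_component)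

text \<open>Chernoff's bound. The variance is replaced by a positive upper bound \<open>V\<close>,
  which also covers vanishing coefficients, as they occur for a pair of equal indices.\<close>

lemma gaussian_lower_tail:
  assumes \<sigma>: "\<sigma> > 0" and t: "t \<ge> 0" and V: "V > 0" "(\<Sum>i=1..n. (a i)\<^sup>2) \<le> V"
  shows "measure (data \<sigma> n f) {Y\<in>space (data \<sigma> n f). (\<Sum>i=1..n. a i * (Y i - f (xd n i))) \<le> - t}
    \<le> exp (- t\<^sup>2 / (2 * \<sigma>\<^sup>2 * V))"
proof -
  let ?M = "\<lambda>i. density lborel (\<lambda>x. ennreal (normal_density (f (xd n i)) \<sigma> x))"
  interpret D: prob_space "data \<sigma> n f" by (rule prob_space_data[OF \<sigma>])
  interpret P: product_prob_space ?M
    by (simp add: product_prob_space_def product_prob_space_axioms_def product_sigma_finite_def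
        prob_space_normal_density[OF \<sigma>] prob_space_imp_sigma_finite)
  \<comment> \<open>The minimiser of the exponent -st + s^2 \<sigma>^2 V / 2.\<close>
  define s where "s = t / (\<sigma>\<^sup>2 * V)"
  have s: "s \<ge> 0" using t V \<sigma> by (simp add: s_def)
  define Z where "Z Y = (\<Sum>i=1..n. a i * (Y i - f (xd n i)))" for Y
  have Z: "Z \<in> borel_measurable (data \<sigma> n f)"
    unfolding Z_def by (intro borel_measurable_sum borel_measurable_times borel_measurable_const
        borel_measurable_diff measurable_data_component)
  have mgf: "(\<integral>\<^sup>+Y. ennreal (exp (- s * Z Y)) \<partial>data \<sigma> n f) \<le> ennreal (exp (s\<^sup>2 * \<sigma>\<^sup>2 * V / 2))"
  proof -
    have "(\<integral>\<^sup>+Y. ennreal (exp (- s * Z Y)) \<partial>data \<sigma> n f)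
        = (\<integral>\<^sup>+Y. (\<Prod>i=1..n. ennreal (exp ((- s * a i) * (Y i - f (xd n i))))) \<partial>PiM {1..n} ?M)"
      unfolding data_def Z_def
      by (intro nn_integral_cong) (simp add: prod_ennreal sum_distrib_left mult.assoc flip: exp_sum)
    also have "\<dots> = (\<Prod>i=1..n. (\<integral>\<^sup>+y. ennreal (exp ((- s * a i) * (y - f (xd n i)))) \<partial>?M i))"
      by (rule P.product_nn_integral_prod) auto
    also have "\<dots> = (\<Prod>i=1..n. ennreal (exp ((- s * a i)\<^sup>2 * \<sigma>\<^sup>2 / 2)))"
      by (simp only: nn_integral_exp_normal_density[OF \<sigma>])
    also have "\<dots> = ennreal (exp (s\<^sup>2 * \<sigma>\<^sup>2 / 2 * (\<Sum>i=1..n. (a i)\<^sup>2)))"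
      by (simp add: prod_ennreal sum_distrib_left power_mult_distrib mult_ac flip: exp_sum)
    also have "\<dots> \<le> ennreal (exp (s\<^sup>2 * \<sigma>\<^sup>2 / 2 * V))"
      using V by (intro ennreal_leI) (auto intro!: mult_left_mono)
    finally show ?thesis by simp
  qed
  have "emeasure (data \<sigma> n f) {Y\<in>space (data \<sigma> n f). 1 \<le> ennreal (exp (- s * t)) * ennreal (exp (- s * Z Y))}
      \<le> ennreal (exp (- s * t)) * (\<integral>\<^sup>+Y. ennreal (exp (- s * Z Y)) * indicator (space (data \<sigma> n f)) Y \<partial>data \<sigma> n f)"
    using Z by (intro nn_integral_Markov_inequality) auto
  also have "(\<integral>\<^sup>+Y. ennreal (exp (- s * Z Y)) * indicator (space (data \<sigma> n f)) Y \<partial>data \<sigma> n f)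
      = (\<integral>\<^sup>+Y. ennreal (exp (- s * Z Y)) \<partial>data \<sigma> n f)"
    by (intro nn_integral_cong) simp
  also have "ennreal (exp (- s * t)) * \<dots> \<le> ennreal (exp (- s * t)) * ennreal (exp (s\<^sup>2 * \<sigma>\<^sup>2 * V / 2))"
    by (intro mult_left_mono mgf) simp
  also have "\<dots> = ennreal (exp (- s * t + s\<^sup>2 * \<sigma>\<^sup>2 * V / 2))"
    by (subst exp_add, subst ennreal_mult') auto
  also have "- s * t + s\<^sup>2 * \<sigma>\<^sup>2 * V / 2 = - t\<^sup>2 / (2 * \<sigma>\<^sup>2 * V)"
    using \<sigma> V by (simp add: s_def field_simps power2_eq_square)
  finally have le: "emeasure (data \<sigma> n f) {Y\<in>space (data \<sigma> n f). 1 \<le> ennreal (exp (- s * t)) * ennreal (exp (- s * Z Y))}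
      \<le> ennreal (exp (- t\<^sup>2 / (2 * \<sigma>\<^sup>2 * V)))" .
  have "emeasure (data \<sigma> n f) {Y\<in>space (data \<sigma> n f). Z Y \<le> - t}
      \<le> emeasure (data \<sigma> n f) {Y\<in>space (data \<sigma> n f). 1 \<le> ennreal (exp (- s * t)) * ennreal (exp (- s * Z Y))}"
  proof (rule emeasure_mono)
    show "{Y\<in>space (data \<sigma> n f). 1 \<le> ennreal (exp (- s * t)) * ennreal (exp (- s * Z Y))} \<in> D.events"
      using Z by measurable
    show "{Y\<in>space (data \<sigma> n f). Z Y \<le> - t}
        \<subseteq> {Y\<in>space (data \<sigma> n f). 1 \<le> ennreal (exp (- s * t)) * ennreal (exp (- s * Z Y))}"
    proof safe
      fix Y assume "Z Y \<le> - t"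
      then have "0 \<le> - s * t + - s * Z Y"
        using mult_left_mono[of "Z Y" "- t" s] s by simp
      then have "1 \<le> ennreal (exp (- s * t + - s * Z Y))" by simp
      then show "1 \<le> ennreal (exp (- s * t)) * ennreal (exp (- s * Z Y))"
        by (subst (asm) exp_add, subst (asm) ennreal_mult') auto
    qed
  qed
  also note le
  finally show ?thesis by (simp add: Z_def D.emeasure_eq_measure)
qed

lemma Phi_measurable:
  "{Y\<in>space (data \<sigma> n f). Phi p \<alpha> n Y i j} \<in> sets (data \<sigma> n f)"
proof -
  have "(\<lambda>Y. LPE p n (hn p n) Y x) \<in> borel_measurable (data \<sigma> n f)" for x
    unfolding LPE_def by (rule measurable_data_sum)
  note [measurable] = this
  show ?thesis unfolding Phi_def by measurable
qed

text \<open>The law of the output depends on the data only through finitely many test outcomes, hence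
  takes finitely many values; this is what makes the integral in the theorem a genuine one.\<close>

lemma FOMT_prob_measurable:
  assumes n: "n \<ge> 1"
  shows "(\<lambda>Y. measure_pmf.prob (FOMT p \<alpha> n Y) A) \<in> borel_measurable (data \<sigma> n f)"
proof -
  let ?M = "data \<sigma> n f"
  let ?I = "{1..n} \<times> {1..n}"
  define key where "key Y = {ij \<in> ?I. Phi p \<alpha> n Y (fst ij) (snd ij)}" for Y
  \<comment> \<open>A representative data vector is chosen for every table \<open>S\<close>. For a
    table of the form \<open>key Y\<close> one exists, namely \<open>Y\<close>, and it yields the
    same law of the output.\<close>
  define G where "G S = measure_pmf.prob (FOMT p \<alpha> n (SOME Y. key Y = S)) A" for S
  have eq: "measure_pmf.prob (FOMT p \<alpha> n Y) A = G (key Y)" for Y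
  proof -
    have key: "key (SOME Y'. key Y' = key Y) = key Y" 
      by (rule someI[where P="\<lambda>Y'. key Y' = key Y"]) (rule refl)
    have "Phi p \<alpha> n Y i j = Phi p \<alpha> n (SOME Y'. key Y' = key Y) i j" if "i \<in> {1..n}" "j \<in> {1..n}" for i j
      using arg_cong[OF key, of "\<lambda>S. (i, j) \<in> S"] that by (simp add: key_def)
    then show ?thesis
      unfolding G_def FOMT_eq_rep_round by (subst fomt_round_cong[OF n]) auto
  qed
  have "key \<in> measurable ?M (count_space (Pow ?I))"
  proof -
    have "key -` {S} \<inter> space ?M \<in> sets ?M" if S: "S \<subseteq> ?I" for S
    proof -
      have "key -` {S} \<inter> space ?M
          = space ?M \<inter> (\<Inter>ij\<in>?I. {Y\<in>space ?M. Phi p \<alpha> n Y (fst ij) (snd ij) = (ij \<in> S)})"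
      proof -
        have "key Y = S \<longleftrightarrow> (\<forall>ij\<in>?I. Phi p \<alpha> n Y (fst ij) (snd ij) = (ij \<in> S))" for Y
          using S unfolding key_def by blast
        then show ?thesis by blast
      qed
      moreover have "{Y\<in>space ?M. Phi p \<alpha> n Y i j = b} \<in> sets ?M" for i j b
        using Phi_measurable[of \<sigma> n f p \<alpha> i j] by (cases b) (auto intro: sets.sets_Collect_neg)
      ultimately show ?thesis
        using n by (auto intro!: sets.Int sets.finite_INT)
    qed
    moreover have "key \<in> space ?M \<rightarrow> Pow ?I" unfolding key_def by blast
    moreover have "finite (Pow ?I)" by simp
    ultimately show ?thesis by (simp only: measurable_count_space_eq2) blast
  qed
  then have "(\<lambda>Y. G (key Y)) \<in> borel_measurable ?M"
    by (rule measurable_compose) simp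
  then show ?thesis by (simp add: eq)
qed

section \<open>Weights of the local polynomial estimator\<close>

lemma kernel_facts:
  assumes "kernel_assms p"
  shows "Ker p u \<ge> 0" "Ker p u \<le> Kmax p" "\<bar>u\<bar> > 1 \<Longrightarrow> Ker p u = 0" "Kmax p > 0" "LK p > 0"
  using assms unfolding kernel_assms_def by blast+

lemma card_window:
  fixes N :: real
  assumes "N \<ge> 0"
  shows "real (card {l\<in>{1..n}. \<bar>real l - real i\<bar> \<le> N}) \<le> 2 * N + 1"
proof -
  have "real (card {l\<in>{1..n}. \<bar>real l - real i\<bar> \<le> N}) = real (card (int ` {l\<in>{1..n}. \<bar>real l - real i\<bar> \<le> N}))"
    by (simp add: card_image)
  also have "\<dots> \<le> real (card {int i - \<lfloor>N\<rfloor>..int i + \<lfloor>N\<rfloor>})"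
  proof (intro of_nat_mono card_mono)
    show "int ` {l\<in>{1..n}. \<bar>real l - real i\<bar> \<le> N} \<subseteq> {int i - \<lfloor>N\<rfloor>..int i + \<lfloor>N\<rfloor>}"
    proof safe
      fix l assume "\<bar>real l - real i\<bar> \<le> N"
      then have "\<bar>int l - int i\<bar> \<le> \<lfloor>N\<rfloor>" by (simp add: le_floor_iff)
      then show "int l \<in> {int i - \<lfloor>N\<rfloor>..int i + \<lfloor>N\<rfloor>}" by auto
    qed
  qed simp
  also have "\<dots> = 2 * of_int \<lfloor>N\<rfloor> + 1" using assms by simp
  also have "\<dots> \<le> 2 * N + 1" by simp
  finally show ?thesis .
qed

lemma card_design_window:
  assumes "n \<ge> 1" "h \<ge> 0"
  shows "real (card {l\<in>{1..n}. \<bar>xd n l - xd n i\<bar> \<le> h}) \<le> 2 * (real n * h) + 1"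
proof -
  have "{l\<in>{1..n}. \<bar>xd n l - xd n i\<bar> \<le> h} = {l\<in>{1..n}. \<bar>real l - real i\<bar> \<le> real n * h}"
  proof -
    have "\<bar>xd n l - xd n i\<bar> = \<bar>real l - real i\<bar> / real n" for l
      using assms by (simp add: xd_def flip: diff_divide_distrib)
    then show ?thesis using assms by (simp add: divide_le_eq mult.commute)
  qed
  then show ?thesis using card_window[of "real n * h" n i] assms by simp
qed

lemma test_cost_le:
  assumes "n \<ge> 1" "h \<ge> 0"
  shows "real (test_cost n h i j) \<le> 4 * (real n * h) + 5"
  using card_design_window[OF assms, of i] card_design_window[OF assms, of j]
  by (simp add: test_cost_def lpe_cost_def)

text \<open>\<open>(r, s)\<close> is the first row of the inverse of the symmetric matrix with rows
  (a, b) and (b, d), and \<open>ev\<close> bounds the roots of its characteristic equation from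
  below by \<open>l\<close>. The claim is the entrywise form of the operator norm bound 1/l,
  obtained here from explicit formulas.\<close>

lemma psd_row_bound:
  fixes a b d r s l :: real
  assumes l: "l > 0" and ev: "\<And>e. (a - e) * (d - e) = b\<^sup>2 \<Longrightarrow> l \<le> e"
    and r: "r * a + s * b = 1" "r * b + s * d = 0"
  shows "\<bar>r\<bar> \<le> 1 / l" "\<bar>s\<bar> \<le> 1 / l"
proof -
  \<comment> \<open>The distance between the two eigenvalues, so that \<open>(a + d - q) / 2\<close>
    is the smaller one.\<close>
  define q where "q = sqrt ((a - d)\<^sup>2 + 4 * b\<^sup>2)"
  have q2: "q\<^sup>2 = (a - d)\<^sup>2 + 4 * b\<^sup>2" by (simp add: q_def)
  have q0: "q \<ge> 0" by (simp add: q_def)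
  have qad: "\<bar>a - d\<bar> \<le> q" "2 * \<bar>b\<bar> \<le> q"
  proof -
    show "\<bar>a - d\<bar> \<le> q" unfolding q_def by (rule real_le_rsqrt) simp
    show "2 * \<bar>b\<bar> \<le> q" unfolding q_def by (rule real_le_rsqrt) (simp add: power_mult_distrib)
  qed
  have "(a - (a + d - q) / 2) * (d - (a + d - q) / 2) = (q\<^sup>2 - (a - d)\<^sup>2) / 4"
    by (simp add: field_simps power2_eq_square)
  also have "\<dots> = b\<^sup>2" by (simp add: q2)
  finally have e: "l \<le> (a + d - q) / 2" by (rule ev)
  have "l \<le> a" using e qad by argo
  moreover have "l \<le> d" using e qad by argo
  ultimately have al: "l \<le> a" "l \<le> d" .
  have psd: "b\<^sup>2 \<le> (a - l) * (d - l)"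
  proof -
    have "q \<le> (a - l) + (d - l)" using e by argo
    then have "q\<^sup>2 \<le> ((a - l) + (d - l))\<^sup>2" using q0 by (rule power_mono)
    then show ?thesis unfolding q2 by (simp add: power2_eq_square algebra_simps)
  qed
  \<comment> \<open>The determinant. Cramer's rule gives \<open>r = d / D\<close> and
    \<open>s = - b / D\<close>, so it remains to compare \<open>D\<close> with \<open>l * d\<close>
    and \<open>l * \<bar>b\<bar>\<close>.\<close>
  define D where "D = a * d - b\<^sup>2"
  have D: "D \<ge> l * (a + d - l)" using psd by (simp add: D_def algebra_simps)
  have "\<bar>b\<bar> + l \<le> a + d - l" using e qad by argo
  then have Db: "l * (\<bar>b\<bar> + l) \<le> D"
    using D mult_left_mono[of "\<bar>b\<bar> + l" "a + d - l" l] l by linarith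
  have Dd: "l * d \<le> D"
    using D mult_left_mono[of d "a + d - l" l] l al by linarith
  have "D > 0" using Db l by (smt (verit, best) mult_pos_pos abs_ge_zero)
  have "r * D = d * (r * a + s * b) - b * (r * b + s * d)" "s * D = a * (r * b + s * d) - b * (r * a + s * b)"
    by (simp_all add: D_def algebra_simps power2_eq_square)
  then have rs: "r * D = d" "s * D = - b" using r by simp_all
  have rD: "\<bar>r\<bar> * D = d" using rs(1) al l \<open>D > 0\<close> by (metis abs_mult abs_of_pos order_less_le_trans)
  have "(\<bar>r\<bar> * l) * D = l * (\<bar>r\<bar> * D)" by simp
  also have "\<dots> \<le> 1 * D" unfolding rD using Dd by simp
  finally have "(\<bar>r\<bar> * l) * D \<le> 1 * D" .
  then show "\<bar>r\<bar> \<le> 1 / l" using \<open>D > 0\<close> l by (simp add: le_divide_eq)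
  have sD: "\<bar>s\<bar> * D = \<bar>b\<bar>" using rs(2) \<open>D > 0\<close> by (metis abs_minus_cancel abs_mult abs_of_pos)
  have "l * \<bar>b\<bar> \<le> D" using Db l by (smt (verit, best) mult_left_mono)
  then have "l * (\<bar>s\<bar> * D) \<le> 1 * D" unfolding sD by simp
  moreover have "(\<bar>s\<bar> * l) * D = l * (\<bar>s\<bar> * D)" by simp
  ultimately have "(\<bar>s\<bar> * l) * D \<le> 1 * D" by linarith
  then show "\<bar>s\<bar> \<le> 1 / l" using \<open>D > 0\<close> l by (simp add: le_divide_eq)
qed

text \<open>Zero is not an eigenvalue, so the determinant does not vanish. This ensures that
  \<open>the (mat_inverse ...)\<close> in \<open>Wn\<close> denotes the actual inverse.\<close>

lemma invertible_of_pos_eigenvalues: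
  fixes A :: "real mat"
  assumes A: "A \<in> carrier_mat m m" and l: "l > 0" and ev: "\<And>e. eigenvalue A e \<Longrightarrow> l \<le> e"
  obtains B where "mat_inverse A = Some B" "B * A = 1\<^sub>m m" "B \<in> carrier_mat m m"
proof (cases "mat_inverse A")
  case None
  have "\<not> eigenvalue A 0" using ev l by force
  moreover have "char_matrix A 0 = A" using A by (intro eq_matI) (auto simp: char_matrix_def)
  ultimately have "det A \<noteq> 0" using A by (simp add: eigenvalue_det)
  then have "A \<in> Units (ring_mat TYPE(real) m ())" by (rule det_non_zero_imp_unit[OF A])
  with mat_inverse(1)[OF A None, of "()"] show ?thesis by blast
next
  case (Some B)
  then show ?thesis using mat_inverse(2)[OF A Some] that by blast
qed

section \<open>Weights as a row of the inverse moment matrix\<close>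

lemma Bmat_carrier: "Bmat p n h x \<in> carrier_mat (kord p + 1) (kord p + 1)"
  by (simp add: Bmat_def Let_def)

text \<open>\<open>Uv k 0\<close> is the first unit vector, since \<open>0 ^ a\<close> vanishes
  except for \<open>a = 0\<close>. The weights therefore involve only row 0 of the inverse.\<close>

lemma Wn_eq_row:
  assumes inv: "mat_inverse (Bmat p n h x) = Some B" and B: "B \<in> carrier_mat (kord p + 1) (kord p + 1)"
  shows "Wn p n h x i = (1 / (real n * h)) *
    (\<Sum>j\<le>kord p. B $$ (0, j) * (((xd n i - x) / h) ^ j / fact j)) * Ker p ((xd n i - x) / h)"
proof -
  let ?u = "(xd n i - x) / h"
  have "Uv (kord p) 0 \<bullet> (B *\<^sub>v Uv (kord p) ?u)
      = (\<Sum>a<kord p + 1. 0 ^ a / fact a * (B *\<^sub>v Uv (kord p) ?u) $ a)"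
    using B by (simp add: scalar_prod_def Uv_def lessThan_atLeast0)
  also have "\<dots> = (B *\<^sub>v Uv (kord p) ?u) $ 0"
    by (subst sum.remove[of _ 0]) (auto intro!: sum.neutral)
  also have "\<dots> = (\<Sum>j\<le>kord p. B $$ (0, j) * (?u ^ j / fact j))"
    using B by (simp add: scalar_prod_def Uv_def lessThan_atLeast0[symmetric] lessThan_Suc_atMost)
  finally show ?thesis by (simp add: Wn_def Let_def inv)
qed

text \<open>Summing weights against a monomial turns row 0 of the inverse into row 0 of
  \<open>B * Bmat\<close>, that is, of the identity. So the estimator reproduces polynomials up to
  its order, which removes the Taylor terms from the bias.\<close>

lemma Wn_reproduces:
  assumes inv: "mat_inverse (Bmat p n h x) = Some B" and B: "B \<in> carrier_mat (kord p + 1) (kord p + 1)"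
    and BA: "B * Bmat p n h x = 1\<^sub>m (kord p + 1)" and b: "b \<le> kord p"
  shows "(\<Sum>i=1..n. Wn p n h x i * (((xd n i - x) / h) ^ b / fact b)) = (if b = 0 then 1 else 0)"
proof -
  let ?u = "\<lambda>i. (xd n i - x) / h"
  let ?v = "\<lambda>i j. ?u i ^ j / fact j"
  have "(\<Sum>i=1..n. Wn p n h x i * ?v i b)
      = (\<Sum>i=1..n. \<Sum>j\<le>kord p. B $$ (0, j) * ((1 / (real n * h)) * (?v i j * ?v i b * Ker p (?u i))))"
    by (simp add: Wn_eq_row[OF inv B] sum_distrib_left sum_distrib_right mult_ac)
  also have "\<dots> = (\<Sum>j\<le>kord p. \<Sum>i=1..n. B $$ (0, j) * ((1 / (real n * h)) * (?v i j * ?v i b * Ker p (?u i))))"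
    by (rule sum.swap)
  also have "\<dots> = (\<Sum>j\<le>kord p. B $$ (0, j) * Bmat p n h x $$ (j, b))"
    using b by (intro sum.cong) (auto simp: Bmat_def Let_def sum_distrib_left)
  also have "\<dots> = (B * Bmat p n h x) $$ (0, b)"
    using B Bmat_carrier[of p n h x] b
    by (simp add: scalar_prod_def lessThan_atLeast0[symmetric] lessThan_Suc_atMost)
  also have "\<dots> = (if b = 0 then 1 else 0)" using b by (simp add: BA)
  finally show ?thesis .
qed

lemma eigenvalue_1x1:
  fixes A :: "real mat"
  assumes "A \<in> carrier_mat 1 1"
  shows "eigenvalue A (A $$ (0, 0))"
proof -
  have "eigenvector A (vec 1 (\<lambda>_. 1)) (A $$ (0, 0))"
    unfolding eigenvector_def using assms by (auto intro!: eq_vecI simp: scalar_prod_def vec_eq_iff)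
  then show ?thesis unfolding eigenvalue_def by blast
qed

text \<open>Off the diagonal case (b, e - a) is an eigenvector; otherwise a unit vector is. This
  connects the hypothesis on \<open>eigenvalue\<close> with the scalar equation used in
  \<open>psd_row_bound\<close>.\<close>

lemma eigenvalue_symmetric_2x2:
  fixes A :: "real mat"
  assumes A: "A \<in> carrier_mat 2 2" and sym: "A $$ (1, 0) = A $$ (0, 1)"
    and e: "(A $$ (0, 0) - e) * (A $$ (1, 1) - e) = (A $$ (0, 1))\<^sup>2"
  shows "eigenvalue A e"
proof -
  define a b d where "a = A $$ (0, 0)" "b = A $$ (0, 1)" "d = A $$ (1, 1)"
  note abd = this
  have "\<exists>r s. (r \<noteq> 0 \<or> s \<noteq> 0) \<and> a * r + b * s = e * r \<and> b * r + d * s = e * s"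
  proof (cases "b = 0")
    case True
    then have "a = e \<or> d = e" using e by (simp add: abd)
    then show ?thesis
    proof
      assume "a = e"
      then show ?thesis using True by (intro exI[of _ 1] exI[of _ 0]) simp
    next
      assume "d = e"
      then show ?thesis using True by (intro exI[of _ 0] exI[of _ 1]) simp
    qed
  next
    case False
    have "b * b + d * (e - a) = e * (e - a)"
      using e unfolding abd[symmetric] by (simp add: power2_eq_square algebra_simps)
    then show ?thesis using False
      by (intro exI[of _ b] exI[of _ "e - a"]) (simp add: algebra_simps)
  qed
  then obtain r s where rs: "r \<noteq> 0 \<or> s \<noteq> 0" "a * r + b * s = e * r" "b * r + d * s = e * s" by blast
  let ?v = "vec 2 (\<lambda>i. if i = 0 then r else s)"
  have "?v \<noteq> 0\<^sub>v 2"
  proof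
    assume "?v = 0\<^sub>v 2"
    then have "?v $ 0 = 0\<^sub>v 2 $ 0" "?v $ 1 = 0\<^sub>v 2 $ 1" by (simp_all only:)
    then show False using rs(1) by simp
  qed
  moreover have entries: "A $$ (0, 0) = a" "A $$ (0, Suc 0) = b" "A $$ (Suc 0, 0) = b" "A $$ (Suc 0, Suc 0) = d"
    using sym by (simp_all add: abd)
  moreover have "A *\<^sub>v ?v = e \<cdot>\<^sub>v ?v"
  proof (rule eq_vecI)
    fix i assume "i < dim_vec (e \<cdot>\<^sub>v ?v)"
    then consider "i = 0" | "i = 1" by force
    then show "(A *\<^sub>v ?v) $ i = (e \<cdot>\<^sub>v ?v) $ i"
      by cases (use A rs(2,3) in \<open>simp_all add: scalar_prod_def entries numeral_2_eq_2\<close>)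
  qed (use A in simp)
  ultimately have "eigenvector A ?v e" unfolding eigenvector_def using A by simp
  then show ?thesis unfolding eigenvalue_def by blast
qed

text \<open>The two sums are polynomial reproduction. In the size bound, row 0 has at most two
  entries, each at most \<open>1 / lam0 p\<close> in absolute value, and inside the window the
  monomials are at most 1. For order 0 the single entry is the reciprocal of a positive number,
  hence the sign of the weights.\<close>

lemma LPE_weight_facts:
  assumes K: "kernel_assms p" and n: "n \<ge> 1" and h: "h > 0" "real n * h \<ge> 1" and k: "kord p \<le> 1"
    and l: "lam0 p > 0" and ev: "\<forall>e. eigenvalue (Bmat p n h (xd n i)) e \<longrightarrow> lam0 p \<le> e"
  shows Wn_sum: "(\<Sum>j=1..n. Wn p n h (xd n i) j) = 1"
    and Wn_sum_linear: "kord p = 1 \<Longrightarrow> (\<Sum>j=1..n. Wn p n h (xd n i) j * (xd n j - xd n i)) = 0"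
    and Wn_support: "\<bar>xd n j - xd n i\<bar> > h \<Longrightarrow> Wn p n h (xd n i) j = 0"
    and Wn_bound: "\<bar>Wn p n h (xd n i) j\<bar> \<le> 2 * Kmax p / (lam0 p * (real n * h))"
    and Wn_nonneg: "kord p = 0 \<Longrightarrow> Wn p n h (xd n i) j \<ge> 0"
proof -
  let ?x = "xd n i" and ?A = "Bmat p n h (xd n i)"
  let ?u = "\<lambda>j. (xd n j - ?x) / h"
  obtain B where B: "mat_inverse ?A = Some B" "B * ?A = 1\<^sub>m (kord p + 1)" "B \<in> carrier_mat (kord p + 1) (kord p + 1)"
    using invertible_of_pos_eigenvalues[OF Bmat_carrier l ev[rule_format]] by blast
  note row = Wn_eq_row[OF B(1,3)] and rep = Wn_reproduces[OF B(1,3,2)]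
  show "(\<Sum>j=1..n. Wn p n h ?x j) = 1" using rep[of 0] by simp
  show "(\<Sum>j=1..n. Wn p n h ?x j * (xd n j - ?x)) = 0" if "kord p = 1"
  proof -
    have "(\<Sum>j=1..n. Wn p n h ?x j * (xd n j - ?x)) = h * (\<Sum>j=1..n. Wn p n h ?x j * (?u j ^ 1 / fact 1))"
      using h by (simp add: sum_distrib_left)
    then show ?thesis using rep[of 1] that by simp
  qed
  show supp: "Wn p n h ?x j = 0" if "\<bar>xd n j - ?x\<bar> > h" for j
  proof -
    have "\<bar>?u j\<bar> > 1" using that h by (simp add: abs_divide)
    then show ?thesis by (simp add: row kernel_facts(3)[OF K])
  qed
  have entry: "(\<Sum>c\<le>kord p. B $$ (0, c) * ?A $$ (c, b)) = (if b = 0 then 1 else 0)" if "b \<le> kord p" for b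
  proof -
    have "(\<Sum>c\<le>kord p. B $$ (0, c) * ?A $$ (c, b)) = (B * ?A) $$ (0, b)"
      using B(3) Bmat_carrier[of p n h ?x] that
      by (simp add: scalar_prod_def lessThan_atLeast0[symmetric] lessThan_Suc_atMost)
    then show ?thesis using that by (simp add: B(2))
  qed
  have r: "\<bar>B $$ (0, c)\<bar> \<le> 1 / lam0 p" if "c \<le> kord p" for c
  proof (cases "kord p = 0")
    case True
    have "lam0 p \<le> ?A $$ (0, 0)"
      using Bmat_carrier[of p n h ?x] True by (intro ev[rule_format] eigenvalue_1x1) simp
    moreover have "B $$ (0, 0) * ?A $$ (0, 0) = 1" using entry[of 0] True by simp
    ultimately have "B $$ (0, 0) = 1 / ?A $$ (0, 0)" "1 / ?A $$ (0, 0) \<le> 1 / lam0 p" "0 \<le> 1 / ?A $$ (0, 0)"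
      using l by (auto simp: field_simps)
    then show ?thesis using that True by simp
  next
    case False
    then have k1: "kord p = 1" using k by simp
    have A: "?A \<in> carrier_mat 2 2" using Bmat_carrier[of p n h ?x] k1 by (simp add: numeral_2_eq_2)
    have sym: "?A $$ (1, 0) = ?A $$ (0, 1)" by (simp add: Bmat_def Let_def k1 mult_ac)
    have eqs: "B $$ (0, 0) * ?A $$ (0, 0) + B $$ (0, 1) * ?A $$ (0, 1) = 1"
      "B $$ (0, 0) * ?A $$ (0, 1) + B $$ (0, 1) * ?A $$ (1, 1) = 0"
      using entry[of 0] entry[of 1] k1 sym by simp_all
    note psd = psd_row_bound[OF l _ eqs]
    have "\<bar>B $$ (0, 0)\<bar> \<le> 1 / lam0 p"
      by (rule psd(1), rule ev[rule_format, OF eigenvalue_symmetric_2x2[OF A sym]])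
    moreover have "\<bar>B $$ (0, 1)\<bar> \<le> 1 / lam0 p"
      by (rule psd(2), rule ev[rule_format, OF eigenvalue_symmetric_2x2[OF A sym]])
    moreover have "c = 0 \<or> c = 1" using that k1 by auto
    ultimately show ?thesis by auto
  qed
  have Kb: "Ker p u \<ge> 0" "Ker p u \<le> Kmax p" for u using kernel_facts[OF K] by auto
  show "\<bar>Wn p n h ?x j\<bar> \<le> 2 * Kmax p / (lam0 p * (real n * h))"
  proof (cases "\<bar>?u j\<bar> \<le> 1")
    case False
    then show ?thesis using n h l kernel_facts(4)[OF K] by (simp add: row kernel_facts(3)[OF K])
  next
    case True
    have "\<bar>\<Sum>c\<le>kord p. B $$ (0, c) * (?u j ^ c / fact c)\<bar> \<le> (\<Sum>c\<le>kord p. 1 / lam0 p)"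
    proof (rule order_trans[OF sum_abs], rule sum_mono)
      fix c assume c: "c \<in> {..kord p}"
      have "\<bar>?u j ^ c / fact c\<bar> \<le> 1"
      proof -
        have "\<bar>?u j\<bar> ^ c \<le> 1" using True by (intro power_le_one) auto
        moreover have "(1::real) \<le> fact c" by (simp add: fact_ge_1)
        ultimately have "\<bar>?u j\<bar> ^ c \<le> fact c" by linarith
        then show ?thesis by (simp add: abs_divide power_abs divide_le_eq)
      qed
      then have "\<bar>B $$ (0, c)\<bar> * \<bar>?u j ^ c / fact c\<bar> \<le> 1 / lam0 p * 1"
        using r[of c] c l by (intro mult_mono) auto
      then show "\<bar>B $$ (0, c) * (?u j ^ c / fact c)\<bar> \<le> 1 / lam0 p" by (simp add: abs_mult)
    qed
    also have "\<dots> \<le> 2 / lam0 p" using k l by (simp add: divide_right_mono)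
    finally have "\<bar>\<Sum>c\<le>kord p. B $$ (0, c) * (?u j ^ c / fact c)\<bar> * Ker p (?u j) \<le> 2 / lam0 p * Kmax p"
      using Kb l by (intro mult_mono) auto
    then have "1 / (real n * h) * (\<bar>\<Sum>c\<le>kord p. B $$ (0, c) * (?u j ^ c / fact c)\<bar> * Ker p (?u j))
        \<le> 1 / (real n * h) * (2 / lam0 p * Kmax p)"
      using n h by (intro mult_left_mono) auto
    moreover have "\<bar>Wn p n h ?x j\<bar>
        = 1 / (real n * h) * (\<bar>\<Sum>c\<le>kord p. B $$ (0, c) * (?u j ^ c / fact c)\<bar> * Ker p (?u j))"
      using n h Kb(1) by (simp add: row abs_mult abs_divide)
    ultimately show ?thesis by (simp add: mult_ac)
  qed
  show "Wn p n h ?x j \<ge> 0" if "kord p = 0"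
  proof -
    have "lam0 p \<le> ?A $$ (0, 0)"
      using Bmat_carrier[of p n h ?x] that by (intro ev[rule_format] eigenvalue_1x1) simp
    moreover have "B $$ (0, 0) * ?A $$ (0, 0) = 1" using entry[of 0] that by simp
    ultimately have "B $$ (0, 0) \<ge> 0" using l by (smt (verit) mult_nonpos_nonneg)
    then show ?thesis using n h Kb(1) that by (simp add: row)
  qed
qed

text \<open>A window contains at most 2nh + 1 \<le> 3nh design points; multiplied by the bound on
  one weight this gives the constant 6, and once more that bound for the squares gives 12. The last
  claim holds because weights summing to 1 cannot have a smaller absolute sum.\<close>

lemma Wn_sum_abs_le:
  assumes K: "kernel_assms p" and n: "n \<ge> 1" and h: "h > 0" "real n * h \<ge> 1" and k: "kord p \<le> 1"
    and l: "lam0 p > 0" and ev: "\<forall>e. eigenvalue (Bmat p n h (xd n i)) e \<longrightarrow> lam0 p \<le> e"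
  shows "(\<Sum>j=1..n. \<bar>Wn p n h (xd n i) j\<bar>) \<le> 6 * Kmax p / lam0 p"
    and "(\<Sum>j=1..n. (Wn p n h (xd n i) j)\<^sup>2) \<le> 12 * (Kmax p / lam0 p)\<^sup>2 / (real n * h)"
    and "lam0 p \<le> 6 * Kmax p"
proof -
  note W = LPE_weight_facts[OF assms]
  let ?S = "{j\<in>{1..n}. \<bar>xd n j - xd n i\<bar> \<le> h}" and ?b = "2 * Kmax p / (lam0 p * (real n * h))"
  have b: "?b \<ge> 0" using l n h kernel_facts(4)[OF K] by simp
  have card: "real (card ?S) \<le> 3 * (real n * h)"
    using card_design_window[OF n, of h i] h by simp
  have "(\<Sum>j=1..n. \<bar>Wn p n h (xd n i) j\<bar>) = (\<Sum>j\<in>?S. \<bar>Wn p n h (xd n i) j\<bar>)"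
    using W(3) by (intro sum.mono_neutral_right) (auto intro: leI)
  also have "\<dots> \<le> real (card ?S) * ?b" using W(4) by (intro sum_bounded_above) auto
  also have "\<dots> \<le> 3 * (real n * h) * ?b" using card b by (intro mult_right_mono) auto
  also have "\<dots> = 6 * Kmax p / lam0 p" using n h by (simp add: field_simps)
  finally show 1: "(\<Sum>j=1..n. \<bar>Wn p n h (xd n i) j\<bar>) \<le> 6 * Kmax p / lam0 p" .
  have "(\<Sum>j=1..n. (Wn p n h (xd n i) j)\<^sup>2) \<le> (\<Sum>j=1..n. ?b * \<bar>Wn p n h (xd n i) j\<bar>)"
  proof (rule sum_mono)
    fix j
    have "(Wn p n h (xd n i) j)\<^sup>2 = \<bar>Wn p n h (xd n i) j\<bar> * \<bar>Wn p n h (xd n i) j\<bar>"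
      by (simp add: power2_eq_square)
    also have "\<dots> \<le> ?b * \<bar>Wn p n h (xd n i) j\<bar>" by (intro mult_right_mono W(4)) simp
    finally show "(Wn p n h (xd n i) j)\<^sup>2 \<le> ?b * \<bar>Wn p n h (xd n i) j\<bar>" .
  qed
  also have "\<dots> = ?b * (\<Sum>j=1..n. \<bar>Wn p n h (xd n i) j\<bar>)" by (simp only: sum_distrib_left)
  also have "\<dots> \<le> ?b * (6 * Kmax p / lam0 p)" using 1 b by (rule mult_left_mono)
  also have "\<dots> = 12 * (Kmax p / lam0 p)\<^sup>2 / (real n * h)" by (simp add: power2_eq_square)
  finally show "(\<Sum>j=1..n. (Wn p n h (xd n i) j)\<^sup>2) \<le> 12 * (Kmax p / lam0 p)\<^sup>2 / (real n * h)" .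
  have "1 = \<bar>\<Sum>j=1..n. Wn p n h (xd n i) j\<bar>" by (simp only: W(1) abs_one)
  also have "\<dots> \<le> (\<Sum>j=1..n. \<bar>Wn p n h (xd n i) j\<bar>)" by (rule sum_abs)
  also note 1
  finally show "lam0 p \<le> 6 * Kmax p" using l by (simp add: le_divide_eq)
qed

section \<open>Heavy indices and exceedance fractions\<close>

text \<open>If the pair \<open>(i, i + t)\<close> drops by less than \<open>g\<close>, then
  \<open>(i + t, j)\<close> drops by more than \<open>g\<close>. The hits seen from \<open>i\<close>
  and from \<open>j\<close> thus number at least \<open>d\<close> together, and the larger count is
  at least half of \<open>d\<close>.\<close>

lemma heavy_endpoint:
  assumes ij: "i \<in> {1..n}" "j \<in> {1..n}" "i < j" and g: "g > 0" and gap: "F i - F j \<ge> 2 * g"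
    and \<phi>: "\<And>i j. i \<in> {1..n} \<Longrightarrow> j \<in> {1..n} \<Longrightarrow> i < j \<Longrightarrow> F i - F j \<ge> (g::real) \<Longrightarrow> \<phi> i j"
  shows "heavy \<phi> n i \<or> heavy \<phi> n j"
proof -
  define d where "d = j - i"
  let ?A = "{J\<in>{1..d}. \<phi> i (i + J)}" and ?B = "{J\<in>{1..d}. \<phi> (j - J) j}"
  have d: "1 \<le> d" "d \<le> n - i" "d \<le> j - 1" using ij by (auto simp: d_def)
  \<comment> \<open>The reflection re-indexes an intermediate point by its distance from
    \<open>j\<close>. The value \<open>t = d\<close> cannot occur, as it is the pair
    \<open>(i, j)\<close> itself, which passes.\<close>
  have "(\<lambda>t. d - t) ` ({1..d} - ?A) \<subseteq> ?B"
  proof safe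
    fix t assume t: "t \<in> {1..d}" "\<not> \<phi> i (i + t)"
    have it: "i + t \<in> {1..n}" "i < i + t" using t d by auto
    have less: "F i - F (i + t) < g" using \<phi>[OF ij(1) it] t by force
    have "t \<noteq> d" using less gap g ij by (auto simp: d_def)
    then have "t < d" using t by auto
    moreover have "\<phi> (i + t) j"
      using less gap ij it \<open>t < d\<close> by (intro \<phi>) (auto simp: d_def)
    moreover have "j - (d - t) = i + t" using ij \<open>t < d\<close> by (auto simp: d_def)
    ultimately show "d - t \<in> {1..d}" "\<phi> (j - (d - t)) j" using t by auto
  qed
  then have "card ((\<lambda>t. d - t) ` ({1..d} - ?A)) \<le> card ?B" by (intro card_mono) auto
  moreover have "inj_on (\<lambda>t. d - t) ({1..d} - ?A)" by (auto simp: inj_on_def)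
  ultimately have "card ({1..d} - ?A) \<le> card ?B" by (simp add: card_image)
  moreover have "card ({1..d} - ?A) = d - card ?A" by (subst card_Diff_subset) auto
  ultimately have "d \<le> card ?A + card ?B" by simp
  then have "2 / 5 * real d \<le> real (card ?A) \<or> 2 / 5 * real d \<le> real (card ?B)" by linarith
  then show ?thesis using d unfolding heavy_def heavy_fwd_def heavy_bwd_def by blast
qed

text \<open>The index of the grid interval, open on the left and closed on the right, that contains
  \<open>x\<close>. The point 0 gets index 0, outside \<open>{1..n}\<close>, hence the conditions
  \<open>0 < x\<close> below.\<close>

definition cell :: "nat \<Rightarrow> real \<Rightarrow> nat" where
  "cell n x = nat \<lceil>real n * x\<rceil>"

lemma cell_facts:
  assumes "n \<ge> 1" "0 < x" "x \<le> 1"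
  shows "cell n x \<in> {1..n}" "\<bar>x - xd n (cell n x)\<bar> \<le> 1 / real n" "xd n (cell n x) \<in> {0..1}"
proof -
  have pos: "0 < real n * x" using assms by simp
  then have c1: "1 \<le> \<lceil>real n * x\<rceil>" by (simp add: one_le_ceiling)
  have "real n * x \<le> real n" using assms by (simp add: mult_left_le)
  then have cn: "\<lceil>real n * x\<rceil> \<le> int n" by (simp add: ceiling_le_iff)
  have "1 \<le> nat \<lceil>real n * x\<rceil>" using c1 by linarith
  moreover have "nat \<lceil>real n * x\<rceil> \<le> n" using cn by linarith
  ultimately show cell: "cell n x \<in> {1..n}" unfolding cell_def atLeastAtMost_iff by blast
  then show "xd n (cell n x) \<in> {0..1}" using assms by (auto simp: xd_def)
  have eq: "real (cell n x) = of_int \<lceil>real n * x\<rceil>" using c1 by (simp add: cell_def)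
  have "real n * x \<le> real (cell n x)" "real (cell n x) \<le> real n * x + 1" unfolding eq by linarith+
  then have "x \<le> xd n (cell n x)" "xd n (cell n x) \<le> x + 1 / real n"
    using assms by (auto simp: xd_def field_simps)
  then show "\<bar>x - xd n (cell n x)\<bar> \<le> 1 / real n" by linarith
qed

lemma cell_mono: "x \<le> y \<Longrightarrow> cell n x \<le> cell n y"
  unfolding cell_def by (intro nat_mono ceiling_mono mult_left_mono) auto

lemma fmeasurable_lborel_Icc: "{a..b :: real} \<in> fmeasurable lborel"
  by (rule fmeasurableI) (auto simp: emeasure_lborel_Icc_eq)

text \<open>Besides the null set \<open>{0}\<close>, the cells indexed by \<open>H\<close> cover
  \<open>S\<close>. No measurability of \<open>S\<close> is assumed: \<open>measure\<close> is 0 on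
  non-measurable sets.\<close>

lemma measure_le_card_cells:
  assumes n: "n \<ge> 1" and H: "H \<subseteq> {1..n}" and S: "S \<subseteq> {0..1}"
    and cover: "\<And>x. x \<in> S \<Longrightarrow> 0 < x \<Longrightarrow> cell n x \<in> H"
  shows "measure lborel S \<le> real (card H) / real n"
proof (cases "S \<in> sets lborel")
  case False
  then show ?thesis by (simp add: measure_notin_sets)
next
  case True
  have fin: "finite H" using H finite_subset by blast
  let ?C = "\<lambda>i. {xd n i - 1 / real n..xd n i}"
  have "S \<subseteq> {0} \<union> (\<Union>i\<in>H. ?C i)"
  proof
    fix x assume x: "x \<in> S"
    show "x \<in> {0} \<union> (\<Union>i\<in>H. ?C i)"
    proof (cases "x = 0")
      case False
      then have x0: "0 < x" "x \<le> 1" using x S by auto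
      have "x \<le> xd n (cell n x)"
        using n x0 by (simp add: xd_def cell_def le_divide_eq mult.commute)
      then have "x \<in> ?C (cell n x)" using cell_facts(2)[OF n x0] by auto
      then show ?thesis using cover[OF x x0(1)] by blast
    qed simp
  qed
  then have "measure lborel S \<le> measure lborel ({0} \<union> (\<Union>i\<in>H. ?C i))"
    using fin fmeasurable_lborel_Icc[of 0 0]
    by (intro measure_mono_fmeasurable True fmeasurable.Un fmeasurable.finite_UN fmeasurable_lborel_Icc) auto
  also have "\<dots> \<le> measure lborel {0::real} + measure lborel (\<Union>i\<in>H. ?C i)"
    using fin by (intro measure_Un_le) auto
  also have "measure lborel (\<Union>i\<in>H. ?C i) \<le> (\<Sum>i\<in>H. measure lborel (?C i))"
    using fin by (intro measure_UNION_le) auto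
  also have "(\<Sum>i\<in>H. measure lborel (?C i)) = real (card H) / real n" by simp
  finally show ?thesis by simp
qed

text \<open>The monotone competitor is the running supremum of \<open>f\<close> over the good cells,
  lowered by \<gamma>. At a good point the supremum is at least \<open>f x\<close>, and at most
  \<open>f x + 2 * \<gamma>\<close> because an earlier good point exceeds \<open>f x\<close> by no
  more than the drop between two grid points plus two oscillations.\<close>

lemma eps0_le_cells:
  assumes n: "n \<ge> 1" and H: "H \<subseteq> {1..n}"
    and bdd: "\<And>x. x \<in> {0..1} \<Longrightarrow> \<bar>f x\<bar> \<le> B"
    and osc: "\<And>x y. x \<in> {0..1} \<Longrightarrow> y \<in> {0..1} \<Longrightarrow> \<bar>x - y\<bar> \<le> 1 / real n \<Longrightarrow> \<bar>f x - f y\<bar> \<le> \<omega>"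
    and good: "\<And>i j. i \<in> {1..n} - H \<Longrightarrow> j \<in> {1..n} - H \<Longrightarrow> i < j \<Longrightarrow> f (xd n i) - f (xd n j) \<le> 2 * \<gamma> - 2 * \<omega>"
    and \<omega>: "\<omega> \<le> \<gamma>"
  shows "eps0 \<gamma> f \<le> real (card H) / real n"
proof -
  define G where "G = {x. 0 < x \<and> x \<le> 1 \<and> cell n x \<notin> H}"
  \<comment> \<open>The lower bound \<open>- B\<close> of \<open>f\<close> keeps the set nonempty
    when no good point lies to the left of \<open>x\<close>.\<close>
  define T where "T x = insert (- B) (f ` {y\<in>G. y \<le> x})" for x
  define g where "g x = Sup (T x) - \<gamma>" for x
  have ub: "t \<le> B" if "t \<in> T x" for t x
  proof -
    have "0 \<le> B" using bdd[of 0] by auto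
    moreover have "f y \<le> B" if "y \<in> G" for y using bdd[of y] that by (auto simp: G_def)
    ultimately show ?thesis using that by (auto simp: T_def)
  qed
  then have bddT: "bdd_above (T x)" for x by (intro bdd_aboveI) auto
  have mono: "mono_on {0..1} g"
    unfolding mono_on_def g_def
    by (intro allI impI diff_right_mono cSup_subset_mono bddT) (auto simp: T_def)
  have near: "\<bar>f x - g x\<bar> \<le> \<gamma>" if x: "x \<in> G" for x
  proof -
    have x01: "0 < x" "x \<le> 1" "cell n x \<in> {1..n} - H"
      using x cell_facts(1)[OF n, of x] by (auto simp: G_def)
    have "f x \<le> Sup (T x)" using x by (intro cSup_upper bddT) (auto simp: T_def)
    moreover have "Sup (T x) \<le> f x + 2 * \<gamma>"
    proof (rule cSup_least)
      fix t assume "t \<in> T x"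
      then consider "t = - B" | y where "y \<in> G" "y \<le> x" "t = f y" by (auto simp: T_def)
      then show "t \<le> f x + 2 * \<gamma>"
      proof cases
        case 1
        have "0 \<le> \<gamma>" using osc[of x x] \<omega> x01 by auto
        then show ?thesis using bdd[of x] x01 1 by auto
      next
        case 2
        then have y01: "0 < y" "y \<le> 1" "cell n y \<in> {1..n} - H"
          using cell_facts(1)[OF n, of y] by (auto simp: G_def)
        have xx: "\<bar>f x - f (xd n (cell n x))\<bar> \<le> \<omega>"
          using x01 cell_facts[OF n x01(1,2)] by (intro osc) auto
        have yy: "\<bar>f y - f (xd n (cell n y))\<bar> \<le> \<omega>"
          using y01 cell_facts[OF n y01(1,2)] by (intro osc) auto
        have "f (xd n (cell n y)) - f (xd n (cell n x)) \<le> 2 * \<gamma> - 2 * \<omega>"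
        proof (cases "cell n y = cell n x")
          case True
          then show ?thesis using \<omega> by simp
        next
          case False
          then have "cell n y < cell n x" using cell_mono[OF 2(2), of n] by simp
          then show ?thesis using good x01 y01 by blast
        qed
        then show ?thesis using xx yy 2 by linarith
      qed
    qed (simp add: T_def)
    ultimately show ?thesis by (auto simp: g_def)
  qed
  have "eps0 \<gamma> f \<le> measure lborel {x\<in>{0..1}. \<bar>f x - g x\<bar> > \<gamma>}"
    unfolding eps0_def using mono by (intro cINF_lower bdd_belowI2[where m=0]) auto
  also have "\<dots> \<le> real (card H) / real n"
  proof (rule measure_le_card_cells[OF n H])
    fix x assume "x \<in> {x\<in>{0..1}. \<bar>f x - g x\<bar> > \<gamma>}" "0 < x"
    then show "cell n x \<in> H" using near[of x] by (auto simp: G_def)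
  qed auto
  finally show ?thesis .
qed

lemma eps1_le_cells:
  assumes n: "n \<ge> 1"
    and osc: "\<And>x y. x \<in> {0..1} \<Longrightarrow> y \<in> {0..1} \<Longrightarrow> \<bar>x - y\<bar> \<le> 1 / real n \<Longrightarrow> \<bar>dF f x - dF f y\<bar> \<le> \<omega>"
  shows "eps1 \<gamma> f \<le> real (card {i\<in>{1..n}. dF f (xd n i) \<le> - (\<gamma> - \<omega>)}) / real n"
  unfolding eps1_def
proof (rule measure_le_card_cells[OF n])
  fix x assume x: "x \<in> {x\<in>{0..1}. dF f x \<le> - \<gamma>}" "0 < x"
  then have "\<bar>dF f x - dF f (xd n (cell n x))\<bar> \<le> \<omega>"
    using cell_facts[OF n, of x] by (intro osc) auto
  then show "cell n x \<in> {i\<in>{1..n}. dF f (xd n i) \<le> - (\<gamma> - \<omega>)}"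
    using x cell_facts(1)[OF n, of x] by auto
qed auto

section \<open>Lower bounds on the exceedance fractions\<close>

lemma continuous_on_Hoelder:
  fixes f :: "real \<Rightarrow> real"
  assumes b: "b > 0" and f: "\<And>x y. x \<in> S \<Longrightarrow> y \<in> S \<Longrightarrow> \<bar>f x - f y\<bar> \<le> L * \<bar>x - y\<bar> powr b"
  shows "continuous_on S f"
  unfolding continuous_on_def
proof
  fix x assume x: "x \<in> S"
  have "((\<lambda>y. L * \<bar>y - x\<bar> powr b) \<longlongrightarrow> L * \<bar>x - x\<bar> powr b) (at x within S)"
    using b by (intro tendsto_intros tendsto_powr') (auto intro!: always_eventually)
  then have "((\<lambda>y. L * \<bar>y - x\<bar> powr b) \<longlongrightarrow> 0) (at x within S)" using b by simp
  moreover have "\<forall>\<^sub>F y in at x within S. norm (f y - f x) \<le> L * \<bar>y - x\<bar> powr b"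
    using f x by (auto simp: eventually_at_filter)
  ultimately have "((\<lambda>y. f y - f x) \<longlongrightarrow> 0) (at x within S)" by (rule Lim_null_comparison[rotated])
  then show "(f \<longlongrightarrow> f x) (at x within S)" by (simp add: LIM_zero_iff)
qed

lemma interval_near:
  assumes "c \<in> {0..1}" "0 < h" "h \<le> 1 / 2"
  obtains u where "{u<..<u + h} \<subseteq> {0..1::real}" "\<And>x. x \<in> {u<..<u + h} \<Longrightarrow> \<bar>x - c\<bar> < h"
proof (cases "c \<le> 1 / 2")
  case True
  show ?thesis by (rule that[of c]) (use True assms in auto)
next
  case False
  show ?thesis by (rule that[of "c - h"]) (use False assms in auto)
qed

text \<open>For a lower bound this is essential: a non-measurable exceedance set would contribute
  \<open>measure\<close> 0 to the infimum defining \<open>eps0\<close>.\<close>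

lemma measurable_exceedance:
  fixes f g :: "real \<Rightarrow> real"
  assumes "continuous_on {0..1} f" "mono_on {0..1} g"
  shows "{x\<in>{0..1}. \<bar>f x - g x\<bar> > \<gamma>} \<in> sets lborel"
proof -
  have [measurable]: "f \<in> borel_measurable (restrict_space borel {0..1})"
    using assms(1) by (rule borel_measurable_continuous_on_restrict)
  have [measurable]: "g \<in> borel_measurable (restrict_space borel {0..1})"
    using assms(2) by (rule borel_measurable_mono_on_fnc)
  have "{x\<in>space (restrict_space borel {0..1}). \<bar>f x - g x\<bar> > \<gamma>} \<in> sets (restrict_space borel {0..1})"
    by measurable
  then show ?thesis by (simp add: sets_restrict_space_iff space_restrict_space)
qed

text \<open>If both an interval of length \<open>h\<close> near \<open>a\<close> and one near
  \<open>c\<close> contained a point where \<open>g\<close> is \<gamma>-close to \<open>f\<close>,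
  monotonicity of \<open>g\<close> would limit the drop between these points to 2 \<gamma>, whereas
  Hoelder continuity leaves more than that. So one interval lies entirely in the exceedance
  set.\<close>

lemma eps0_ge:
  assumes b: "0 < b" "b \<le> 1" and L: "L > 0" and h: "0 < h" "h \<le> 1 / 2" and \<gamma>: "\<gamma> \<ge> 0"
    and f: "\<And>x y. x \<in> {0..1} \<Longrightarrow> y \<in> {0..1} \<Longrightarrow> \<bar>f x - f y\<bar> \<le> L * \<bar>x - y\<bar> powr b"
    and ac: "0 \<le> a" "a < c" "c \<le> 1" and drop: "f a - f c \<ge> 2 * \<gamma> + 2 * L * h powr b"
  shows "eps0 \<gamma> f \<ge> h"
  unfolding eps0_def
proof (rule cINF_greatest)
  show "{g :: real \<Rightarrow> real. mono_on {0..1} g} \<noteq> {}" by (auto intro!: exI[of _ "\<lambda>_. 0"] simp: mono_on_def)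
  fix g :: "real \<Rightarrow> real" assume "g \<in> {g. mono_on {0..1} g}"
  then have g: "mono_on {0..1} g" by simp
  let ?E = "{x\<in>{0..1}. \<bar>f x - g x\<bar> > \<gamma>}"
  have E: "?E \<in> sets lborel"
    by (rule measurable_exceedance[OF continuous_on_Hoelder g]) (use b f in auto)
  have "2 * L * h powr b \<le> L * (c - a) powr b"
    using drop f[of a c] ac \<gamma> by auto
  then have "2 * h powr b \<le> (c - a) powr b" using L by simp
  \<comment> \<open>This gives \<open>2 * h \<le> c - a\<close>, which places the two points in the
    right order; \<open>b \<le> 1\<close> enters through \<open>2 powr b \<le> 2\<close>.\<close>
  moreover have "(2 * h) powr b \<le> 2 * h powr b"
    using b h powr_mono[of b 1 2] by (simp add: powr_mult mult_right_mono)
  ultimately have "(2 * h) powr b \<le> (c - a) powr b" by linarith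
  then have sep: "2 * h \<le> c - a" using b h ac by (meson powr_less_mono2 not_le diff_ge_0_iff_ge less_imp_le)
  obtain u where u: "{u<..<u + h} \<subseteq> {0..1}" "\<And>x. x \<in> {u<..<u + h} \<Longrightarrow> \<bar>x - a\<bar> < h"
    using interval_near[of a h] ac h by auto
  obtain v where v: "{v<..<v + h} \<subseteq> {0..1}" "\<And>x. x \<in> {v<..<v + h} \<Longrightarrow> \<bar>x - c\<bar> < h"
    using interval_near[of c h] ac h by auto
  have "{u<..<u + h} \<subseteq> ?E \<or> {v<..<v + h} \<subseteq> ?E"
  proof (rule ccontr)
    assume "\<not> ?thesis"
    then obtain x y where x: "x \<in> {u<..<u + h}" "x \<notin> ?E" and y: "y \<in> {v<..<v + h}" "y \<notin> ?E" by blast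
    have xy01: "x \<in> {0..1}" "y \<in> {0..1}" using x y u v by blast+
    have dist: "\<bar>x - a\<bar> < h" "\<bar>y - c\<bar> < h" using x y u v by blast+
    have "\<bar>x - a\<bar> powr b < h powr b" "\<bar>y - c\<bar> powr b < h powr b"
      using dist b by (auto intro!: powr_less_mono2)
    then have "L * \<bar>x - a\<bar> powr b < L * h powr b" "L * \<bar>y - c\<bar> powr b < L * h powr b" using L by auto
    moreover have "\<bar>f x - f a\<bar> \<le> L * \<bar>x - a\<bar> powr b" "\<bar>f y - f c\<bar> \<le> L * \<bar>y - c\<bar> powr b"
      using f xy01 ac by auto
    moreover have "\<bar>f x - g x\<bar> \<le> \<gamma>" "\<bar>f y - g y\<bar> \<le> \<gamma>" using x y xy01 by auto
    moreover have "g x \<le> g y" using dist sep xy01 by (intro mono_onD[OF g]) auto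
    ultimately show False using drop by (simp add: abs_le_iff)
  qed
  moreover have "h \<le> measure lborel ?E" if "{w<..<w + h} \<subseteq> ?E" for w
  proof -
    have "measure lborel {w<..<w + h} \<le> measure lborel ?E"
    proof (rule measure_mono_fmeasurable[OF that])
      show "?E \<in> fmeasurable lborel"
        by (rule fmeasurableI2[OF fmeasurable_lborel_Icc[of 0 1] _ E]) blast
    qed simp
    then show ?thesis using h by simp
  qed
  ultimately show "h \<le> measure lborel ?E" by blast
qed

lemma eps1_ge:
  assumes s: "0 < s" and L: "L > 0" and h: "0 < h" "h \<le> 1 / 2"
    and f: "\<And>x y. x \<in> {0..1} \<Longrightarrow> y \<in> {0..1} \<Longrightarrow> \<bar>dF f x - dF f y\<bar> \<le> L * \<bar>x - y\<bar> powr s"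
    and c: "c \<in> {0..1}" "dF f c \<le> - (\<gamma> + L * h powr s)"
  shows "eps1 \<gamma> f \<ge> h"
proof -
  let ?E = "{x\<in>{0..1}. dF f x \<le> - \<gamma>}"
  have "continuous_on {0..1} (dF f)" by (rule continuous_on_Hoelder[OF s f])
  then have [measurable]: "dF f \<in> borel_measurable (restrict_space borel {0..1})"
    by (rule borel_measurable_continuous_on_restrict)
  have "{x\<in>space (restrict_space borel {0..1}). dF f x \<le> - \<gamma>} \<in> sets (restrict_space borel {0..1})"
    by measurable
  then have E: "?E \<in> sets lborel" by (simp add: sets_restrict_space_iff space_restrict_space)
  obtain u where u: "{u<..<u + h} \<subseteq> {0..1}" "\<And>x. x \<in> {u<..<u + h} \<Longrightarrow> \<bar>x - c\<bar> < h"
    using interval_near[of c h] c h by auto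
  have sub: "{u<..<u + h} \<subseteq> ?E"
  proof
    fix x assume x: "x \<in> {u<..<u + h}"
    then have x01: "x \<in> {0..1}" using u by blast
    have "\<bar>x - c\<bar> powr s \<le> h powr s" using u(2)[OF x] s by (intro powr_mono2) auto
    then have "L * \<bar>x - c\<bar> powr s \<le> L * h powr s" using L by simp
    then have "dF f x \<le> - \<gamma>" using f[OF x01 c(1)] c(2) by (simp add: abs_le_iff)
    then show "x \<in> ?E" using x01 by simp
  qed
  have "measure lborel {u<..<u + h} \<le> measure lborel ?E"
  proof (rule measure_mono_fmeasurable[OF sub])
    show "?E \<in> fmeasurable lborel" by (rule fmeasurableI2[OF fmeasurable_lborel_Icc[of 0 1] _ E]) blast
  qed simp
  then show ?thesis using h by (simp add: eps1_def)
qed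

section \<open>Constants\<close>

text \<open>The lower bound on \<open>mu2\<close> makes \<open>q2\<close>, and with it the
  bandwidth, positive. The other two combine to \<open>mu2 p \<le> 2 * (Kmax p)\<^sup>2\<close>,
  needed to compare noise and bias.\<close>

lemma kernel_L2_norm:
  assumes K: "kernel_assms p"
  shows "mu2 p \<ge> 1 / 2" "mu2 p \<le> Kmax p" "Kmax p \<ge> 1 / 2"
proof -
  have lip: "\<bar>Ker p u - Ker p v\<bar> \<le> LK p * \<bar>u - v\<bar>" for u v using K unfolding kernel_assms_def by blast
  have "continuous_on {-1..1} (Ker p)"
    by (rule continuous_on_Hoelder[of 1 _ _ "LK p"]) (use lip in auto)
  then have "(\<lambda>u. (Ker p u)\<^sup>2) integrable_on {-1..1}"
    by (intro integrable_continuous_interval continuous_intros)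
  then obtain m where m: "((\<lambda>u. (Ker p u)\<^sup>2) has_integral m) {-1..1}" by blast
  have zero: "Ker p u = 0" if "u \<notin> {-1..1}" for u using kernel_facts(3)[OF K, of u] that by auto
  have "(\<lambda>u. if u \<in> {-1..1} then (Ker p u)\<^sup>2 else 0) = (\<lambda>u. (Ker p u)\<^sup>2)"
    using zero by (auto simp: fun_eq_iff)
  with m have "((\<lambda>u. (Ker p u)\<^sup>2) has_integral m) UNIV" by (metis has_integral_restrict_UNIV)
  then have mu: "mu2 p = m" unfolding mu2_def by (rule integral_unique)
  have "(Ker p has_integral 1) UNIV" using K unfolding kernel_assms_def by blast
  moreover have "(\<lambda>u. if u \<in> {-1..1} then Ker p u else 0) = Ker p" using zero by (auto simp: fun_eq_iff)
  ultimately have one: "(Ker p has_integral 1) {-1..1}" by (metis has_integral_restrict_UNIV)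
  have const: "((\<lambda>u::real. c) has_integral 2 * c) {-1..1}" for c :: real
    using has_integral_const_real[of c "-1" 1] by simp
  \<comment> \<open>Integrating \<open>K\<^sup>2 \<ge> K - 1/4\<close>, i.e. \<open>(K - 1/2)\<^sup>2 \<ge> 0\<close>.\<close>
  have "1 - 2 * (1 / 4) \<le> m"
  proof (rule has_integral_le[OF has_integral_diff[OF one const] m])
    fix u
    have "0 \<le> (Ker p u - 1 / 2)\<^sup>2" by simp
    then show "Ker p u - 1 / 4 \<le> (Ker p u)\<^sup>2" by (simp add: power2_eq_square algebra_simps)
  qed
  then show "mu2 p \<ge> 1 / 2" by (simp add: mu)
  have "m \<le> Kmax p * 1"
    by (rule has_integral_le[OF m has_integral_mult_right[OF one]])
       (simp add: power2_eq_square mult_right_mono kernel_facts[OF K])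
  then show "mu2 p \<le> Kmax p" by (simp add: mu)
  have "1 \<le> 2 * Kmax p" by (rule has_integral_le[OF one const]) (simp add: kernel_facts[OF K])
  then show "Kmax p \<ge> 1 / 2" by simp
qed

lemma cb_pos: "beta p > 0 \<Longrightarrow> cb p \<ge> 1"
  by (simp add: cb_def one_le_ceiling)

lemma kord_cases:
  assumes "0 < beta p" "beta p \<le> 2"
  obtains "beta p \<le> 1" "kord p = 0" "cb p = 1" | "beta p > 1" "kord p = 1" "cb p = 2"
proof (cases "beta p \<le> 1")
  case True
  then have "\<lceil>beta p\<rceil> = 1" using assms by (simp add: ceiling_eq_iff)
  then show ?thesis using True that(1) by (simp add: kord_def cb_def)
next
  case False
  then have "\<lceil>beta p\<rceil> = 2" using assms by (simp add: ceiling_eq_iff)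
  then show ?thesis using False that(2) by (simp add: kord_def cb_def)
qed

text \<open>The common unit of the square roots in \<open>Cbeta\<close>. Multiplied by
  \<open>h powr beta p\<close> it is the standard noise level \<sigma> sqrt(W log n / (n h)) of the
  estimator.\<close>

definition noise_scale :: "params \<Rightarrow> real" where
  "noise_scale p = sigma p * sqrt (Wc p / Ch p powr (2 * beta p + 1))"

lemma Wc_ge: "Wc p \<ge> 256 * (Kmax p / lam0 p)\<^sup>2"
  by (simp add: Wc_def Cstar_def power_divide power_mult_distrib)

locale fomt_params =
  fixes p :: params
  assumes beta: "0 < beta p" "beta p \<le> 2" and L: "Lc p > 0" and sig: "sigma p > 0"
    and K: "kernel_assms p" and lam0: "lam0 p > 0"
begin

lemma Kmax_pos: "Kmax p > 0" using K by (rule kernel_facts)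

lemma Wc_pos: "Wc p > 0"
proof -
  have "0 < 256 * (Kmax p / lam0 p)\<^sup>2" using Kmax_pos lam0 by simp
  then show ?thesis using Wc_ge[of p] by linarith
qed

lemma q_pos: "q1 p > 0" "q2 p > 0"
proof -
  show "q1 p > 0" using Kmax_pos lam0 L by (simp add: q1_def Cstar_def)
  have "mu2 p > 0" using kernel_L2_norm(1)[OF K] by linarith
  moreover have "cb p > 0" using cb_pos[OF beta(1)] by linarith
  ultimately show "q2 p > 0" using sig lam0 by (simp add: q2_def)
qed

lemma Ch_pos: "Ch p > 0"
  using q_pos beta by (simp add: Ch_def)

lemma Ch_powr: "Ch p powr (2 * beta p + 1) = q2 p / (4 * (q1 p)\<^sup>2 * beta p)"
  using q_pos beta by (simp add: Ch_def powr_powr)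

lemma noise_scale_pos: "noise_scale p > 0"
  using sig Wc_pos Ch_pos by (simp add: noise_scale_def)

text \<open>The bandwidth constant is calibrated so that the factor \<open>\<sigma>\<close> cancels in the noise level, which
  therefore dominates the bias terms.\<close>

lemma noise_scale_ge:
  assumes "beta p > 1"
  shows "noise_scale p \<ge> 32 * Kmax p / lam0 p * Lc p"
proof -
  have k: "kord p = 1" "cb p = 2" using kord_cases[OF beta] assms by fastforce+
  note mu = kernel_L2_norm[OF K]
  have mu0: "mu2 p > 0" using mu by linarith
  have "(noise_scale p)\<^sup>2 = (sigma p)\<^sup>2 * (Wc p / (q2 p / (4 * (q1 p)\<^sup>2 * beta p)))"
    using Wc_pos q_pos beta by (simp add: noise_scale_def power_mult_distrib Ch_powr)
  also have "\<dots> = Wc p * beta p * (8 * (Kmax p)\<^sup>2 * (Lc p)\<^sup>2) / mu2 p"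
    using sig lam0 Kmax_pos L beta mu0
    by (simp add: q1_def q2_def Cstar_def k field_simps power2_eq_square)
  finally have eq: "(noise_scale p)\<^sup>2 = Wc p * beta p * (8 * (Kmax p)\<^sup>2 * (Lc p)\<^sup>2) / mu2 p" .
  have "(32 * Kmax p / lam0 p * Lc p)\<^sup>2 = (256 * (Kmax p / lam0 p)\<^sup>2) * (4 * (Lc p)\<^sup>2)"
    by (simp add: power2_eq_square)
  also have "\<dots> \<le> Wc p * (4 * (Lc p)\<^sup>2)" by (intro mult_right_mono Wc_ge) simp
  also have "\<dots> \<le> (Wc p * beta p) * (8 * (Kmax p)\<^sup>2 * (Lc p)\<^sup>2 / mu2 p)"
  proof (intro mult_mono)
    show "Wc p \<le> Wc p * beta p" using Wc_pos assms by simp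
    have "mu2 p \<le> 2 * (Kmax p)\<^sup>2"
    proof -
      have "mu2 p * 1 \<le> Kmax p * (2 * Kmax p)" using mu mu0 by (intro mult_mono) auto
      then show ?thesis by (simp add: power2_eq_square)
    qed
    then have "4 * (Lc p)\<^sup>2 * mu2 p \<le> 4 * (Lc p)\<^sup>2 * (2 * (Kmax p)\<^sup>2)" by (intro mult_left_mono) auto
    then show "4 * (Lc p)\<^sup>2 \<le> 8 * (Kmax p)\<^sup>2 * (Lc p)\<^sup>2 / mu2 p"
      using mu0 by (simp add: le_divide_eq mult_ac)
  qed (use Wc_pos beta in auto)
  also have "\<dots> = (noise_scale p)\<^sup>2" by (simp add: eq)
  finally show ?thesis by (rule power2_le_imp_le) (use noise_scale_pos in simp)
qed

text \<open>For \<beta> \<le> 1, half of 4L is later spent on the bias of two estimates, and the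
  rest leaves room for the oscillation of \<open>f\<close> inside a cell.\<close>

lemma Cbeta_eq:
  "beta p \<le> 1 \<Longrightarrow> Cbeta p = (max (16 * Kmax p / lam0 p) 2 + 4) * Lc p + (2 + sqrt 6) * noise_scale p"
  "beta p > 1 \<Longrightarrow> Cbeta p = 4 * Lc p + 32 * L2 p / lam0 p * noise_scale p"
proof -
  have "sqrt (c * Wc p / X) = sqrt c * sqrt (Wc p / X)" for c X
    by (simp add: real_sqrt_mult flip: times_divide_eq_right)
  note split = this
  show "beta p \<le> 1 \<Longrightarrow> Cbeta p = (max (16 * Kmax p / lam0 p) 2 + 4) * Lc p + (2 + sqrt 6) * noise_scale p"
    unfolding Cbeta_def split noise_scale_def by (simp add: algebra_simps)
  show "beta p > 1 \<Longrightarrow> Cbeta p = 4 * Lc p + 32 * L2 p / lam0 p * noise_scale p"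
    unfolding Cbeta_def split noise_scale_def by simp
qed

end

section \<open>Mean value and Taylor estimates on the unit interval\<close>

lemma dF_mean_value:
  assumes diff: "\<forall>x\<in>{0..1}. f differentiable (at x within {0..1})" and xy: "0 \<le> x" "x < y" "y \<le> 1"
  obtains \<xi> where "x < \<xi>" "\<xi> < y" "f y - f x = dF f \<xi> * (y - x)"
proof -
  have "\<exists>\<xi>\<in>{x<..<y}. f y - f x = (\<lambda>t. t *\<^sub>R dF f \<xi>) (y - x)"
  proof (rule mvt_simple[OF xy(2)])
    fix t assume t: "x \<le> t" "t \<le> y"
    then have "(f has_vector_derivative dF f t) (at t within {0..1})"
      using diff xy unfolding dF_def by (simp flip: vector_derivative_works)
    then show "(f has_derivative (\<lambda>s. s *\<^sub>R dF f t)) (at t within {x..y})"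
      unfolding has_vector_derivative_def by (rule has_derivative_subset) (use xy in auto)
  qed
  then show ?thesis using that by (auto simp: mult.commute)
qed

lemma Hoelder_first_order:
  assumes diff: "\<forall>x\<in>{0..1}. f differentiable (at x within {0..1})" and s: "s > 0"
    and dF: "\<forall>x\<in>{0..1}. \<forall>y\<in>{0..1}. \<bar>dF f x - dF f y\<bar> \<le> L * \<bar>x - y\<bar> powr s" and L: "L \<ge> 0"
    and xy: "x \<in> {0..1}" "y \<in> {0..1}"
  shows "\<bar>f y - f x - dF f x * (y - x)\<bar> \<le> L * \<bar>y - x\<bar> powr (s + 1)"
proof (cases "x = y")
  case False
  obtain \<xi> where \<xi>: "\<xi> \<in> {0..1}" "\<bar>\<xi> - x\<bar> \<le> \<bar>y - x\<bar>" "f y - f x = dF f \<xi> * (y - x)"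
  proof (cases "x < y")
    case True
    with dF_mean_value[OF diff, of x y] xy obtain \<xi> where "x < \<xi>" "\<xi> < y" "f y - f x = dF f \<xi> * (y - x)" by auto
    then show ?thesis using xy by (intro that) auto
  next
    case False
    with dF_mean_value[OF diff, of y x] xy \<open>x \<noteq> y\<close>
    obtain \<xi> where "y < \<xi>" "\<xi> < x" "f x - f y = dF f \<xi> * (x - y)" by auto
    moreover have "f y - f x = dF f \<xi> * (y - x)" using calculation(3) by (simp add: algebra_simps)
    ultimately show ?thesis using xy by (intro that[of \<xi>]) auto
  qed
  have "\<bar>f y - f x - dF f x * (y - x)\<bar> = \<bar>dF f \<xi> - dF f x\<bar> * \<bar>y - x\<bar>"
    by (simp add: \<xi>(3) left_diff_distrib flip: abs_mult)
  also have "\<dots> \<le> (L * \<bar>\<xi> - x\<bar> powr s) * \<bar>y - x\<bar>" using dF \<xi> xy by (intro mult_right_mono) auto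
  also have "\<dots> \<le> (L * \<bar>y - x\<bar> powr s) * \<bar>y - x\<bar>"
    using \<xi> s L by (intro mult_right_mono mult_left_mono powr_mono2) auto
  also have "\<dots> = L * \<bar>y - x\<bar> powr (s + 1)" using False by (simp add: powr_add)
  finally show ?thesis .
qed simp

section \<open>The noise event\<close>

text \<open>All requirements of the form "n large" are collected here, so that the subsequent
  estimates are non-asymptotic. \<open>h_small\<close> gives every index room for a window on one
  side, \<open>nh\<close> absorbs rounding of window lengths, and \<open>Nmax_le\<close> controls
  the logarithm in the critical value.\<close>

locale fomt_regime = fomt_params +
  fixes \<alpha> :: real and n :: nat
  assumes alpha: "0 < \<alpha>" "\<alpha> < 1" and ln_n: "ln (real n) \<ge> 1"
    and h_small: "hn p n \<le> 1 / 4" and nh: "real n * hn p n \<ge> 20"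
    and Nmax_le: "Nmax p \<alpha> n \<le> \<alpha> * (real n)\<^sup>2"
    and eig: "\<forall>x\<in>{0..1}. \<forall>e. eigenvalue (Bmat p n (hn p n) x) e \<longrightarrow> lam0 p \<le> e"
begin

abbreviation h where "h \<equiv> hn p n"

lemma n_gt: "real n > 1"
proof (rule ccontr)
  assume "\<not> real n > 1"
  then have "n = 0 \<or> n = 1" by auto
  then show False using ln_n by auto
qed

lemma n_ge: "n \<ge> 1" using n_gt by simp

lemma h_pos: "h > 0"
  using Ch_pos n_gt ln_n by (simp add: hn_def)

lemma nh_pos: "real n * h > 0" using nh by linarith

lemma h_ge: "1 / real n \<le> h" using nh n_gt by (simp add: field_simps)

lemma xd_01: "i \<in> {1..n} \<Longrightarrow> xd n i \<in> {0..1}"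
  by (auto simp: xd_def divide_le_eq)

lemma eig_xd: "i \<in> {1..n} \<Longrightarrow> \<forall>e. eigenvalue (Bmat p n h (xd n i)) e \<longrightarrow> lam0 p \<le> e"
  using eig xd_01 by blast

lemma kord_le: "kord p \<le> 1" using kord_cases[OF beta] by fastforce

lemma nh1: "real n * h \<ge> 1" using nh by linarith

lemmas weight_facts = LPE_weight_facts[OF K n_ge h_pos nh1 kord_le lam0 eig_xd]
lemmas weight_sums = Wn_sum_abs_le[OF K n_ge h_pos nh1 kord_le lam0 eig_xd]

lemma lam0_le: "lam0 p \<le> 6 * Kmax p" using weight_sums(3)[of 1] n_ge by simp

lemma n_h_powr: "real n * h powr (2 * beta p + 1) = Ch p powr (2 * beta p + 1) * ln (real n)"
proof -
  have "h powr (2 * beta p + 1)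
      = Ch p powr (2 * beta p + 1) * (ln (real n) / real n)"
    using beta Ch_pos n_gt ln_n by (simp add: hn_def powr_mult powr_powr)
  then show ?thesis using n_gt by simp
qed

text \<open>The bandwidth solves n h^(2 \<beta> + 1) = C_h^(2 \<beta> + 1) log n, the balance
  between h^\<beta> and the noise level; so the two can be exchanged.\<close>

lemma noise_scale_h: "noise_scale p * h powr beta p = sigma p * sqrt (Wc p * ln (real n) / (real n * h))"
proof -
  let ?X = "Ch p powr (2 * beta p + 1)"
  have X: "?X > 0" using Ch_pos by simp
  have hb: "h powr beta p = sqrt (h powr (2 * beta p))"
    using h_pos by (simp flip: powr_half_sqrt add: powr_powr)
  have "h powr (2 * beta p) = ?X * ln (real n) / (real n * h)"
    using n_h_powr h_pos n_gt by (simp add: powr_add field_simps)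
  then have "Wc p / ?X * h powr (2 * beta p) = Wc p * ln (real n) / (real n * h)"
    using X by simp
  then show ?thesis
    unfolding noise_scale_def hb by (simp only: mult.assoc flip: real_sqrt_mult)
qed

text \<open>\<open>Nmax_le\<close> bounds the logarithmic factor by 4 log n, whose root supplies the
  factor 2, and the minimum is bounded by \<open>h\<close>, which reduces h^(-3/2) to
  h^(-1/2).\<close>

lemma Ccrit_le: "Ccrit p \<alpha> n i j \<le> 2 * noise_scale p * h powr beta p"
proof -
  have Cn: "Cn p \<alpha> n > 0" using alpha h_pos by (simp add: Cn_def ln_less_zero divide_neg_pos)
  have Nm: "Nmax p \<alpha> n > 0" using Cn ln_n by (simp add: Nmax_def)
  have "Nmax p \<alpha> n / \<alpha> \<le> (real n)\<^sup>2" using Nmax_le alpha by (simp add: divide_le_eq mult.commute)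
  then have "ln (Nmax p \<alpha> n / \<alpha>) \<le> ln ((real n)\<^sup>2)" using Nm alpha n_gt by (subst ln_le_cancel_iff) auto
  also have "\<dots> = 2 * ln (real n)" using n_gt by (simp add: ln_realpow)
  finally have "- 2 * ln (\<alpha> / Nmax p \<alpha> n) \<le> 4 * ln (real n)" using Nm alpha by (simp add: ln_div)
  then have "- 2 * ln (\<alpha> / Nmax p \<alpha> n) * Wc p \<le> 4 * ln (real n) * Wc p"
    using Wc_pos by (intro mult_right_mono) auto
  then have s: "sqrt (- 2 * ln (\<alpha> / Nmax p \<alpha> n) * Wc p) \<le> sqrt (4 * ln (real n) * Wc p)" by (rule real_sqrt_le_mono)
  let ?m = "min (8 * L2 p / lam0 p * \<bar>xd n i - xd n j\<bar>) h"
  have L2: "L2 p \<ge> 0" using kernel_facts[OF K] cb_pos[OF beta(1)] by (simp add: L2_def)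
  have m: "0 \<le> ?m" "?m \<le> h" using L2 lam0 h_pos by auto
  define c where "c = sigma p * real n powr (-1/2) * h powr (-3/2)"
  have c: "c \<ge> 0" using sig by (simp add: c_def)
  have "Ccrit p \<alpha> n i j = sqrt (- 2 * ln (\<alpha> / Nmax p \<alpha> n) * Wc p) * (c * ?m)"
    unfolding Ccrit_def c_def by (simp only: mult_ac)
  also have "\<dots> \<le> sqrt (4 * ln (real n) * Wc p) * (c * ?m)"
    using c m by (intro mult_right_mono s mult_nonneg_nonneg)
  also have "\<dots> \<le> sqrt (4 * ln (real n) * Wc p) * (c * h)"
    using c m ln_n Wc_pos by (intro mult_left_mono real_sqrt_ge_zero mult_nonneg_nonneg) auto
  also have "\<dots> = sigma p * sqrt (4 * ln (real n) * Wc p) * real n powr (-1/2) * (h powr (-3/2) * h)"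
    unfolding c_def by (simp only: mult_ac)
  also have "\<dots> = sigma p * (2 * sqrt (Wc p * ln (real n) / (real n * h)))"
  proof -
    have "h powr (-3/2) * h = h powr (-1/2)" using h_pos powr_add[of h "-3/2" 1] by simp
    moreover have "x powr (-1/2) = 1 / sqrt x" if "x > 0" for x :: real
      using that by (simp add: powr_minus_divide powr_half_sqrt)
    ultimately show ?thesis using h_pos n_gt
      by (simp add: real_sqrt_mult real_sqrt_divide mult_ac)
  qed
  also have "\<dots> = 2 * noise_scale p * h powr beta p" using noise_scale_h by simp
  finally show ?thesis .
qed

lemma Dcrit_le: "Dcrit p n i j \<le> max (16 * Kmax p / lam0 p) 2 * Lc p * h powr beta p"
  using L by (simp add: Dcrit_def)

text \<open>Only downward fluctuations can keep a test from firing, so the event is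
  one-sided.\<close>

definition tame :: "(real \<Rightarrow> real) \<Rightarrow> (nat \<Rightarrow> real) \<Rightarrow> bool" where
  "tame f Y \<longleftrightarrow> (\<forall>i\<in>{1..n}. \<forall>j\<in>{1..n}.
     LPE p n h Y (xd n i) - LPE p n h Y (xd n j)
     > LPE p n h (\<lambda>l. f (xd n l)) (xd n i) - LPE p n h (\<lambda>l. f (xd n l)) (xd n j)
       - sqrt 6 * noise_scale p * h powr beta p)"

text \<open>With \<open>(a - b)\<^sup>2 \<le> 2 * a\<^sup>2 + 2 * b\<^sup>2\<close> the squared
  weights sum to at most 48 (Kmax/lam0)^2 / (n h), while the squared threshold is at least 6 * 256
  \<sigma>^2 (Kmax/lam0)^2 log n / (n h). The exponent 16 is 6 * 256 / (2 * 48).\<close>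

lemma prob_pair_noise:
  assumes ij: "i \<in> {1..n}" "j \<in> {1..n}"
  shows "measure (data (sigma p) n f) {Y\<in>space (data (sigma p) n f).
     (\<Sum>l=1..n. (Wn p n h (xd n i) l - Wn p n h (xd n j) l) * (Y l - f (xd n l)))
       \<le> - (sqrt 6 * noise_scale p * h powr beta p)} \<le> 1 / real n ^ 16"
proof -
  define V where "V = 4 * (12 * (Kmax p / lam0 p)\<^sup>2 / (real n * h))"
  define t where "t = sqrt 6 * noise_scale p * h powr beta p"
  have V: "V > 0" using Kmax_pos lam0 nh_pos by (simp add: V_def)
  have t: "t \<ge> 0" using noise_scale_pos by (simp add: t_def)
  have "(\<Sum>l=1..n. (Wn p n h (xd n i) l - Wn p n h (xd n j) l)\<^sup>2)
      \<le> (\<Sum>l=1..n. 2 * (Wn p n h (xd n i) l)\<^sup>2 + 2 * (Wn p n h (xd n j) l)\<^sup>2)"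
  proof (rule sum_mono)
    fix l
    have "0 \<le> (Wn p n h (xd n i) l + Wn p n h (xd n j) l)\<^sup>2" by simp
    then show "(Wn p n h (xd n i) l - Wn p n h (xd n j) l)\<^sup>2
        \<le> 2 * (Wn p n h (xd n i) l)\<^sup>2 + 2 * (Wn p n h (xd n j) l)\<^sup>2"
      by (simp add: power2_eq_square algebra_simps)
  qed
  also have "\<dots> = 2 * (\<Sum>l=1..n. (Wn p n h (xd n i) l)\<^sup>2) + 2 * (\<Sum>l=1..n. (Wn p n h (xd n j) l)\<^sup>2)"
    by (simp add: sum.distrib sum_distrib_left)
  also have "\<dots> \<le> V"
  proof -
    have "2 * a + 2 * b \<le> 4 * v" if "a \<le> v" "b \<le> v" for a b v :: real using that by linarith
    then show ?thesis unfolding V_def using weight_sums(2)[OF ij(1)] weight_sums(2)[OF ij(2)] .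
  qed
  finally have le: "(\<Sum>l=1..n. (Wn p n h (xd n i) l - Wn p n h (xd n j) l)\<^sup>2) \<le> V" .
  have "t\<^sup>2 = 6 * (noise_scale p * h powr beta p)\<^sup>2" by (simp add: t_def power_mult_distrib)
  also have "\<dots> = 6 * (sigma p)\<^sup>2 * (Wc p * ln (real n) / (real n * h))"
    unfolding noise_scale_h using Wc_pos ln_n nh_pos by (simp add: power_mult_distrib)
  also have "\<dots> \<ge> 6 * (sigma p)\<^sup>2 * (256 * (Kmax p / lam0 p)\<^sup>2 * ln (real n) / (real n * h))"
    using Wc_ge[of p] ln_n nh_pos by (intro mult_left_mono divide_right_mono mult_right_mono) auto
  finally have "16 * ln (real n) * (2 * (sigma p)\<^sup>2 * V) \<le> t\<^sup>2" by (simp add: V_def mult_ac)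
  then have "16 * ln (real n) \<le> t\<^sup>2 / (2 * (sigma p)\<^sup>2 * V)" using V sig by (simp add: le_divide_eq)
  then have "exp (- t\<^sup>2 / (2 * (sigma p)\<^sup>2 * V)) \<le> exp (- (16 * ln (real n)))" by simp
  also have "\<dots> = 1 / real n ^ 16"
  proof -
    have "16 * ln (real n) = ln (real n ^ 16)" using n_gt by (simp add: ln_realpow)
    then show ?thesis using n_gt by (simp add: exp_minus inverse_eq_divide)
  qed
  finally show ?thesis
    using gaussian_lower_tail[OF sig t V le, of f] unfolding t_def by linarith
qed

lemma tame_measurable: "{Y\<in>space (data (sigma p) n f). tame f Y} \<in> sets (data (sigma p) n f)"
proof -
  have [measurable]: "(\<lambda>Y. LPE p n h Y x) \<in> borel_measurable (data (sigma p) n f)" for x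
    unfolding LPE_def by (rule measurable_data_sum)
  show ?thesis unfolding tame_def by measurable
qed

lemma prob_tame: "measure (data (sigma p) n f) {Y\<in>space (data (sigma p) n f). tame f Y} \<ge> 1 - 1 / real n"
proof -
  let ?M = "data (sigma p) n f" and ?I = "{1..n} \<times> {1..n}"
  interpret D: prob_space ?M by (rule prob_space_data[OF sig])
  define E where "E = (\<lambda>(i, j). {Y\<in>space ?M.
     (\<Sum>l=1..n. (Wn p n h (xd n i) l - Wn p n h (xd n j) l) * (Y l - f (xd n l)))
       \<le> - (sqrt 6 * noise_scale p * h powr beta p)})"
  have E: "E ij \<in> D.events" for ij
  proof -
    obtain i j where ij: "ij = (i, j)" by (cases ij)
    have "(\<lambda>Y. \<Sum>l=1..n. (Wn p n h (xd n i) l - Wn p n h (xd n j) l) * (Y l - f (xd n l))) \<in> borel_measurable ?M"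
      by (intro borel_measurable_sum borel_measurable_times borel_measurable_const
          borel_measurable_diff measurable_data_component)
    note [measurable] = this
    show ?thesis unfolding ij E_def prod.case by measurable
  qed
  have diff: "(LPE p n h Y (xd n i) - LPE p n h Y (xd n j))
       - (LPE p n h (\<lambda>l. f (xd n l)) (xd n i) - LPE p n h (\<lambda>l. f (xd n l)) (xd n j))
     = (\<Sum>l=1..n. (Wn p n h (xd n i) l - Wn p n h (xd n j) l) * (Y l - f (xd n l)))" for Y i j
    unfolding LPE_def by (simp add: algebra_simps flip: sum_subtractf sum.distrib)
  have "space ?M - {Y\<in>space ?M. tame f Y} \<subseteq> (\<Union>ij\<in>?I. E ij)"
  proof
    fix Y assume "Y \<in> space ?M - {Y\<in>space ?M. tame f Y}"
    then have Y: "Y \<in> space ?M" "\<not> tame f Y" by blast+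
    then obtain i j where ij: "i \<in> {1..n}" "j \<in> {1..n}"
      and le: "\<not> LPE p n h Y (xd n i) - LPE p n h Y (xd n j)
        > LPE p n h (\<lambda>l. f (xd n l)) (xd n i) - LPE p n h (\<lambda>l. f (xd n l)) (xd n j)
          - sqrt 6 * noise_scale p * h powr beta p"
      unfolding tame_def by blast
    have "(\<Sum>l=1..n. (Wn p n h (xd n i) l - Wn p n h (xd n j) l) * (Y l - f (xd n l)))
        \<le> - (sqrt 6 * noise_scale p * h powr beta p)"
      using le unfolding diff[symmetric] by linarith
    then have "Y \<in> E (i, j)" unfolding E_def prod.case using Y(1) by blast
    then show "Y \<in> (\<Union>ij\<in>?I. E ij)" using ij by blast
  qed
  then have "D.prob (space ?M - {Y\<in>space ?M. tame f Y}) \<le> D.prob (\<Union>ij\<in>?I. E ij)"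
    using E by (intro D.finite_measure_mono) auto
  also have "\<dots> \<le> (\<Sum>ij\<in>?I. D.prob (E ij))"
    using E by (intro D.finite_measure_subadditive_finite) auto
  also have "\<dots> \<le> (\<Sum>ij\<in>?I. 1 / real n ^ 16)"
  proof (rule sum_mono)
    fix ij assume "ij \<in> ?I"
    then obtain i j where ij: "ij = (i, j)" "i \<in> {1..n}" "j \<in> {1..n}" by blast
    show "D.prob (E ij) \<le> 1 / real n ^ 16"
      unfolding ij(1) E_def prod.case by (rule prob_pair_noise[OF ij(2,3)])
  qed
  also have "\<dots> = 1 / real n ^ 14"
  proof -
    have "real n ^ 16 = real n * real n * real n ^ 14" by (simp add: eval_nat_numeral)
    then show ?thesis using n_gt by (simp add: card_cartesian_product)
  qed
  also have "\<dots> \<le> 1 / real n"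
    using n_gt power_increasing[of 1 14 "real n"] by (intro divide_left_mono) auto
  finally show ?thesis by (simp add: D.prob_compl[OF tame_measurable])
qed

end

section \<open>Violations are detected\<close>

context fomt_regime
begin

text \<open>As the weights sum to 1 and annihilate \<open>r\<close>, only the remainder
  \<open>f (xd n l) - f (xd n i) - r l\<close> is averaged. The choice of \<open>r\<close> is 0 for
  order 0 and the linear Taylor term for order 1.\<close>

lemma LPE_bias:
  assumes i: "i \<in> {1..n}" and \<rho>: "\<rho> \<ge> 0"
    and lin: "(\<Sum>l=1..n. Wn p n h (xd n i) l * r l) = 0"
    and err: "\<And>l. l \<in> {1..n} \<Longrightarrow> \<bar>xd n l - xd n i\<bar> \<le> h \<Longrightarrow> \<bar>f (xd n l) - f (xd n i) - r l\<bar> \<le> \<rho>"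
  shows "\<bar>LPE p n h (\<lambda>l. f (xd n l)) (xd n i) - f (xd n i)\<bar>
    \<le> (\<Sum>l=1..n. \<bar>Wn p n h (xd n i) l\<bar>) * \<rho>"
proof -
  let ?W = "Wn p n h (xd n i)"
  have "(\<Sum>l=1..n. ?W l * (f (xd n l) - f (xd n i) - r l))
      = (\<Sum>l=1..n. ?W l * f (xd n l)) - (\<Sum>l=1..n. ?W l) * f (xd n i) - (\<Sum>l=1..n. ?W l * r l)"
    by (simp only: right_diff_distrib sum_subtractf sum_distrib_right)
  also have "\<dots> = LPE p n h (\<lambda>l. f (xd n l)) (xd n i) - f (xd n i)"
    unfolding LPE_def lin weight_facts(1)[OF i] by simp
  finally have "\<bar>LPE p n h (\<lambda>l. f (xd n l)) (xd n i) - f (xd n i)\<bar>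
      = \<bar>\<Sum>l=1..n. ?W l * (f (xd n l) - f (xd n i) - r l)\<bar>" by simp
  also have "\<dots> \<le> (\<Sum>l=1..n. \<bar>?W l * (f (xd n l) - f (xd n i) - r l)\<bar>)" by (rule sum_abs)
  also have "\<dots> \<le> (\<Sum>l=1..n. \<bar>?W l\<bar> * \<rho>)"
  proof (rule sum_mono)
    fix l assume l: "l \<in> {1..n}"
    show "\<bar>?W l * (f (xd n l) - f (xd n i) - r l)\<bar> \<le> \<bar>?W l\<bar> * \<rho>"
    proof (cases "\<bar>xd n l - xd n i\<bar> \<le> h")
      case True
      then show ?thesis unfolding abs_mult using err[OF l] by (intro mult_left_mono) auto
    next
      case False
      then show ?thesis using weight_facts(3)[OF i, of l] by simp
    qed
  qed
  also have "\<dots> = (\<Sum>l=1..n. \<bar>?W l\<bar>) * \<rho>" by (simp only: sum_distrib_right)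
  finally show ?thesis .
qed

lemma Hoelder_low:
  assumes "beta p \<le> 1" "Hoelder (beta p) (Lc p) f" "x \<in> {0..1}" "y \<in> {0..1}"
  shows "\<bar>f x - f y\<bar> \<le> Lc p * \<bar>x - y\<bar> powr beta p"
proof -
  have "\<lceil>beta p\<rceil> = 1" using assms(1) beta by (simp add: ceiling_eq_iff)
  then show ?thesis using assms by (simp add: Hoelder_def)
qed

lemma Hoelder_high:
  assumes "beta p > 1" "Hoelder (beta p) (Lc p) f"
  shows "\<forall>x\<in>{0..1}. f differentiable (at x within {0..1})"
    "\<forall>x\<in>{0..1}. \<forall>y\<in>{0..1}. \<bar>dF f x - dF f y\<bar> \<le> Lc p * \<bar>x - y\<bar> powr (beta p - 1)"
proof -
  have "\<lceil>beta p\<rceil> = 2" using assms(1) beta by (simp add: ceiling_eq_iff)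
  then show "\<forall>x\<in>{0..1}. f differentiable (at x within {0..1})"
    "\<forall>x\<in>{0..1}. \<forall>y\<in>{0..1}. \<bar>dF f x - dF f y\<bar> \<le> Lc p * \<bar>x - y\<bar> powr (beta p - 1)"
    using assms by (simp_all add: Hoelder_def)
qed

text \<open>Nonnegative weights have absolute sum exactly 1, which keeps the constant at L; this is
  what the entry 4L in \<open>Cbeta\<close> can afford.\<close>

lemma bias_low:
  assumes b: "beta p \<le> 1" and f: "Hoelder (beta p) (Lc p) f" and i: "i \<in> {1..n}"
  shows "\<bar>LPE p n h (\<lambda>l. f (xd n l)) (xd n i) - f (xd n i)\<bar> \<le> Lc p * h powr beta p"
proof -
  have k0: "kord p = 0" using kord_cases[OF beta] b by fastforce
  have "\<bar>f (xd n l) - f (xd n i) - 0\<bar> \<le> Lc p * h powr beta p"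
    if "l \<in> {1..n}" "\<bar>xd n l - xd n i\<bar> \<le> h" for l
  proof -
    have "\<bar>f (xd n l) - f (xd n i)\<bar> \<le> Lc p * \<bar>xd n l - xd n i\<bar> powr beta p"
      using xd_01 that i by (intro Hoelder_low[OF b f])
    also have "\<dots> \<le> Lc p * h powr beta p" using that L beta by (intro mult_left_mono powr_mono2) auto
    finally show ?thesis by simp
  qed
  then have "\<bar>LPE p n h (\<lambda>l. f (xd n l)) (xd n i) - f (xd n i)\<bar>
      \<le> (\<Sum>l=1..n. \<bar>Wn p n h (xd n i) l\<bar>) * (Lc p * h powr beta p)"
    using L by (intro LPE_bias[OF i, where r="\<lambda>_. 0"]) auto
  also have "(\<Sum>l=1..n. \<bar>Wn p n h (xd n i) l\<bar>) = (\<Sum>l=1..n. Wn p n h (xd n i) l)"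
    by (rule sum.cong[OF refl]) (rule abs_of_nonneg[OF weight_facts(5)[OF i k0]])
  also have "\<dots> = 1" by (rule weight_facts(1)[OF i])
  finally show ?thesis by simp
qed

lemma bias_high:
  assumes b: "beta p > 1" and f: "Hoelder (beta p) (Lc p) f" and i: "i \<in> {1..n}"
  shows "\<bar>LPE p n h (\<lambda>l. f (xd n l)) (xd n i) - f (xd n i)\<bar> \<le> 6 * Kmax p / lam0 p * Lc p * h powr beta p"
proof -
  have k1: "kord p = 1" using kord_cases[OF beta] b by fastforce
  have "\<bar>f (xd n l) - f (xd n i) - dF f (xd n i) * (xd n l - xd n i)\<bar> \<le> Lc p * h powr beta p"
    if "l \<in> {1..n}" "\<bar>xd n l - xd n i\<bar> \<le> h" for l
  proof -
    have "\<bar>f (xd n l) - f (xd n i) - dF f (xd n i) * (xd n l - xd n i)\<bar>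
        \<le> Lc p * \<bar>xd n l - xd n i\<bar> powr (beta p - 1 + 1)"
      by (rule Hoelder_first_order[OF Hoelder_high(1)[OF b f] _ Hoelder_high(2)[OF b f]])
         (use b L xd_01 i that in auto)
    also have "\<dots> \<le> Lc p * h powr beta p" using that L beta by (auto intro!: mult_left_mono powr_mono2)
    finally show ?thesis .
  qed
  moreover have "(\<Sum>l=1..n. Wn p n h (xd n i) l * (dF f (xd n i) * (xd n l - xd n i))) = 0"
  proof -
    have "(\<Sum>l=1..n. Wn p n h (xd n i) l * (dF f (xd n i) * (xd n l - xd n i)))
        = dF f (xd n i) * (\<Sum>l=1..n. Wn p n h (xd n i) l * (xd n l - xd n i))"
      by (simp only: sum_distrib_left mult.left_commute)
    then show ?thesis unfolding weight_facts(2)[OF i k1] by simp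
  qed
  ultimately have "\<bar>LPE p n h (\<lambda>l. f (xd n l)) (xd n i) - f (xd n i)\<bar>
      \<le> (\<Sum>l=1..n. \<bar>Wn p n h (xd n i) l\<bar>) * (Lc p * h powr beta p)"
    using L by (intro LPE_bias[OF i, where r="\<lambda>l. dF f (xd n i) * (xd n l - xd n i)"]) auto
  also have "\<dots> \<le> (6 * Kmax p / lam0 p) * (Lc p * h powr beta p)"
    using L by (intro mult_right_mono weight_sums(1)[OF i]) simp
  finally show ?thesis by (simp only: mult.assoc)
qed

lemma Phi_fires:
  assumes Y: "tame f Y" and ij: "i \<in> {1..n}" "j \<in> {1..n}"
    and bias: "\<And>i. i \<in> {1..n} \<Longrightarrow> \<bar>LPE p n h (\<lambda>l. f (xd n l)) (xd n i) - f (xd n i)\<bar> \<le> \<delta> * h powr beta p"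
    and gap: "f (xd n i) - f (xd n j)
      \<ge> (2 * \<delta> + max (16 * Kmax p / lam0 p) 2 * Lc p + (2 + sqrt 6) * noise_scale p) * h powr beta p"
  shows "Phi p \<alpha> n Y i j"
proof -
  have "LPE p n h Y (xd n i) - LPE p n h Y (xd n j)
      > LPE p n h (\<lambda>l. f (xd n l)) (xd n i) - LPE p n h (\<lambda>l. f (xd n l)) (xd n j)
        - sqrt 6 * noise_scale p * h powr beta p"
    using Y ij unfolding tame_def by blast
  moreover have "LPE p n h (\<lambda>l. f (xd n l)) (xd n i) - LPE p n h (\<lambda>l. f (xd n l)) (xd n j)
      \<ge> f (xd n i) - f (xd n j) - 2 * \<delta> * h powr beta p"
    using bias[OF ij(1)] bias[OF ij(2)] by linarith
  moreover have "(2 * \<delta> + max (16 * Kmax p / lam0 p) 2 * Lc p + (2 + sqrt 6) * noise_scale p) * h powr beta p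
     = 2 * \<delta> * h powr beta p + max (16 * Kmax p / lam0 p) 2 * Lc p * h powr beta p
       + 2 * noise_scale p * h powr beta p + sqrt 6 * noise_scale p * h powr beta p"
    by (simp only: distrib_right)
  ultimately have "LPE p n h Y (xd n i) - LPE p n h Y (xd n j)
      \<ge> 2 * noise_scale p * h powr beta p + max (16 * Kmax p / lam0 p) 2 * Lc p * h powr beta p"
    using gap by linarith
  then show ?thesis unfolding Phi_def using Ccrit_le[of i j] Dcrit_le[of i j] by linarith
qed

lemma eps0_le_heavy:
  assumes b: "beta p \<le> 1" and f: "Hoelder (beta p) (Lc p) f" and Y: "tame f Y"
  shows "eps0 (Cbeta p * h powr beta p) f \<le> real (card {I\<in>{1..n}. heavy (Phi p \<alpha> n Y) n I}) / real n"
proof -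
  let ?H = "{I\<in>{1..n}. heavy (Phi p \<alpha> n Y) n I}"
  \<comment> \<open>The drop at which \<open>Phi_fires\<close> applies. With \<gamma> and \<omega>
    as in \<open>eps0_le_cells\<close>, \<open>2 * g\<close> equals
    \<open>2 * \<gamma> - 4 * \<omega>\<close>, below the admissible
    \<open>2 * \<gamma> - 2 * \<omega>\<close>.\<close>
  define g where "g = (Cbeta p - 2 * Lc p) * h powr beta p"
  have hb: "h powr beta p > 0" using h_pos by simp
  have Cb: "Cbeta p - 2 * Lc p = 2 * Lc p + max (16 * Kmax p / lam0 p) 2 * Lc p + (2 + sqrt 6) * noise_scale p"
    unfolding Cbeta_eq(1)[OF b] by (simp add: algebra_simps)
  have Cb2: "Cbeta p - 2 * Lc p \<ge> 2 * Lc p"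
  proof -
    have "0 \<le> max (16 * Kmax p / lam0 p) 2 * Lc p" using L by simp
    moreover have "0 \<le> (2 + sqrt 6) * noise_scale p" using noise_scale_pos by simp
    ultimately show ?thesis unfolding Cb by linarith
  qed
  then have g: "g > 0" unfolding g_def using L hb by (intro mult_pos_pos) auto
  have Phi: "Phi p \<alpha> n Y i j" if "i \<in> {1..n}" "j \<in> {1..n}" "i < j" "f (xd n i) - f (xd n j) \<ge> g" for i j
    using that by (intro Phi_fires[OF Y that(1,2) bias_low[OF b f]]) (auto simp: g_def Cb)
  have fc: "\<bar>f x - f y\<bar> \<le> Lc p * \<bar>x - y\<bar> powr beta p" if "x \<in> {0..1}" "y \<in> {0..1}" for x y
    using Hoelder_low[OF b f that] .
  show ?thesis
  proof (rule eps0_le_cells[where \<omega>="Lc p * h powr beta p" and B="\<bar>f 0\<bar> + Lc p"])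
    fix x :: real assume x: "x \<in> {0..1}"
    have "\<bar>f x - f 0\<bar> \<le> Lc p * \<bar>x - 0\<bar> powr beta p" using x by (intro fc) auto
    also have "\<dots> \<le> Lc p * 1" using x L beta by (intro mult_left_mono powr_le1) auto
    finally show "\<bar>f x\<bar> \<le> \<bar>f 0\<bar> + Lc p" by linarith
  next
    fix x y :: real assume xy: "x \<in> {0..1}" "y \<in> {0..1}" "\<bar>x - y\<bar> \<le> 1 / real n"
    have "Lc p * \<bar>x - y\<bar> powr beta p \<le> Lc p * h powr beta p"
      using xy(3) h_ge L beta by (intro mult_left_mono powr_mono2) auto
    then show "\<bar>f x - f y\<bar> \<le> Lc p * h powr beta p" using fc[OF xy(1,2)] by linarith
  next
    fix i j assume ij: "i \<in> {1..n} - ?H" "j \<in> {1..n} - ?H" "i < j"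
    then have "\<not> (heavy (Phi p \<alpha> n Y) n i \<or> heavy (Phi p \<alpha> n Y) n j)" by blast
    moreover have "heavy (Phi p \<alpha> n Y) n i \<or> heavy (Phi p \<alpha> n Y) n j"
      if "f (xd n i) - f (xd n j) \<ge> 2 * g"
      by (rule heavy_endpoint[where F="\<lambda>i. f (xd n i)" and g=g]) (use ij g that Phi in auto)
    ultimately have small: "\<not> f (xd n i) - f (xd n j) \<ge> 2 * g" by blast
    show "f (xd n i) - f (xd n j) \<le> 2 * (Cbeta p * h powr beta p) - 2 * (Lc p * h powr beta p)"
    proof -
      have "g = Cbeta p * h powr beta p - 2 * (Lc p * h powr beta p)" by (simp add: g_def left_diff_distrib)
      moreover have "0 < Lc p * h powr beta p" using L hb by (rule mult_pos_pos)
      ultimately show ?thesis using small by linarith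
    qed
  next
    have "Lc p \<le> Cbeta p" using Cb2 L by linarith
    then show "Lc p * h powr beta p \<le> Cbeta p * h powr beta p" using hb by simp
  qed (use n_ge in auto)
qed

text \<open>Bias and boundary correction together cost 28 \<open>A\<close>, which
  \<open>noise_scale_ge\<close> bounds by \<open>S\<close>. The term with \<open>L2\<close> has size
  at least 64/3 \<open>S\<close>, because \<open>L2\<close> is at least \<open>4 * Kmax p\<close>.
  The left side is halved because a slope acting over distance h/2 produces only half of the
  drop.\<close>

lemma Cbeta_high_ge:
  assumes b: "beta p > 1"
  shows "(Cbeta p - 2 * Lc p) / 2
    \<ge> 2 * (6 * Kmax p / lam0 p * Lc p) + max (16 * Kmax p / lam0 p) 2 * Lc p + (2 + sqrt 6) * noise_scale p"
proof -
  define A where "A = Kmax p / lam0 p * Lc p"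
  define S where "S = noise_scale p"
  have cb: "cb p = 2" using kord_cases[OF beta] b by fastforce
  have A0: "A > 0" using Kmax_pos lam0 L by (simp add: A_def)
  have S0: "S > 0" using noise_scale_pos by (simp add: S_def)
  have SA: "32 * A \<le> S" using noise_scale_ge[OF b] by (simp add: A_def S_def)
  have K6: "1 / 6 \<le> Kmax p / lam0 p" using lam0_le lam0 by (simp add: field_simps)
  have "max (16 * Kmax p / lam0 p) 2 = 16 * (Kmax p / lam0 p)" using K6 by simp
  then have mx: "max (16 * Kmax p / lam0 p) 2 * Lc p = 16 * A" by (simp add: A_def)
  have "2 / 3 \<le> L2 p / lam0 p"
  proof -
    have "4 * Kmax p \<le> L2 p" using kernel_facts(5)[OF K] by (simp add: L2_def cb)
    then have "4 * Kmax p / lam0 p \<le> L2 p / lam0 p" using lam0 by (intro divide_right_mono) auto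
    moreover have "4 * Kmax p / lam0 p = 4 * (Kmax p / lam0 p)" by simp
    ultimately show ?thesis using K6 by linarith
  qed
  then have "32 * (2 / 3) * S \<le> 32 * (L2 p / lam0 p) * S" using S0 by (intro mult_right_mono) auto
  moreover have "Cbeta p = 4 * Lc p + 32 * (L2 p / lam0 p) * S" by (simp add: Cbeta_eq(2)[OF b] S_def)
  ultimately have Cb: "Cbeta p \<ge> 4 * Lc p + 64 / 3 * S" by linarith
  have sq: "sqrt 6 * S \<le> 5 / 2 * S"
    using S0 by (intro mult_right_mono real_le_lsqrt) (auto simp: power2_eq_square)
  have "12 * A + 16 * A + (2 * S + sqrt 6 * S) \<le> (Cbeta p - 2 * Lc p) / 2"
  proof -
    have "12 * a + 16 * a + (2 * s + q) \<le> (c - 2 * l) / 2"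
      if "4 * l + 64 / 3 * s \<le> c" "q \<le> 5 / 2 * s" "32 * a \<le> s" "0 < s" "0 < l" for a s q c l :: real
      using that by argo
    then show ?thesis using Cb sq SA S0 L by blast
  qed
  moreover have "2 * (6 * Kmax p / lam0 p * Lc p) = 12 * A" by (simp add: A_def)
  moreover have "(2 + sqrt 6) * S = 2 * S + sqrt 6 * S" by (rule distrib_right)
  ultimately show ?thesis unfolding mx S_def[symmetric] by (simp only:)
qed

text \<open>The slope may be known at either endpoint, so one statement serves windows to the right
  and to the left. Moving from \<open>c\<close> to the intermediate point costs one more L in the
  slope bound.\<close>

lemma Phi_fires_descent:
  assumes b: "beta p > 1" and f: "Hoelder (beta p) (Lc p) f" and Y: "tame f Y"
    and ij: "i \<in> {1..n}" "j \<in> {1..n}" and c: "c \<in> {xd n i, xd n j}"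
    and slope: "dF f c \<le> - (Cbeta p - Lc p) * h powr (beta p - 1)"
    and dist: "h / 2 \<le> xd n j - xd n i" "xd n j - xd n i \<le> h"
  shows "Phi p \<alpha> n Y i j"
proof (rule Phi_fires[OF Y ij bias_high[OF b f]])
  let ?x = "xd n i" and ?y = "xd n j" and ?hs = "h powr (beta p - 1)"
  have hs: "?hs > 0" using h_pos by simp
  obtain \<xi> where \<xi>: "?x < \<xi>" "\<xi> < ?y" "f ?y - f ?x = dF f \<xi> * (?y - ?x)"
    using dF_mean_value[OF Hoelder_high(1)[OF b f], of ?x ?y] xd_01[OF ij(1)] xd_01[OF ij(2)] dist h_pos by auto
  have "\<bar>dF f \<xi> - dF f c\<bar> \<le> Lc p * \<bar>\<xi> - c\<bar> powr (beta p - 1)"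
    by (rule Hoelder_high(2)[OF b f, rule_format])
       (use xd_01[OF ij(1)] xd_01[OF ij(2)] c \<xi>(1,2) in auto)
  also have "\<dots> \<le> Lc p * ?hs"
    using c \<xi>(1,2) dist L b by (intro mult_left_mono powr_mono2) auto
  finally have "dF f \<xi> \<le> - ((Cbeta p - 2 * Lc p) * ?hs)" using slope by (simp add: abs_le_iff algebra_simps)
  then have "(Cbeta p - 2 * Lc p) * ?hs * (?y - ?x) \<le> - dF f \<xi> * (?y - ?x)"
    using dist h_pos by (intro mult_right_mono) auto
  also have "- dF f \<xi> * (?y - ?x) = f ?x - f ?y" using \<xi>(3) by simp
  finally have drop: "(Cbeta p - 2 * Lc p) * ?hs * (?y - ?x) \<le> f ?x - f ?y" .
  have C0: "Cbeta p - 2 * Lc p \<ge> 0"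
  proof -
    have "0 \<le> 2 * (6 * Kmax p / lam0 p * Lc p) + max (16 * Kmax p / lam0 p) 2 * Lc p + (2 + sqrt 6) * noise_scale p"
      using Kmax_pos lam0 L noise_scale_pos by (intro add_nonneg_nonneg mult_nonneg_nonneg) auto
    from order_trans[OF this Cbeta_high_ge[OF b]] show ?thesis by simp
  qed
  have "(Cbeta p - 2 * Lc p) / 2 * h powr beta p = (Cbeta p - 2 * Lc p) * ?hs * (h / 2)"
    using h_pos by (simp add: powr_diff)
  also have "\<dots> \<le> (Cbeta p - 2 * Lc p) * ?hs * (?y - ?x)"
    using dist hs C0 by (intro mult_left_mono mult_nonneg_nonneg) auto
  also note drop
  finally have "(Cbeta p - 2 * Lc p) / 2 * h powr beta p \<le> f ?x - f ?y" .
  moreover have "(2 * (6 * Kmax p / lam0 p * Lc p) + max (16 * Kmax p / lam0 p) 2 * Lc p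
      + (2 + sqrt 6) * noise_scale p) * h powr beta p \<le> (Cbeta p - 2 * Lc p) / 2 * h powr beta p"
    by (intro mult_right_mono Cbeta_high_ge[OF b]) simp
  ultimately show "(2 * (6 * Kmax p / lam0 p * Lc p) + max (16 * Kmax p / lam0 p) 2 * Lc p
      + (2 + sqrt 6) * noise_scale p) * h powr beta p \<le> f ?x - f ?y" by (rule order_trans[rotated])
qed

lemma eps1_le_heavy:
  assumes b: "beta p > 1" and f: "Hoelder (beta p) (Lc p) f" and Y: "tame f Y"
  shows "eps1 (Cbeta p * h powr (beta p - 1)) f \<le> real (card {I\<in>{1..n}. heavy (Phi p \<alpha> n Y) n I}) / real n"
proof -
  let ?hs = "h powr (beta p - 1)" and ?N = "real n * h"
  \<comment> \<open>The window reaches distance \<open>h\<close>. Its outer half, at distances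
    between h/2 and h, fires; rounding costs less than one index, and \<open>d \<ge> 20\<close>
    keeps the share at 2/5.\<close>
  define d where "d = nat \<lfloor>?N\<rfloor>"
  have dN: "real d \<le> ?N" "?N < real d + 1" using nh_pos unfolding d_def by linarith+
  have d20: "d \<ge> 20" using nh unfolding d_def by linarith
  let ?G = "{J\<in>{1..d}. ?N / 2 \<le> real J}"
  have "{nat \<lceil>?N / 2\<rceil>..d} \<subseteq> ?G" using nh by auto
  then have "card {nat \<lceil>?N / 2\<rceil>..d} \<le> card ?G" by (intro card_mono) auto
  moreover have "real (card {nat \<lceil>?N / 2\<rceil>..d}) \<ge> 2 / 5 * real d"
  proof -
    have "real (nat \<lceil>?N / 2\<rceil>) \<le> ?N / 2 + 1" using nh_pos by linarith
    then have "real d + 1 - real (nat \<lceil>?N / 2\<rceil>) \<ge> 2 / 5 * real d" using dN d20 by linarith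
    then show ?thesis by simp
  qed
  ultimately have G: "2 / 5 * real d \<le> real (card ?G)" by linarith
  have d14: "real d \<le> real n / 4"
  proof -
    have "?N \<le> real n * (1 / 4)" by (intro mult_left_mono h_small) simp
    then show ?thesis using dN by linarith
  qed
  have gapd: "h / 2 \<le> real J / real n" "real J / real n \<le> h" if "J \<in> ?G" for J
  proof -
    have "?N / 2 \<le> real J" "real J \<le> ?N" using that dN by auto
    then show "h / 2 \<le> real J / real n" "real J / real n \<le> h" using n_gt by (auto simp: field_simps)
  qed
  \<comment> \<open>By \<open>d \<le> n/4\<close> the window fits on at least one side of every
    index; the right side is preferred.\<close>
  have heavy: "heavy (Phi p \<alpha> n Y) n i"
    if i: "i \<in> {1..n}" and slope: "dF f (xd n i) \<le> - (Cbeta p - Lc p) * ?hs" for i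
  proof (cases "d \<le> n - i")
    case True
    have "Phi p \<alpha> n Y i (i + J)" if J: "J \<in> ?G" for J
    proof (rule Phi_fires_descent[OF b f Y i, where c="xd n i"])
      show "i + J \<in> {1..n}" using J True i by auto
      have "xd n (i + J) - xd n i = real J / real n" by (simp add: xd_def add_divide_distrib)
      then show "h / 2 \<le> xd n (i + J) - xd n i" "xd n (i + J) - xd n i \<le> h" using gapd[OF J] by simp_all
    qed (use slope in auto)
    then have "?G \<subseteq> {J\<in>{1..d}. Phi p \<alpha> n Y i (i + J)}" by blast
    then have "card ?G \<le> card {J\<in>{1..d}. Phi p \<alpha> n Y i (i + J)}" by (intro card_mono) auto
    then have "2 / 5 * real d \<le> real (card {J\<in>{1..d}. Phi p \<alpha> n Y i (i + J)})" using G by linarith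
    then show ?thesis unfolding heavy_def heavy_fwd_def using True d20 by (intro disjI1 exI[of _ d]) auto
  next
    case False
    then have di: "d \<le> i - 1"
    proof -
      have "real n - real i < real d" using False i by auto
      then have "2 * real d < real i" using d14 d20 by linarith
      then show ?thesis by linarith
    qed
    have "Phi p \<alpha> n Y (i - J) i" if J: "J \<in> ?G" for J
    proof (rule Phi_fires_descent[OF b f Y _ i, where c="xd n i"])
      show "i - J \<in> {1..n}" using J di i by auto
      have "xd n i - xd n (i - J) = real J / real n"
      proof -
        have "J \<le> i" using J di i by auto
        then show ?thesis by (simp add: xd_def of_nat_diff diff_divide_distrib)
      qed
      then show "h / 2 \<le> xd n i - xd n (i - J)" "xd n i - xd n (i - J) \<le> h" using gapd[OF J] by simp_all
    qed (use slope in auto)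
    then have "?G \<subseteq> {J\<in>{1..d}. Phi p \<alpha> n Y (i - J) i}" by blast
    then have "card ?G \<le> card {J\<in>{1..d}. Phi p \<alpha> n Y (i - J) i}" by (intro card_mono) auto
    then have "2 / 5 * real d \<le> real (card {J\<in>{1..d}. Phi p \<alpha> n Y (i - J) i})" using G by linarith
    then show ?thesis unfolding heavy_def heavy_bwd_def using di d20 by (intro disjI2 exI[of _ d]) auto
  qed
  have "eps1 (Cbeta p * ?hs) f
      \<le> real (card {i\<in>{1..n}. dF f (xd n i) \<le> - (Cbeta p * ?hs - Lc p * ?hs)}) / real n"
  proof (rule eps1_le_cells[OF n_ge])
    fix x y :: real assume xy: "x \<in> {0..1}" "y \<in> {0..1}" "\<bar>x - y\<bar> \<le> 1 / real n"
    have "Lc p * \<bar>x - y\<bar> powr (beta p - 1) \<le> Lc p * ?hs"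
      using xy(3) h_ge L b by (intro mult_left_mono powr_mono2) auto
    moreover have "\<bar>dF f x - dF f y\<bar> \<le> Lc p * \<bar>x - y\<bar> powr (beta p - 1)"
      using Hoelder_high(2)[OF b f] xy by blast
    ultimately show "\<bar>dF f x - dF f y\<bar> \<le> Lc p * ?hs" by linarith
  qed
  also have "\<dots> \<le> real (card {I\<in>{1..n}. heavy (Phi p \<alpha> n Y) n I}) / real n"
    using heavy by (intro divide_right_mono of_nat_mono card_mono) (auto simp: algebra_simps)
  finally show ?thesis .
qed

end

section \<open>Running time and detection probability\<close>

context fomt_regime
begin

lemma smexp_eq: "beta p \<le> 1 \<Longrightarrow> smexp p = beta p" "beta p > 1 \<Longrightarrow> smexp p = beta p - 1"
  using kord_cases[OF beta] by (fastforce simp: smexp_def)+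

lemma Cbeta_nonneg: "Cbeta p \<ge> 0"
proof (cases "beta p \<le> 1")
  case True
  show ?thesis unfolding Cbeta_eq(1)[OF True]
    using L noise_scale_pos by (intro add_nonneg_nonneg mult_nonneg_nonneg) auto
next
  case False
  then have b: "beta p > 1" by simp
  have "L2 p \<ge> 0" using kernel_facts[OF K] cb_pos[OF beta(1)] by (simp add: L2_def)
  then show ?thesis unfolding Cbeta_eq(2)[OF b]
    using L noise_scale_pos lam0 by (intro add_nonneg_nonneg mult_nonneg_nonneg divide_nonneg_nonneg) auto
qed

abbreviation eps where
  "eps f \<equiv> epsk (kord p) (Cbeta p * h powr smexp p) f"

lemma eps_le_heavy:
  assumes "Hoelder (beta p) (Lc p) f" "tame f Y"
  shows "eps f \<le> real (card {I\<in>{1..n}. heavy (Phi p \<alpha> n Y) n I}) / real n"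
  using beta
proof (cases rule: kord_cases)
  case 1
  then show ?thesis using eps0_le_heavy[OF _ assms] by (simp add: epsk_def smexp_eq)
next
  case 2
  then show ?thesis using eps1_le_heavy[OF _ assms] by (simp add: epsk_def smexp_eq)
qed

lemma h_powr_smexp:
  "h powr smexp p = Ch p powr smexp p * (ln (real n) / real n) powr (smexp p / (2 * beta p + 1))"
  using Ch_pos n_gt ln_n by (simp add: hn_def powr_mult powr_powr)

text \<open>The factor C_h^s and the rate combine to \<open>h powr smexp p\<close>, so the
  separation is 2 \<gamma>_n + 2 L h^s in disguise, as required by \<open>eps0_ge\<close> and more
  than enough for \<open>eps1_ge\<close>.\<close>

lemma eps_ge:
  assumes f: "f \<in> Fclass (beta p) (Lc p) ((2 * Cbeta p + 2 * Lc p) * Ch p powr smexp p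
                   * (ln (real n) / real n) powr (smexp p / (2 * beta p + 1)))"
  shows "Hoelder (beta p) (Lc p) f" "eps f \<ge> h"
proof -
  show H: "Hoelder (beta p) (Lc p) f" using f by (simp add: Fclass_def)
  have f': "f \<in> Fclass (beta p) (Lc p) ((2 * Cbeta p + 2 * Lc p) * h powr smexp p)"
    using f by (simp add: h_powr_smexp mult.assoc)
  have h2: "h \<le> 1 / 2" using h_small by linarith
  show "eps f \<ge> h"
    using beta
  proof (cases rule: kord_cases)
    case 1
    then obtain a c where ac: "0 \<le> a" "a < c" "c \<le> 1" "f a - f c \<ge> (2 * Cbeta p + 2 * Lc p) * h powr beta p"
      using f' by (auto simp: Fclass_def smexp_eq)
    have "h \<le> eps0 (Cbeta p * h powr beta p) f"
    proof (rule eps0_ge[OF beta(1) 1(1) L h_pos h2 _ _ ac(1-3)])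
      show "2 * (Cbeta p * h powr beta p) + 2 * Lc p * h powr beta p \<le> f a - f c"
        using ac(4) by (simp add: distrib_right mult.assoc)
    qed (use Cbeta_nonneg Hoelder_low[OF 1(1) H] in auto)
    then show ?thesis using 1 by (simp add: epsk_def smexp_eq)
  next
    case 2
    then obtain c where c: "c \<in> {0..1}" "dF f c \<le> - ((2 * Cbeta p + 2 * Lc p) * h powr (beta p - 1))"
      using f' by (auto simp: Fclass_def smexp_eq)
    have "h \<le> eps1 (Cbeta p * h powr (beta p - 1)) f"
    proof (rule eps1_ge[OF _ L h_pos h2 _ c(1)])
      have "(Cbeta p + Lc p) * h powr (beta p - 1) \<le> (2 * Cbeta p + 2 * Lc p) * h powr (beta p - 1)"
        using Cbeta_nonneg L by (intro mult_right_mono) auto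
      then show "dF f c \<le> - (Cbeta p * h powr (beta p - 1) + Lc p * h powr (beta p - 1))"
        using c(2) by (simp add: distrib_right)
    qed (use 2 Hoelder_high(2)[OF 2(1) H] in auto)
    then show ?thesis using 2 by (simp add: epsk_def smexp_eq)
  qed
qed

section \<open>Cost of one round and of the whole run\<close>

abbreviation trial where
  "trial Y \<equiv> fomt_round (nat \<lceil>20 * ln (real n)\<rceil>) (Phi p \<alpha> n Y) (test_cost n h) n"

text \<open>The number 841 is 2 * 21 * 4 * 5 + 1: two scans, at most 21 log n repetitions, at most 4
  log n levels, at most 5 n h operations per level, and one draw of the index.\<close>

definition trial_cost :: real where
  "trial_cost = 841 * (real n * h) * (ln (real n))\<^sup>2"

lemma trial_cost_pos: "trial_cost > 0"
  using n_gt h_pos ln_n unfolding trial_cost_def by (intro mult_pos_pos zero_less_power) auto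

lemma cost_le_trial: "cost_le trial_cost (trial Y)"
proof -
  let ?m = "nat \<lceil>20 * ln (real n)\<rceil>" and ?l = "ln (real n)" and ?T = "4 * (real n * h) + 5"
  have "cost_le (2 * real ?m * (log 2 (real n) + 2) * (1 + ?T) + 1) (trial Y)"
    using n_ge h_pos nh_pos by (intro cost_le_round test_cost_le) auto
  moreover have "2 * real ?m * (log 2 (real n) + 2) * (1 + ?T) + 1 \<le> trial_cost"
  proof -
    have m: "real ?m \<le> 21 * ?l" using ln_n by linarith
    \<comment> \<open>From e \<le> 4; it bounds the binary logarithm by twice the natural
      one.\<close>
    have "1 \<le> 2 * ln (2::real)"
    proof -
      have "exp 1 \<le> (2 ^ 2 :: real)" using exp_le by simp
      then have "1 \<le> ln (2 ^ 2 :: real)" using ln_ge_iff[of "2 ^ 2" 1] by simp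
      also have "ln (2 ^ 2 :: real) = 2 * ln 2" by (subst ln_realpow) simp_all
      finally show ?thesis .
    qed
    then have "?l / ln 2 \<le> 2 * ?l" using ln_n by (simp add: divide_le_eq)
    then have l: "log 2 (real n) + 2 \<le> 4 * ?l" using ln_n by (simp add: log_def)
    have T: "1 + ?T \<le> 5 * (real n * h)" using nh by linarith
    have l0: "0 \<le> log 2 (real n) + 2" using n_gt by simp
    have "2 * real ?m * (log 2 (real n) + 2) * (1 + ?T) \<le> 2 * (21 * ?l) * (4 * ?l) * (5 * (real n * h))"
      using m l T l0 ln_n nh_pos by (intro mult_mono mult_nonneg_nonneg mult_left_mono) auto
    also have "\<dots> = 840 * (real n * h) * ?l\<^sup>2" by (simp add: power2_eq_square)
    finally have "2 * real ?m * (log 2 (real n) + 2) * (1 + ?T) \<le> 840 * (real n * h) * ?l\<^sup>2" .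
    moreover have "1 \<le> (real n * h) * ?l\<^sup>2"
    proof -
      have "1 * 1 \<le> (real n * h) * ?l\<^sup>2" using nh ln_n by (intro mult_mono) auto
      then show ?thesis by simp
    qed
    moreover have "trial_cost = 840 * (real n * h) * ?l\<^sup>2 + (real n * h) * ?l\<^sup>2" by (simp add: trial_cost_def)
    ultimately show ?thesis by linarith
  qed
  ultimately show ?thesis by (rule cost_le_mono)
qed

lemma Cn_eq: "Cn p \<alpha> n = 2 * ln (2 / \<alpha>) / h"
  using alpha by (simp add: Cn_def ln_div)

lemma ln_alpha: "ln (2 / \<alpha>) > 0"
  using alpha by simp

text \<open>The number of rounds is of order 1/h and a round costs order n h (log n)^2, so the
  bandwidth cancels.\<close>

lemma FOMT_cost: "cost_le ((2 * ln (2 / \<alpha>) + 1) * 841 * real n * (ln (real n))\<^sup>2) (FOMT p \<alpha> n Y)"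
proof -
  let ?R = "nat \<lceil>Cn p \<alpha> n\<rceil>"
  have "cost_le (real ?R * trial_cost) (FOMT p \<alpha> n Y)"
    unfolding FOMT_eq_rep_round using cost_le_trial trial_cost_pos by (intro cost_le_rep) auto
  moreover have "real ?R * trial_cost \<le> (2 * ln (2 / \<alpha>) + 1) / h * trial_cost"
  proof -
    have "0 < Cn p \<alpha> n" unfolding Cn_eq using ln_alpha h_pos by simp
    then have "real ?R \<le> Cn p \<alpha> n + 1" by linarith
    also have "\<dots> \<le> (2 * ln (2 / \<alpha>) + 1) / h"
      unfolding Cn_eq using h_pos h_small by (simp add: add_divide_distrib le_divide_eq)
    finally show ?thesis using trial_cost_pos by (intro mult_right_mono) auto
  qed
  moreover have "(2 * ln (2 / \<alpha>) + 1) / h * trial_cost = (2 * ln (2 / \<alpha>) + 1) * 841 * real n * (ln (real n))\<^sup>2"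
    using h_pos by (simp add: trial_cost_def)
  ultimately show ?thesis by (metis cost_le_mono)
qed

text \<open>A round is silent with probability at most exp(-e/2), so \<open>M\<close> rounds, about
  2 log(2/\<alpha>) / e, leave \<alpha>/2. The bound \<open>eps f \<ge> h\<close> gives
  \<open>M \<le> R\<close>, and \<open>e \<le> 1\<close> absorbs the rounding of \<open>M\<close>
  into the budget.\<close>

lemma detection_given_tame:
  assumes f: "Hoelder (beta p) (Lc p) f" and \<epsilon>: "eps f \<ge> h" and Y: "tame f Y"
    and B: "B \<ge> (2 * ln (2 / \<alpha>) + 1) / eps f * trial_cost"
  shows "measure_pmf.prob (FOMT p \<alpha> n Y) {r. fst r \<and> real (snd r) \<le> B} \<ge> 1 - \<alpha> / 2"
proof -
  define e where "e = eps f"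
  define M where "M = nat \<lceil>2 * ln (2 / \<alpha>) / e\<rceil>"
  define R where "R = nat \<lceil>Cn p \<alpha> n\<rceil>"
  have e0: "e > 0" using \<epsilon> h_pos by (simp add: e_def)
  define q where "q = real (card {I\<in>{1..n}. heavy (Phi p \<alpha> n Y) n I}) / real n"
  have e_heavy: "e \<le> q"
    unfolding e_def q_def by (rule eps_le_heavy[OF f Y])
  have "card {I\<in>{1..n}. heavy (Phi p \<alpha> n Y) n I} \<le> card {1..n}" by (intro card_mono) auto
  then have "q \<le> 1" using n_gt by (simp add: q_def divide_le_eq)
  then have e1: "e \<le> 1" using e_heavy by linarith
  have "2 * ln (2 / \<alpha>) / e \<le> Cn p \<alpha> n"
    unfolding Cn_eq using \<epsilon> h_pos ln_alpha by (intro divide_left_mono) (auto simp: e_def)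
  then have MR: "M \<le> R" unfolding M_def R_def by (intro nat_mono ceiling_mono)
  have x0: "0 < 2 * ln (2 / \<alpha>) / e" using ln_alpha e0 by simp
  have M1: "2 * ln (2 / \<alpha>) / e \<le> real M" "real M \<le> 2 * ln (2 / \<alpha>) / e + 1"
    using x0 unfolding M_def by linarith+
  have "real M \<le> (2 * ln (2 / \<alpha>) + 1) / e"
  proof -
    have "1 \<le> 1 / e" using e0 e1 by simp
    then show ?thesis using M1(2) by (simp add: add_divide_distrib)
  qed
  then have MB: "real M * trial_cost \<le> B"
    using B mult_right_mono[of "real M" "(2 * ln (2 / \<alpha>) + 1) / e" trial_cost] trial_cost_pos
    by (simp add: e_def)
  have "4 \<le> nat \<lceil>20 * ln (real n)\<rceil>" using ln_n by linarith
  from silent_round_le[OF n_ge this, of "Phi p \<alpha> n Y" "test_cost n h"]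
  have "silent (trial Y) \<le> 1 - q / 2" unfolding q_def .
  also have "\<dots> \<le> 1 - e / 2" using e_heavy by simp
  also have "\<dots> \<le> exp (- (e / 2))" using exp_ge_add_one_self[of "- (e / 2)"] by simp
  finally have "silent (trial Y) ^ M \<le> exp (- (e / 2)) ^ M"
    by (intro power_mono silent_nonneg)
  also have "\<dots> = exp (- (real M * e / 2))" by (simp flip: exp_of_nat_mult)
  also have "\<dots> \<le> exp (- ln (2 / \<alpha>))"
    using M1(1) e0 by (simp add: divide_le_eq)
  also have "\<dots> = \<alpha> / 2" using alpha by (simp add: exp_minus)
  finally have "silent (trial Y) ^ M \<le> \<alpha> / 2" .
  moreover have "miss (real M * trial_cost) (FOMT p \<alpha> n Y) \<le> silent (trial Y) ^ M"
    unfolding FOMT_eq_rep_round R_def[symmetric]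
    by (rule miss_rep_le[OF cost_le_trial _ MR]) (use trial_cost_pos in simp)
  ultimately have miss: "miss (real M * trial_cost) (FOMT p \<alpha> n Y) \<le> \<alpha> / 2" by linarith
  have "1 - miss (real M * trial_cost) (FOMT p \<alpha> n Y)
      = measure_pmf.prob (FOMT p \<alpha> n Y) {r. fst r \<and> real (snd r) \<le> real M * trial_cost}"
    unfolding miss_def by (subst measure_pmf.prob_compl[symmetric]) (auto intro!: arg_cong[where f="measure_pmf.prob _"])
  also have "\<dots> \<le> measure_pmf.prob (FOMT p \<alpha> n Y) {r. fst r \<and> real (snd r) \<le> B}"
    using MB by (intro measure_pmf.finite_measure_mono) auto
  finally show ?thesis using miss by linarith
qed

text \<open>Integration over the tame event alone gives the product of 1 - \<alpha>/2 and 1 - 1/n;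
  outside it the integrand is nonnegative.\<close>

lemma detection_probability:
  assumes f: "Hoelder (beta p) (Lc p) f" and \<epsilon>: "eps f \<ge> h"
    and B: "B \<ge> (2 * ln (2 / \<alpha>) + 1) / eps f * trial_cost"
  shows "(\<integral>Y. measure_pmf.prob (FOMT p \<alpha> n Y) {r. fst r \<and> real (snd r) \<le> B} \<partial>data (sigma p) n f)
    \<ge> 1 - \<alpha> / 2 - 1 / real n"
proof -
  let ?M = "data (sigma p) n f" and ?E = "{Y\<in>space (data (sigma p) n f). tame f Y}"
  let ?P = "\<lambda>Y. measure_pmf.prob (FOMT p \<alpha> n Y) {r. fst r \<and> real (snd r) \<le> B}"
  interpret D: prob_space ?M by (rule prob_space_data[OF sig])
  have "(1 - \<alpha> / 2) * D.prob ?E = (\<integral>Y. (1 - \<alpha> / 2) * indicator ?E Y \<partial>?M)"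
    using tame_measurable[of f] by simp
  also have "\<dots> \<le> (\<integral>Y. ?P Y \<partial>?M)"
  proof (rule integral_mono)
    show "integrable ?M (\<lambda>Y. (1 - \<alpha> / 2) * indicator ?E Y)"
      using tame_measurable[of f] by (intro integrable_mult_right integrable_real_indicator) (auto simp: D.emeasure_eq_measure)
    show "integrable ?M ?P"
      by (rule D.integrable_const_bound[where B=1]) (auto intro: FOMT_prob_measurable[OF n_ge])
    fix Y assume "Y \<in> space ?M"
    then show "(1 - \<alpha> / 2) * indicator ?E Y \<le> ?P Y"
      using detection_given_tame[OF f \<epsilon> _ B, of Y] by (auto simp: indicator_def)
  qed
  finally have "(1 - \<alpha> / 2) * D.prob ?E \<le> (\<integral>Y. ?P Y \<partial>?M)" .
  moreover have "(1 - \<alpha> / 2) * (1 - 1 / real n) \<le> (1 - \<alpha> / 2) * D.prob ?E"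
    using prob_tame[of f] alpha by (intro mult_left_mono) auto
  moreover have "1 - \<alpha> / 2 - 1 / real n \<le> (1 - \<alpha> / 2) * (1 - 1 / real n)"
  proof -
    have "(1 - \<alpha> / 2) * (1 / real n) \<le> 1 * (1 / real n)" using alpha by (intro mult_right_mono) auto
    then show ?thesis by (simp only: right_diff_distrib mult_1_right mult_1_left)
  qed
  ultimately show ?thesis by linarith
qed

lemma trial_cost_eq:
  "trial_cost = 841 * Ch p * real n powr (2 * beta p / (2 * beta p + 1))
     * ln (real n) powr ((4 * beta p + 3) / (2 * beta p + 1))"
proof -
  define \<kappa> where "\<kappa> = 1 / (2 * beta p + 1)"
  have d: "2 * beta p + 1 > 0" using beta by simp
  have e1: "2 * beta p / (2 * beta p + 1) = 1 - \<kappa>" and e2: "(4 * beta p + 3) / (2 * beta p + 1) = \<kappa> + 2"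
    using d by (simp_all add: \<kappa>_def field_simps)
  have "real n * h = Ch p * real n powr (1 - \<kappa>) * ln (real n) powr \<kappa>"
    using n_gt ln_n unfolding hn_def \<kappa>_def[symmetric] by (simp add: powr_divide powr_diff)
  moreover have "ln (real n) powr (\<kappa> + 2) = ln (real n) powr \<kappa> * (ln (real n))\<^sup>2"
    using ln_n by (simp add: powr_add powr_numeral)
  ultimately show ?thesis unfolding e1 e2 trial_cost_def by simp
qed

end

text \<open>For the lower bound on n h the logarithm is dropped, leaving a positive power of n. Then
  1/h \<le> n/20 makes \<open>Nmax\<close> of order n (log n)^2, eventually below \<alpha>
  n^2.\<close>

lemma (in fomt_params) eventually_fomt_regime:
  assumes alpha: "0 < \<alpha>" "\<alpha> < 1"
    and eig: "\<forall>\<^sub>F n in sequentially. \<forall>x\<in>{0..1}. \<forall>e. eigenvalue (Bmat p n (hn p n) x) e \<longrightarrow> lam0 p \<le> e"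
  shows "\<forall>\<^sub>F n in sequentially. fomt_regime p \<alpha> n"
proof -
  define \<kappa> where "\<kappa> = 1 / (2 * beta p + 1)"
  have \<kappa>: "0 < \<kappa>" "\<kappa> < 1" using beta by (simp_all add: \<kappa>_def)
  have hn: "hn p n = Ch p * (ln (real n) / real n) powr \<kappa>" for n by (simp add: hn_def \<kappa>_def)
  have "(\<lambda>n. ln (real n) / real n) \<longlonglongrightarrow> 0" by real_asymp
  then have "(\<lambda>n. (ln (real n) / real n) powr \<kappa>) \<longlonglongrightarrow> 0"
  proof (rule tendsto_zero_powrI[where b=\<kappa>])
    show "\<forall>\<^sub>F n in sequentially. 0 \<le> ln (real n) / real n" by real_asymp
  qed (use \<kappa> in auto)
  then have "(\<lambda>n. hn p n) \<longlonglongrightarrow> 0" unfolding hn by (rule tendsto_mult_right_zero)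
  then have h: "\<forall>\<^sub>F n in sequentially. hn p n < 1 / 4" by (rule order_tendstoD) simp
  have ln1: "\<forall>\<^sub>F n in sequentially. ln (real n) \<ge> 1" by real_asymp
  have "filterlim (\<lambda>n. Ch p * real n powr (1 - \<kappa>)) at_top sequentially" using Ch_pos \<kappa> by real_asymp
  then have "\<forall>\<^sub>F n in sequentially. 20 \<le> Ch p * real n powr (1 - \<kappa>)" by (simp add: filterlim_at_top)
  then have nh: "\<forall>\<^sub>F n in sequentially. 20 \<le> real n * hn p n"
    using ln1
  proof eventually_elim
    case (elim n)
    have n0: "real n > 0" using elim(2) by (cases n) auto
    have "(1 / real n) powr \<kappa> \<le> (ln (real n) / real n) powr \<kappa>"
      using elim n0 \<kappa> by (intro powr_mono2 divide_right_mono) auto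
    then have "real n * (Ch p * (1 / real n) powr \<kappa>) \<le> real n * hn p n"
      unfolding hn using Ch_pos n0 by (intro mult_left_mono) auto
    moreover have "real n * (Ch p * (1 / real n) powr \<kappa>) = Ch p * real n powr (1 - \<kappa>)"
      using n0 by (simp add: powr_divide powr_diff)
    ultimately show ?case using elim(1) by linarith
  qed
  \<comment> \<open>The coefficient 4 is 40 * 2 / 20, with 1/20 from the bound on 1/h.\<close>
  define c where "c = 4 * ln (2 / \<alpha>) / ln 2"
  have "(\<lambda>n. c * (ln (real n))\<^sup>2 / real n) \<longlonglongrightarrow> 0" by real_asymp
  then have "\<forall>\<^sub>F n in sequentially. c * (ln (real n))\<^sup>2 / real n < \<alpha>" by (rule order_tendstoD) (use alpha in simp)
  then have Nm: "\<forall>\<^sub>F n in sequentially. Nmax p \<alpha> n \<le> \<alpha> * (real n)\<^sup>2"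
    using nh ln1
  proof eventually_elim
    case (elim n)
    have n0: "real n > 0" using elim(3) by (cases n) auto
    have la: "ln (2 / \<alpha>) > 0" using alpha by simp
    have "1 / hn p n \<le> real n / 20"
    proof -
      have "hn p n > 0" using elim(2) n0 by (smt (verit) mult_nonneg_nonpos)
      then show ?thesis using elim(2) by (simp add: field_simps)
    qed
    then have "40 / ln 2 * (2 * ln (2 / \<alpha>)) * (ln (real n))\<^sup>2 * (1 / hn p n)
        \<le> 40 / ln 2 * (2 * ln (2 / \<alpha>)) * (ln (real n))\<^sup>2 * (real n / 20)"
      using la by (intro mult_left_mono mult_nonneg_nonneg) auto
    also have "\<dots> = c * (ln (real n))\<^sup>2 * real n" by (simp add: c_def)
    also have "\<dots> \<le> (\<alpha> * real n) * real n"
      using elim(1) n0 by (intro mult_right_mono) (auto simp: divide_less_eq)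
    finally have "40 / ln 2 * (2 * ln (2 / \<alpha>)) * (ln (real n))\<^sup>2 * (1 / hn p n) \<le> \<alpha> * (real n)\<^sup>2"
      by (simp add: power2_eq_square mult.assoc)
    moreover have "Nmax p \<alpha> n = 40 / ln 2 * (2 * ln (2 / \<alpha>)) * (ln (real n))\<^sup>2 * (1 / hn p n)"
    proof -
      have "Cn p \<alpha> n = 2 * ln (2 / \<alpha>) * (1 / hn p n)" using alpha by (simp add: Cn_def ln_div)
      then show ?thesis unfolding Nmax_def by simp
    qed
    ultimately show ?case by simp
  qed
  show ?thesis
    using h ln1 nh Nm eig
  proof eventually_elim
    case (elim n)
    then show ?case using alpha
      by (intro fomt_regime.intro fomt_params_axioms fomt_regime_axioms.intro) auto
  qed
qed

text \<open>Part (i) bounds every run in the support, whatever the data. In part (ii) the constant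
  is common to all f and all \<eta>; only the threshold on n depends on \<eta>, through 1/n <
  \<eta>.\<close>

theorem mainTheorem4:
  fixes p :: params and \<alpha> :: real
  assumes beta: "0 < beta p" "beta p \<le> 2"
    and L: "Lc p > 0" and sig: "sigma p > 0"
    and K: "kernel_assms p"
    and alpha: "0 < \<alpha>" "\<alpha> < 1"
    and lam0: "lam0 p > 0"
    and lam0_eig: "\<forall>\<^sub>F n in sequentially. \<forall>x\<in>{0..1}. \<forall>e.
                     eigenvalue (Bmat p n (hn p n) x) e \<longrightarrow> lam0 p \<le> e"
  shows
    "(\<exists>c. \<forall>\<^sub>F n in sequentially. \<forall>f. Hoelder (beta p) (Lc p) f \<longrightarrow>
        (\<forall>Y. \<forall>r\<in>set_pmf (FOMT p \<alpha> n Y). real (snd r) \<le> c * real n * (ln (real n))\<^sup>2))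
     \<and>
     (\<exists>c. \<forall>\<eta>>0. \<forall>\<^sub>F n in sequentially.
        \<forall>f\<in>Fclass (beta p) (Lc p) ((2 * Cbeta p + 2 * Lc p) * Ch p powr smexp p
                                      * (ln (real n) / real n) powr (smexp p / (2 * beta p + 1))).
          (\<integral>Y. measure_pmf.prob (FOMT p \<alpha> n Y)
                 {r. fst r \<and> real (snd r) \<le>
                     c * (1 / epsk (kord p) (Cbeta p * hn p n powr smexp p) f)
                       * real n powr (2 * beta p / (2 * beta p + 1))
                       * ln (real n) powr ((4 * beta p + 3) / (2 * beta p + 1))}
           \<partial>data (sigma p) n f) \<ge> 1 - \<alpha> - \<eta>)"
proof -
  interpret fomt_params p
    using beta L sig K lam0 by unfold_locales
  note regime = eventually_fomt_regime[OF alpha lam0_eig]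
  have "\<forall>\<^sub>F n in sequentially. \<forall>f. Hoelder (beta p) (Lc p) f \<longrightarrow> (\<forall>Y. \<forall>r\<in>set_pmf (FOMT p \<alpha> n Y).
      real (snd r) \<le> ((2 * ln (2 / \<alpha>) + 1) * 841) * real n * (ln (real n))\<^sup>2)"
    using regime
  proof eventually_elim
    case (elim n)
    show ?case using fomt_regime.FOMT_cost[OF elim] unfolding cost_le_def by blast
  qed
  moreover have "\<forall>\<^sub>F n in sequentially.
        \<forall>f\<in>Fclass (beta p) (Lc p) ((2 * Cbeta p + 2 * Lc p) * Ch p powr smexp p
                                      * (ln (real n) / real n) powr (smexp p / (2 * beta p + 1))).
          (\<integral>Y. measure_pmf.prob (FOMT p \<alpha> n Y)
                 {r. fst r \<and> real (snd r) \<le>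
                     ((2 * ln (2 / \<alpha>) + 1) * 841 * Ch p) * (1 / epsk (kord p) (Cbeta p * hn p n powr smexp p) f)
                       * real n powr (2 * beta p / (2 * beta p + 1))
                       * ln (real n) powr ((4 * beta p + 3) / (2 * beta p + 1))}
           \<partial>data (sigma p) n f) \<ge> 1 - \<alpha> - \<eta>" if "\<eta> > 0" for \<eta>
  proof -
    have "(\<lambda>n. 1 / real n) \<longlonglongrightarrow> 0" by real_asymp
    then have "\<forall>\<^sub>F n in sequentially. 1 / real n < \<eta>" by (rule order_tendstoD) (rule that)
    with regime show ?thesis
    proof eventually_elim
      case (elim n)
      interpret fomt_regime p \<alpha> n by (rule elim(1))
      show ?case
      proof
        fix f assume f: "f \<in> Fclass (beta p) (Lc p) ((2 * Cbeta p + 2 * Lc p) * Ch p powr smexp p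
                                      * (ln (real n) / real n) powr (smexp p / (2 * beta p + 1)))"
        have "(2 * ln (2 / \<alpha>) + 1) / eps f * trial_cost
            \<le> ((2 * ln (2 / \<alpha>) + 1) * 841 * Ch p) * (1 / eps f)
                       * real n powr (2 * beta p / (2 * beta p + 1))
                       * ln (real n) powr ((4 * beta p + 3) / (2 * beta p + 1))"
          unfolding trial_cost_eq by (simp only: divide_inverse mult_ac mult_1_left order_refl)
        from detection_probability[OF eps_ge[OF f] this] elim(2) alpha
        show "1 - \<alpha> - \<eta> \<le> (\<integral>Y. measure_pmf.prob (FOMT p \<alpha> n Y)
                 {r. fst r \<and> real (snd r) \<le>
                     ((2 * ln (2 / \<alpha>) + 1) * 841 * Ch p) * (1 / epsk (kord p) (Cbeta p * hn p n powr smexp p) f)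
                       * real n powr (2 * beta p / (2 * beta p + 1))
                       * ln (real n) powr ((4 * beta p + 3) / (2 * beta p + 1))}
           \<partial>data (sigma p) n f)"
          by linarith
      qed
    qed
  qed
  ultimately show ?thesis by blast
qed

end
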